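(* Let $q, r \geq 1$ be integers and let $\widehat{V}\colon [0,\infty) \to \mathbb{R}$ be continuous with $$\lim_{x \to \infty} \bigl(\widehat{V}(x) - \log(1+x^2)\bigr) = +\infty.$$ Then there is a unique vector $(\nu_{-q+1}^*, \ldots, \nu_{-1}^*, \nu_0^*, \nu_1^*, \ldots, \nu_{r-1}^* )$ of $q+r-1$ measures that minimizes the energy functional $$\sum_{j=-q+1}^{r-1} I(\nu_j) - \sum_{j=-q+1}^{r-2} I(\nu_j, \nu_{j+1}) + \int \widehat{V} \, d\nu_0$$ among all vectors $(\nu_{-q+1},\ldots,\nu_{r-1})$ of positive Borel measures satisfying, for every $j = -q+1, \ldots, r-1$: (i) $\operatorname{supp}(\nu_j) \subset \Delta_j$, (ii) $\nu_j(\Delta_j) = m_j$, where $m_j = 1 - \frac{j}{r}$ if $j \geq 0$ and $m_j = 1 - \frac{|j|}{q}$ if $j \leq 0$, (iii) $I(\nu_j) < +\infty$. Moreover, the measure $\nu_0^*$ has compact support and it is the unique minimizer of the functional $$\frac{1}{2} \iint \log \frac{1}{|x^{1/q}-y^{1/q}|} \, d\nu(x) d\nu(y) + \frac{1}{2} \iint \log \frac{1}{|x^{1/r} - y^{1/r}|} \, d\nu(x) d\nu(y) + \int \widehat{V}(x) \, d\nu(x)$$ among all probability measures $\nu$ on $[0,\infty)$; and the measure $\mu_0^*$ given by $d\mu_0^*(x) = d\nu_0^*(x^q)$ is the unique minimizer of $$\frac{1}{2} \iint \log \frac{1}{|x-y|} \, d\mu(x) d\mu(y) + \frac{1}{2}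 \iint \log \frac{1}{|x^{\theta} - y^{\theta}|} \, d\mu(x) d\mu(y) + \int V(x) \, d\mu(x), \qquad \theta = \frac{q}{r},$$ among all probability measures $\mu$ on $[0,\infty)$, where $V(x) = \widehat{V}(x^q)$ for $x \geq 0$.
   Context: For $j \in \mathbb{Z}$, $\Delta_j = [0,\infty)$ if $j$ is even and $\Delta_j = (-\infty,0]$ if $j$ is odd. For positive Borel measures $\mu,\nu$, the logarithmic energy and the mutual energy are $$I(\mu) = \iint \log\frac{1}{|x-y|}\, d\mu(x)d\mu(y), \qquad I(\mu,\nu) = \iint \log\frac{1}{|x-y|}\, d\mu(x)d\nu(y).$$ Empty sums are $0$. The notation $d\mu_0^*(x) = d\nu_0^*(x^q)$ means that $\mu_0^*$ is the push-forward of $\nu_0^*$ under $x \mapsto x^{1/q}$, i.e. $\mu_0^*(A) = \nu_0^*(\{x^q : x \in A\})$ for Borel sets $A \subset [0,\infty)$. Conventions for unbounded supports: the condition $I(\nu_j)<+\infty$ is understood as the double integral defining $I(\nu_j)$ being absolutely convergent (so that all terms $I(\nu_j), I(\nu_j,\nu_{j+1})$ of the vector functional are finite, and $\int \widehat V d\nu_0 \in (-\infty,+\infty]$). Each functional of a single probability measure on $[0,\infty)$ is understood as the integral, with values in $(-\infty,+\infty]$, of the combined kernel: for the functional of $\nu$ this is $$\frac12\log\frac{1}{|x^{1/q}-y^{1/q}|}+\frac12\log\frac{1}{|x^{1/r}-y^{1/r}|}+\frac12 \widehat V(x)+\frac12 \widehat V(y)$$ integrated against $d\nu(x)d\nu(y)$,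 and for the functional of $\mu$ it is $\frac12\log\frac{1}{|x-y|}+\frac12\log\frac{1}{|x^{\theta}-y^{\theta}|}+\frac12 V(x)+\frac12 V(y)$ integrated against $d\mu(x)d\mu(y)$. These kernels are bounded below under the growth assumption on $\widehat V$. *)

theory Defs
  imports "HOL-Probability.Probability"
begin

definition Delta :: "int \<Rightarrow> real set" where
  "Delta j = (if even j then {0..} else {..0})"

definition index_set :: "nat \<Rightarrow> nat \<Rightarrow> int set" where
  "index_set q r = {- int q + 1 .. int r - 1}"

definition mass :: "nat \<Rightarrow> nat \<Rightarrow> int \<Rightarrow> real" where
  "mass q r j = (if j \<ge> 0 then 1 - real_of_int j / real r else 1 - real_of_int \<bar>j\<bar> / real q)"

definition measure_support :: "real measure \<Rightarrow> real set" where
  "measure_support M = {x. \<forall>U. open U \<and> x \<in> U \<longrightarrow> emeasure M U > 0}"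

text \<open>Integral of an extended-real function: positive part minus negative part
  (\<^const>\<open>e2ennreal\<close> truncates negative values to 0). It is the usual integral whenever one of
  the two parts is finite; where both are infinite it carries no meaning.\<close>

definition ereal_integral :: "'a measure \<Rightarrow> ('a \<Rightarrow> ereal) \<Rightarrow> ereal" where
  "ereal_integral M f =
     enn2ereal (\<integral>\<^sup>+ x. e2ennreal (f x) \<partial>M) - enn2ereal (\<integral>\<^sup>+ x. e2ennreal (- f x) \<partial>M)"

text \<open>The diagonal value has to be set by hand, since \<^term>\<open>ln (1 / \<bar>x - x\<bar>) = (0::real)\<close> in HOL.\<close>

definition log_kernel :: "real \<Rightarrow> real \<Rightarrow> ereal" where
  "log_kernel x y = (if x = y then \<infinity> else ereal (ln (1 / \<bar>x - y\<bar>)))"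

definition mutual_energy :: "real measure \<Rightarrow> real measure \<Rightarrow> ereal" where
  "mutual_energy M N = ereal_integral (M \<Otimes>\<^sub>M N) (\<lambda>(x, y). log_kernel x y)"

definition log_energy :: "real measure \<Rightarrow> ereal" where
  "log_energy M = mutual_energy M M"

text \<open>For unbounded supports, \<open>I(M) < \<infinity>\<close> means absolute convergence of the double integral.\<close>

definition finite_log_energy :: "real measure \<Rightarrow> bool" where
  "finite_log_energy M \<longleftrightarrow>
     (\<integral>\<^sup>+ (x, y). e2ennreal \<bar>log_kernel x y\<bar> \<partial>(M \<Otimes>\<^sub>M M)) < \<infinity>"

text \<open>Vectors of measures are functions on the integers that are \<^const>\<open>undefined\<close> off the
  index set, so that equality of functions is equality of vectors.\<close>

definition admissible :: "nat \<Rightarrow> nat \<Rightarrow> (int \<Rightarrow> real measure) \<Rightarrow> bool" where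
  "admissible q r \<nu> \<longleftrightarrow>
     \<nu> \<in> extensional (index_set q r) \<and>
     (\<forall>j \<in> index_set q r.
        sets (\<nu> j) = sets borel \<and>
        measure_support (\<nu> j) \<subseteq> Delta j \<and>
        emeasure (\<nu> j) (Delta j) = ennreal (mass q r j) \<and>
        finite_log_energy (\<nu> j))"

definition vector_energy ::
    "nat \<Rightarrow> nat \<Rightarrow> (real \<Rightarrow> real) \<Rightarrow> (int \<Rightarrow> real measure) \<Rightarrow> ereal" where
  "vector_energy q r Vh \<nu> =
     (\<Sum>j \<in> index_set q r. log_energy (\<nu> j))
     - (\<Sum>j = - int q + 1 .. int r - 2. mutual_energy (\<nu> j) (\<nu> (j + 1)))
     + ereal_integral (\<nu> 0) (\<lambda>x. ereal (Vh x))"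

text \<open>Probability measures on the half-line are carried by Borel measures on the whole line;
  the values of potentials and kernels at negative arguments are irrelevant, as these form a
  null set.\<close>

definition prob_on_halfline :: "real measure \<Rightarrow> bool" where
  "prob_on_halfline M \<longleftrightarrow> sets M = sets borel \<and> prob_space M \<and> emeasure M {0..} = 1"

text \<open>The scalar functionals are integrals of the combined kernel, so that no difference of
  infinities arises for measures of unbounded support: under the growth assumption the kernels
  are bounded below on the half-line. The potential is split evenly between both variables.\<close>

definition nu_energy :: "nat \<Rightarrow> nat \<Rightarrow> (real \<Rightarrow> real) \<Rightarrow> real measure \<Rightarrow> ereal" where
  "nu_energy q r Vh M =
     ereal_integral (M \<Otimes>\<^sub>M M)
       (\<lambda>(x, y). log_kernel (root q x) (root q y) / 2
               + log_kernel (root r x) (root r y) / 2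
               + ereal (Vh x / 2) + ereal (Vh y / 2))"

definition mu_energy :: "real \<Rightarrow> (real \<Rightarrow> real) \<Rightarrow> real measure \<Rightarrow> ereal" where
  "mu_energy \<theta> V M =
     ereal_integral (M \<Otimes>\<^sub>M M)
       (\<lambda>(x, y). log_kernel x y / 2
               + log_kernel (x powr \<theta>) (y powr \<theta>) / 2
               + ereal (V x / 2) + ereal (V y / 2))"

definition is_unique_minimizer :: "('a \<Rightarrow> ereal) \<Rightarrow> ('a \<Rightarrow> bool) \<Rightarrow> 'a \<Rightarrow> bool" where
  "is_unique_minimizer F P x \<longleftrightarrow> is_arg_min F P x \<and> (\<forall>y. is_arg_min F P y \<longrightarrow> y = x)"

end

theory Submission
  imports Defs
begin

text \<open>
  The proof moves to exponential coordinates and then to the Fourier side, where the chain of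
  measures can be eliminated by completing squares.

  A measure of finite logarithmic energy has no atom at the origin, so each component of an
  admissible vector is a multiple of the image, under \<open>u \<mapsto> \<plusminus> exp u\<close>, of a probability law on the
  whole line (\<open>admissible_law_vector\<close>). In these coordinates the three kernels that occur are
  built from the same two ingredients, the covariance
  \<open>brownian u v = (\<bar>u\<bar> + \<bar>v\<bar> - \<bar>u - v\<bar>) / 2\<close> of two-sided Brownian motion and the convolution kernels
  \<open>kap a t = - ln (1 - exp (- \<bar>t\<bar> / a))\<close>: up to the terms \<open>- max u 0 - max v 0\<close>,
  which act as an external field,
   \<^item> two points on the same side interact through \<open>brownian + kap 1\<close>,
   \<^item> two points on opposite sides through \<open>brownian + kap (1/2) - kap 1\<close>,
   \<^item> the \<open>n\<close>-th roots of two positive points through \<open>brownian / n + kap n\<close>, where the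
    external field is divided by \<open>n\<close> as well.

  Both ingredients are diagonal in Fourier space. The Brownian form of a difference of two laws
  with characteristic functions \<open>f\<close> and \<open>g\<close> is the integral of \<open>\<bar>g - f\<bar>\<^sup>2 / (2 \<pi> \<xi>\<^sup>2)\<close>
  (\<open>brown_form_spectral\<close>), and the Fourier transform of \<open>kap a\<close> is
  \<open>coth (\<pi> a \<xi>) / (2 \<xi>) - 1 / (2 \<pi> a \<xi>\<^sup>2)\<close> (\<open>kap_hat_closed_form\<close>).
  Let \<open>E n M\<close> be the energy of the law \<open>M\<close> for the \<open>n\<close>-th root kernel, and let \<open>X M N\<close> be the
  mutual energy of \<open>M\<close> and \<open>N\<close> placed on opposite half-lines. With \<open>k = (n - 1) / n\<close>, the addition
  theorems of the hyperbolic functions turn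
    \<open>E 1 M - E n M - 2 k (X M N) + k\<^sup>2 (E 1 N + E (n - 1) N)\<close>
  into the integral of a positive weight times
    \<open>\<bar>k g - (sinh ((n - 1) \<pi> \<xi>) / sinh (n \<pi> \<xi>)) f\<bar>\<^sup>2\<close>,
  see \<open>defect_symbol\<close> and \<open>chain_defect_spectral\<close>. Here \<open>n\<close> is the number of measures from \<open>M\<close> to
  the end of its chain and \<open>k\<close> is the quotient of the prescribed masses of \<open>N\<close> and \<open>M\<close>. These
  identities telescope along both chains that start at \<open>\<nu>\<^sub>0\<close>, and the vector energy becomes the
  scalar energy of \<open>\<nu>\<^sub>0\<close>, with the \<open>q\<close>-th and \<open>r\<close>-th root kernels, plus half of a sum of
  nonnegative defects (\<open>chain_energy_decomposition\<close>, \<open>vector_energy_ge_nu_energy\<close>).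

  All defects vanish for exactly one continuation of a given \<open>\<nu>\<^sub>0\<close>. The law at distance \<open>j\<close> from
  \<open>\<nu>\<^sub>0\<close> in a chain of length \<open>b\<close> has characteristic function
  \<open>b sinh ((b - j) \<pi> \<xi>) / ((b - j) sinh (b \<pi> \<xi>))\<close> times that of \<open>\<nu>\<^sub>0\<close>, and the first factor
  is the characteristic function of a probability law, because the product formula for
  \<open>sinh\<close> presents it as an infinite convolution of mixtures of a Laplace law and a point mass
  (\<open>sinh_ratio_law_exists\<close>). Hence the vector problem reduces to the scalar problem for \<open>\<nu>\<^sub>0\<close>.

  In the scalar problem the growth condition absorbs the external field, which leaves a kernel
  bounded from below. A minimizer exists by tightness and lower semicontinuity,
  it is unique because the forms are positive semidefinite and \<open>kap\<close> is
  strictly so, and it has compact support because far out the kernel exceeds the minimal energy.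
  The problem for \<open>\<mu>\<close> is the image of the problem for \<open>\<nu>\<close> under the \<open>q\<close>-th root.
\<close>

section \<open>Laplace and Cauchy kernels\<close>

lemma exp_half_line_rate:
  assumes c: "c > 0"
  shows "(\<integral>\<^sup>+x. ennreal (exp (- (c * x))) * indicator {0..} x \<partial>lborel) = ennreal (1 / c)"
proof -
  have "(\<integral>\<^sup>+x. ennreal (exp (- (c * x))) * indicator {0..} x \<partial>lborel) = ennreal (0 - (- exp (- (c * 0)) / c))"
  proof (rule nn_integral_FTC_atLeast)
    show "((\<lambda>x::real. - exp (- (c * x)) / c) \<longlongrightarrow> 0) at_top"
      using c by real_asymp
  qed (use c in \<open>auto intro!: derivative_eq_intros\<close>)
  then show ?thesis by simp
qed

lemma exp_half_line_integrable:
  "integrable lborel (\<lambda>x::real. indicator {0..} x * exp (-x))"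
proof (rule integrableI_nonneg)
  have "(\<integral>\<^sup>+x. ennreal (indicator {0..} x * exp (-x)) \<partial>lborel) =
      (\<integral>\<^sup>+x. ennreal (exp (-x)) * indicator {0..} x \<partial>lborel)"
    by (intro nn_integral_cong) (auto split: split_indicator)
  then show "(\<integral>\<^sup>+x. ennreal (indicator {0..} x * exp (-x)) \<partial>lborel) < \<infinity>"
    using exp_half_line_rate[of 1] by simp
qed auto

text \<open>The Laplace law is a symmetric pair of exponential laws. Its Fourier transform is assembled
from this half, by the fundamental theorem of calculus on a half-line.\<close>

lemma exp_half_line_char:
  fixes t :: real
  shows "integrable lborel (\<lambda>x::real. (indicator {0..} x * exp (-x)) *\<^sub>R iexp (t * x))"
    and "(\<integral>x. (indicator {0..} x * exp (-x)) *\<^sub>R iexp (t * x) \<partial>lborel) = 1 / (1 - \<i> * t)"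
proof -
  let ?f = "\<lambda>x::real. exp (-x) *\<^sub>R iexp (t * x)"
  have int: "integrable lborel (\<lambda>x::real. (indicator {0..} x * exp (-x)) *\<^sub>R iexp (t * x))"
    by (rule Bochner_Integration.integrable_bound[OF exp_half_line_integrable])
       (auto simp: norm_mult split: split_indicator)
  then show "integrable lborel (\<lambda>x::real. (indicator {0..} x * exp (-x)) *\<^sub>R iexp (t * x))" .
  let ?F = "\<lambda>x::real. exp ((\<i> * t - 1) * x) / (\<i> * t - 1)"
  have nz: "\<i> * t - 1 \<noteq> 0" by (simp add: complex_eq_iff)
  have lim: "(?F \<longlongrightarrow> 0) at_top"
  proof (rule Lim_null_comparison)
    show "\<forall>\<^sub>F x in at_top. norm (?F x) \<le> exp (-x) / cmod (\<i> * t - 1)"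
      by (auto simp: norm_divide)
    show "((\<lambda>x::real. exp (-x) / cmod (\<i> * t - 1)) \<longlongrightarrow> 0) at_top"
      using nz by real_asymp
  qed
  have "(LBINT x=ereal 0..\<infinity>. ?f x) = 0 - ?F 0"
  proof (rule interval_integral_FTC_integrable)
    fix x :: real
    have e: "?f y = exp ((\<i> * t - 1) * y)" for y :: real
      by (simp add: scaleR_conv_of_real exp_of_real[symmetric] exp_add[symmetric] algebra_simps)
    have "(?F has_vector_derivative exp ((\<i> * t - 1) * x)) (at x)"
      using nz by (intro has_vector_derivative_real_field[where f = "\<lambda>z. exp ((\<i> * t - 1) * z) / (\<i> * t - 1)"])
        (auto intro!: derivative_eq_intros)
    then show "(?F has_vector_derivative ?f x) (at x)" unfolding e .
    show "isCont ?f x" by (intro continuous_intros)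
  next
    have "set_integrable lborel {0<..} ?f"
      by (rule set_integrable_subset[of _ "{0..}"]) (use int in \<open>auto simp: set_integrable_def\<close>)
    then show "set_integrable lborel (einterval (ereal 0) \<infinity>) ?f"
      by (simp add: einterval_eq_Ici einterval_eq)
    show "((?F \<circ> real_of_ereal) \<longlongrightarrow> 0) (at_left \<infinity>)"
      using lim by (simp add: ereal_tendsto_simps)
    show "((?F \<circ> real_of_ereal) \<longlongrightarrow> ?F 0) (at_right (ereal 0))"
      unfolding ereal_tendsto_simps using nz by (intro tendsto_eq_intros) auto
  qed simp
  also have "(LBINT x=ereal 0..\<infinity>. ?f x) = (\<integral>x. indicator {0<..} x *\<^sub>R ?f x \<partial>lborel)"
    by (simp add: interval_lebesgue_integral_def set_lebesgue_integral_def einterval_eq)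
  also have "\<dots> = (\<integral>x. (indicator {0..} x * exp (-x)) *\<^sub>R iexp (t * x) \<partial>lborel)"
    using AE_lborel_singleton[of 0] by (intro integral_cong_AE) (auto split: split_indicator)
  finally show "(\<integral>x. (indicator {0..} x * exp (-x)) *\<^sub>R iexp (t * x) \<partial>lborel) = 1 / (1 - \<i> * t)"
    using nz by (simp add: divide_simps) (auto simp: algebra_simps complex_eq_iff)?
qed

definition laplace_distribution :: "real measure" where
  "laplace_distribution = density lborel (\<lambda>x. ennreal (exp (- \<bar>x\<bar>) / 2))"

lemma sets_laplace [simp, measurable_cong]: "sets laplace_distribution = sets borel"
  by (simp add: laplace_distribution_def)

lemma space_laplace [simp]: "space laplace_distribution = UNIV"
  by (simp add: laplace_distribution_def)

text \<open>Reflecting the left half of the Laplace density expresses every integral through the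
exponential density on the positive half-line.\<close>

lemma laplace_split:
  fixes f :: "real \<Rightarrow> complex"
  assumes [measurable]: "f \<in> borel_measurable borel"
    and f: "integrable lborel (\<lambda>x::real. (indicator {0..} x * exp (-x)) *\<^sub>R f x)"
    and g: "integrable lborel (\<lambda>x::real. (indicator {0..} x * exp (-x)) *\<^sub>R f (-x))"
  shows "integrable laplace_distribution f"
    and "(\<integral>x. f x \<partial>laplace_distribution) =
      ((\<integral>x. (indicator {0..} x * exp (-x)) *\<^sub>R f x \<partial>lborel) +
       (\<integral>x. (indicator {0..} x * exp (-x)) *\<^sub>R f (-x) \<partial>lborel)) / 2"
proof -
  let ?f = "\<lambda>x::real. (indicator {0..} x * exp (-x)) *\<^sub>R f x"
  let ?g = "\<lambda>x::real. (indicator {0..} x * exp (-x)) *\<^sub>R f (-x)"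
  have g': "integrable lborel (\<lambda>x. ?g (-x))" "(\<integral>x. ?g (-x) \<partial>lborel) = integral\<^sup>L lborel ?g"
    using lborel_integrable_real_affine[OF g, of "-1" 0] lborel_integral_real_affine[of "-1" ?g 0] by simp_all
  have ae: "AE x in lborel. (exp (-\<bar>x\<bar>) / 2) *\<^sub>R f x = (?f x + ?g (-x)) / 2"
    using AE_lborel_singleton[of "0::real"] by eventually_elim (auto split: split_indicator simp: scaleR_conv_of_real)
  have "integrable lborel (\<lambda>x. (?f x + ?g (-x)) / 2)"
    by (intro integrable_divide Bochner_Integration.integrable_add f g'(1))
  then have "integrable lborel (\<lambda>x. (exp (-\<bar>x\<bar>) / 2) *\<^sub>R f x)"
    by (rule integrable_cong_AE_imp) (use ae in \<open>auto\<close>)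
  then show "integrable laplace_distribution f"
    unfolding laplace_distribution_def by (subst integrable_density) auto
  have "(\<integral>x. f x \<partial>laplace_distribution) = (\<integral>x. (exp (-\<bar>x\<bar>) / 2) *\<^sub>R f x \<partial>lborel)"
    unfolding laplace_distribution_def by (subst integral_density) auto
  also have "\<dots> = (\<integral>x. (?f x + ?g (-x)) / 2 \<partial>lborel)"
    by (rule integral_cong_AE) (use ae in auto)
  also have "\<dots> = (integral\<^sup>L lborel ?f + integral\<^sup>L lborel ?g) / 2"
    using f g' by simp
  finally show "(\<integral>x. f x \<partial>laplace_distribution) = (integral\<^sup>L lborel ?f + integral\<^sup>L lborel ?g) / 2" .
qed

lemma char_laplace: "char laplace_distribution t = 1 / (1 + t\<^sup>2)"
proof -
  have "char laplace_distribution t = (1 / (1 - \<i> * t) + 1 / (1 - \<i> * (-t))) / 2"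
    unfolding char_def
    by (subst laplace_split(2)) (use exp_half_line_char[of t] exp_half_line_char[of "-t"] in auto)
  also have "\<dots> = 1 / (1 + t\<^sup>2)"
  proof -
    have "1 - \<i> * t \<noteq> 0" "1 + \<i> * t \<noteq> 0" by (auto simp: complex_eq_iff)
    moreover have "(1 - \<i> * t) * (1 + \<i> * t) = 1 + t\<^sup>2" by (simp add: algebra_simps power2_eq_square)
    moreover have "complex_of_real (1 + t\<^sup>2) \<noteq> 0" unfolding of_real_eq_0_iff
      by (metis add_pos_nonneg less_irrefl zero_le_power2 zero_less_one)
    ultimately show ?thesis by (simp add: divide_simps del: of_real_add)
  qed
  finally show ?thesis .
qed

lemma real_distribution_laplace: "real_distribution laplace_distribution"
proof -
  have i: "(\<integral>x. 1 \<partial>laplace_distribution) = (1::complex)" "integrable laplace_distribution (\<lambda>x. 1::complex)"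
    using laplace_split[of "\<lambda>_. 1"] exp_half_line_char[of 0] by auto
  then have "integrable laplace_distribution (\<lambda>x. 1::real)"
    using integrable_Re by fastforce
  then have "finite_measure laplace_distribution"
    by (intro finite_measureI) (auto simp: integrable_iff_bounded)
  then interpret finite_measure laplace_distribution .
  have "measure laplace_distribution UNIV = 1"
    using i(1) by (simp add: complex_eq_iff scaleR_conv_of_real)
  then show ?thesis
    by (auto simp: real_distribution_def real_distribution_axioms_def emeasure_eq_measure
       intro!: prob_spaceI)
qed

lemma integrable_inverse_1_plus_square: "integrable lborel (\<lambda>x::real. 1 / (1 + x\<^sup>2))"
proof -
  have h: "integrable lborel (\<lambda>x::real. indicator {0..} x * (1 / (1 + x\<^sup>2)))" (is "integrable _ ?f")
  proof (rule integrableI_nonneg)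
    have "(\<integral>\<^sup>+x. ennreal (indicator {0..} x * (1 / (1 + x\<^sup>2))) \<partial>lborel) =
        (\<integral>\<^sup>+x. ennreal (1 / (1 + x\<^sup>2)) * indicator {0..} x \<partial>lborel)"
      by (intro nn_integral_cong) (auto split: split_indicator)
    also have "\<dots> = ennreal (pi / 2 - arctan 0)"
      by (rule nn_integral_FTC_atLeast)
         (auto intro!: derivative_eq_intros tendsto_arctan_at_top simp: inverse_eq_divide)
    finally show "(\<integral>\<^sup>+x. ennreal (indicator {0..} x * (1 / (1 + x\<^sup>2))) \<partial>lborel) < \<infinity>"
      by simp
  qed auto
  have "integrable lborel (\<lambda>x. ?f x + ?f (-x))"
    using h lborel_integrable_real_affine[OF h, of "-1" 0] by (intro Bochner_Integration.integrable_add) auto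
  then show ?thesis
    by (rule Bochner_Integration.integrable_bound) (auto split: split_indicator)
qed

lemma laplace_interval:
  assumes "0 \<le> t" "0 \<le> h"
  shows "measure laplace_distribution {t<..t+h} = (exp (-t) - exp (-(t+h))) / 2"
proof -
  have "emeasure laplace_distribution {t<..t+h} = 
    (\<integral>\<^sup>+x. ennreal (exp (- \<bar>x\<bar>) / 2) * indicator {t<..t+h} x \<partial>lborel)"
    unfolding laplace_distribution_def by (subst emeasure_density) auto
  also have "\<dots> = (\<integral>\<^sup>+x. ennreal (exp (- x) / 2) * indicator {t..t+h} x \<partial>lborel)"
  proof (rule nn_integral_cong_AE)
    show "AE x in lborel. ennreal (exp (- \<bar>x\<bar>) / 2) * indicator {t<..t + h} x = ennreal (exp (- x) / 2) * indicator {t..t + h} x"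
      using AE_lborel_singleton[of t] by eventually_elim (use \<open>0 \<le> t\<close> in \<open>auto split: split_indicator\<close>)
  qed
  also have "\<dots> = ennreal ((- exp (-(t+h)) / 2) - (- exp (-t) / 2))"
    using assms by (intro nn_integral_FTC_Icc[where F = "\<lambda>x. - exp (-x) / 2"]) (auto intro!: derivative_eq_intros)
  finally show ?thesis
    using assms by (simp add: measure_def diff_divide_distrib)
qed

text \<open>The Fourier transform of the Cauchy density, obtained by inverting that of the Laplace law:
Levy's inversion formula gives the mass of \<open>{t<..t + h}\<close>, and dividing by \<open>h\<close> and letting
\<open>h\<close> tend to \<open>0\<close> gives the density at \<open>t\<close>. The integrability of \<open>1 / (1 + \<xi>\<^sup>2)\<close> makes both the
principal value and the limit in \<open>h\<close> harmless.\<close>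

lemma fourier_cauchy_kernel:
  "(\<integral>\<xi>. cos (t * \<xi>) / (1 + \<xi>\<^sup>2) \<partial>lborel) = pi * exp (- \<bar>t\<bar>)"
proof -
  interpret L: real_distribution laplace_distribution by (rule real_distribution_laplace)
  have main: "(\<integral>\<xi>. cos (t * \<xi>) / (1 + \<xi>\<^sup>2) \<partial>lborel) = pi * exp (- t)" if t: "t \<ge> 0" for t :: real
  proof -
    \<comment> \<open>The integrand of Levy's inversion formula for the interval from \<open>t\<close> to \<open>t + h\<close>.\<close>
    define F where "F h \<xi> = (iexp (-(\<xi> * t)) - iexp (-(\<xi> * (t + h)))) / (\<i> * \<xi>) * complex_of_real (1 / (1 + \<xi>\<^sup>2))"
      for h \<xi> :: real
    have [measurable]: "F h \<in> borel_measurable borel" for h unfolding F_def by measurable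
    have bound: "cmod (F h \<xi>) \<le> h * (1 / (1 + \<xi>\<^sup>2))" if "0 \<le> h" for h \<xi>
    proof (cases "\<xi> = 0")
      case False
      have "cmod ((iexp (\<xi> * (-t)) - iexp (\<xi> * (-(t+h)))) / (\<i> * \<xi>)) \<le> (-t) - (-(t+h))"
        using that False by (intro Levy_Inversion_aux2) auto
      then have "cmod ((iexp (\<xi> * (-t)) - iexp (\<xi> * (-(t+h)))) / (\<i> * \<xi>)) * cmod (complex_of_real (1 / (1 + \<xi>\<^sup>2))) \<le> h * cmod (complex_of_real (1 / (1 + \<xi>\<^sup>2)))"
        by (intro mult_right_mono) auto
      moreover have "cmod (complex_of_real (1 / (1 + \<xi>\<^sup>2))) = 1 / (1 + \<xi>\<^sup>2)"
        unfolding norm_of_real by simp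
      moreover have "\<xi> * (-t) = -(\<xi> * t)" "\<xi> * (-(t+h)) = -(\<xi> * (t+h))" by (simp_all add: algebra_simps)
      ultimately show ?thesis unfolding F_def norm_mult by (metis mult.right_neutral times_divide_eq_right)
    qed (use that in \<open>simp add: F_def\<close>)
    have atoms: "measure laplace_distribution {x} = 0" for x
    proof -
      have "emeasure laplace_distribution {x} = 0"
        unfolding laplace_distribution_def by (subst emeasure_density) auto
      then show ?thesis by (simp add: measure_def)
    qed
    have inv: "1 / (2 * pi) * (CLBINT \<xi>. F h \<xi>) = complex_of_real ((exp (-t) - exp (-(t+h))) / 2)" if h: "0 \<le> h" for h
    proof (rule LIMSEQ_unique)
      show "(\<lambda>T::nat. 1 / (2 * pi) * (CLBINT \<xi>=-real T..real T. F h \<xi>)) \<longlonglongrightarrow> complex_of_real ((exp (-t) - exp (-(t+h))) / 2)"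
        using L.Levy_Inversion[of t "t + h"] h atoms
        unfolding char_laplace F_def laplace_interval[OF t h] by simp
      have "(\<lambda>T::nat. CLBINT \<xi>. indicator {-real T<..<real T} \<xi> *\<^sub>R F h \<xi>) \<longlonglongrightarrow> (CLBINT \<xi>. F h \<xi>)"
      proof (rule integral_dominated_convergence[where w="\<lambda>\<xi>. h * (1 / (1 + \<xi>\<^sup>2))"])
        show "AE \<xi> in lborel. (\<lambda>T::nat. indicator {-real T<..<real T} \<xi> *\<^sub>R F h \<xi>) \<longlonglongrightarrow> F h \<xi>"
        proof (rule AE_I2, rule tendsto_eventually)
          fix \<xi> :: real
          obtain N :: nat where "\<bar>\<xi>\<bar> < real N" using reals_Archimedean2 by blast
          then show "\<forall>\<^sub>F T::nat in sequentially. indicator {-real T<..<real T} \<xi> *\<^sub>R F h \<xi> = F h \<xi>"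
            by (intro eventually_sequentiallyI[of N]) (auto split: split_indicator)
        qed
        show "AE \<xi> in lborel. cmod (indicator {-real T<..<real T} \<xi> *\<^sub>R F h \<xi>) \<le> h * (1 / (1 + \<xi>\<^sup>2))" for T
          using bound[OF h] h by (auto split: split_indicator)
      qed (use integrable_mult_right[OF integrable_inverse_1_plus_square, of h] in simp_all)
      then show "(\<lambda>T::nat. 1 / (2 * pi) * (CLBINT \<xi>=-real T..real T. F h \<xi>)) \<longlonglongrightarrow> 1 / (2 * pi) * (CLBINT \<xi>. F h \<xi>)"
        by (intro tendsto_mult tendsto_const)
           (simp add: interval_lebesgue_integral_def set_lebesgue_integral_def)
    qed
    \<comment> \<open>Difference quotients along this sequence; the bound on \<open>F\<close> is linear in \<open>h\<close>, so that
      the quotients are dominated by \<open>1 / (1 + \<xi>\<^sup>2)\<close>.\<close>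
    define h where "h n = 1 / real (Suc n)" for n
    have h0: "h \<longlonglongrightarrow> 0" "\<And>n. h n > 0" unfolding h_def by (rule LIMSEQ_Suc[OF lim_1_over_n]) simp
    have "(\<lambda>n. CLBINT \<xi>. F (h n) \<xi> / h n) \<longlonglongrightarrow> (CLBINT \<xi>. iexp (-(\<xi> * t)) * complex_of_real (1 / (1 + \<xi>\<^sup>2)))"
    proof (rule integral_dominated_convergence[where w="\<lambda>\<xi>. 1 / (1 + \<xi>\<^sup>2)"])
      show "AE \<xi> in lborel. cmod (F (h n) \<xi> / h n) \<le> 1 / (1 + \<xi>\<^sup>2)" for n
      proof (rule AE_I2)
        fix \<xi>
        have "cmod (F (h n) \<xi>) / h n \<le> 1 / (1 + \<xi>\<^sup>2)"
          using bound[of "h n" \<xi>] h0(2)[of n] by (subst pos_divide_le_eq) (auto simp: mult.commute)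
        then show "cmod (F (h n) \<xi> / h n) \<le> 1 / (1 + \<xi>\<^sup>2)"
          using h0(2)[of n] by (simp add: norm_divide)
      qed
      show "AE \<xi> in lborel. (\<lambda>n. F (h n) \<xi> / h n) \<longlonglongrightarrow> iexp (-(\<xi> * t)) * complex_of_real (1 / (1 + \<xi>\<^sup>2))"
        using AE_lborel_singleton[of 0]
      proof eventually_elim
        fix \<xi> :: real assume nz: "\<xi> \<noteq> 0"
        have "((\<lambda>z. exp (\<i> * (-(\<xi> * z)))) has_field_derivative (- \<i> * \<xi>) * exp (\<i> * (-(\<xi> * t)))) (at (complex_of_real t))"
          by (auto intro!: derivative_eq_intros)
        then have "((\<lambda>k::complex. (exp (\<i> * (-(\<xi> * (t + k)))) - exp (\<i> * (-(\<xi> * t)))) / k) \<longlongrightarrow> (- \<i> * \<xi>) * exp (\<i> * (-(\<xi> * t)))) (at 0)"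
          by (simp add: DERIV_def)
        moreover have "filterlim (\<lambda>n. complex_of_real (h n)) (at 0) sequentially"
          using h0 by (auto simp: filterlim_at tendsto_of_real_iff[where c=0, simplified of_real_0] intro!: always_eventually)
            (metis less_irrefl)
        ultimately have "(\<lambda>n. (exp (\<i> * (-(\<xi> * (t + complex_of_real (h n))))) - exp (\<i> * (-(\<xi> * t)))) / h n) \<longlonglongrightarrow> (- \<i> * \<xi>) * exp (\<i> * (-(\<xi> * t)))"
          by (rule filterlim_compose)
        then have "(\<lambda>n. - ((exp (\<i> * (-(\<xi> * (t + complex_of_real (h n))))) - exp (\<i> * (-(\<xi> * t)))) / h n) / (\<i> * \<xi>) * complex_of_real (1 / (1 + \<xi>\<^sup>2)))
            \<longlonglongrightarrow> - ((- \<i> * \<xi>) * exp (\<i> * (-(\<xi> * t)))) / (\<i> * \<xi>) * complex_of_real (1 / (1 + \<xi>\<^sup>2))"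
          by (intro tendsto_intros) (use nz in auto)
        then show "(\<lambda>n. F (h n) \<xi> / h n) \<longlonglongrightarrow> iexp (-(\<xi> * t)) * complex_of_real (1 / (1 + \<xi>\<^sup>2))"
          unfolding F_def using nz by (simp add: mult_ac diff_divide_distrib)
      qed
    qed (use integrable_inverse_1_plus_square in auto)
    then have "(\<lambda>n. 1 / (2 * pi) * (CLBINT \<xi>. F (h n) \<xi>) / h n) \<longlonglongrightarrow> 1 / (2 * pi) * (CLBINT \<xi>. iexp (-(\<xi> * t)) * complex_of_real (1 / (1 + \<xi>\<^sup>2)))"
      using tendsto_mult[OF tendsto_const[of "1 / (2 * complex_of_real pi)"]] by (fastforce simp: mult_ac)
    then have "(\<lambda>n. complex_of_real ((exp (-t) - exp (-(t+h n))) / 2 / h n)) \<longlonglongrightarrow> 1 / (2 * pi) * (CLBINT \<xi>. iexp (-(\<xi> * t)) * complex_of_real (1 / (1 + \<xi>\<^sup>2)))"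
      by (simp only: inv[OF less_imp_le[OF h0(2)]] of_real_divide[symmetric])
    then have "(\<lambda>n. (exp (-t) - exp (-(t+h n))) / 2 / h n) \<longlonglongrightarrow> Re (1 / (2 * pi) * (CLBINT \<xi>. iexp (-(\<xi> * t)) * complex_of_real (1 / (1 + \<xi>\<^sup>2))))"
      using tendsto_Re by fastforce
    moreover have "(\<lambda>n. (exp (-t) - exp (-(t+h n))) / 2 / h n) \<longlonglongrightarrow> exp (-t) / 2"
    proof -
      have "((\<lambda>z. - exp (-z) / 2) has_real_derivative exp (-t) / 2) (at t)"
        by (auto intro!: derivative_eq_intros)
      then have "((\<lambda>k. (- exp (-(t + k)) / 2 - - exp (-t) / 2) / k) \<longlongrightarrow> exp (-t) / 2) (at 0)"
        by (simp add: DERIV_def)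
      moreover have "filterlim h (at 0) sequentially"
        using h0 by (auto simp: filterlim_at intro!: always_eventually) (metis less_irrefl)
      ultimately have "(\<lambda>n. (- exp (-(t + h n)) / 2 - - exp (-t) / 2) / h n) \<longlonglongrightarrow> exp (-t) / 2"
        by (rule filterlim_compose)
      then show ?thesis by (simp add: diff_divide_distrib)
    qed
    ultimately have "Re (1 / (2 * pi) * (CLBINT \<xi>. iexp (-(\<xi> * t)) * complex_of_real (1 / (1 + \<xi>\<^sup>2)))) = exp (-t) / 2"
      by (rule LIMSEQ_unique)
    also have "Re (1 / (2 * pi) * (CLBINT \<xi>. iexp (-(\<xi> * t)) * complex_of_real (1 / (1 + \<xi>\<^sup>2)))) = 1 / (2 * pi) * Re (CLBINT \<xi>. iexp (-(\<xi> * t)) * complex_of_real (1 / (1 + \<xi>\<^sup>2)))"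
    proof -
      have "1 / (2 * complex_of_real pi) = complex_of_real (1 / (2 * pi))" by simp
      moreover have "Re (complex_of_real c * z) = c * Re z" for c z by simp
      ultimately show ?thesis by (simp only:)
    qed
    also have "Re (CLBINT \<xi>. iexp (-(\<xi> * t)) * complex_of_real (1 / (1 + \<xi>\<^sup>2))) =
        (\<integral>\<xi>. Re (iexp (-(\<xi> * t)) * complex_of_real (1 / (1 + \<xi>\<^sup>2))) \<partial>lborel)"
    proof (intro integral_Re[symmetric] Bochner_Integration.integrable_bound[OF integrable_inverse_1_plus_square] AE_I2)
      show "norm (iexp (-(\<xi> * t)) * complex_of_real (1 / (1 + \<xi>\<^sup>2))) \<le> norm (1 / (1 + \<xi>\<^sup>2))" for \<xi>
        by (simp only: norm_mult norm_of_real norm_exp_i_times real_norm_def mult_1 order_refl)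
    qed measurable
    also have "\<dots> = (\<integral>\<xi>. cos (t * \<xi>) / (1 + \<xi>\<^sup>2) \<partial>lborel)"
      by (intro Bochner_Integration.integral_cong refl) (simp add: Re_exp mult_ac)
    finally show ?thesis by (simp add: field_simps)
  qed
  have "(\<integral>\<xi>. cos (t * \<xi>) / (1 + \<xi>\<^sup>2) \<partial>lborel) = (\<integral>\<xi>. cos (\<bar>t\<bar> * \<xi>) / (1 + \<xi>\<^sup>2) \<partial>lborel)"
    by (intro Bochner_Integration.integral_cong refl) (simp add: abs_if)
  then show ?thesis using main[of "\<bar>t\<bar>"] by simp
qed

section \<open>Partial fractions of the hyperbolic cotangent\<close>

text \<open>Euler's product for the sine on the imaginary axis.\<close>

lemma sinh_product:
  assumes "z > (0::real)"
  shows "(\<lambda>n. \<Prod>k=1..n. 1 + z\<^sup>2 / (real k)\<^sup>2) \<longlonglongrightarrow> sinh (pi * z) / (pi * z)"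
proof -
  have "(\<lambda>n. of_real pi * (\<i> * z) * (\<Prod>k=1..n. 1 - (\<i> * z)^2 / of_nat k^2)) \<longlonglongrightarrow> sin (of_real pi * (\<i> * complex_of_real z))"
    by (rule sin_product_formula_complex)
  moreover have "sin (of_real pi * (\<i> * complex_of_real z)) = \<i> * of_real (sinh (pi * z))"
  proof -
    have "sin (\<i> * complex_of_real (pi * z)) = \<i> * sinh (complex_of_real (pi * z))"
      by (simp add: sinh_conv_sin)
    then show ?thesis by (simp add: sinh_field_def sinh_def exp_of_real[symmetric] mult_ac)
  qed
  moreover have "of_real pi * (\<i> * z) * (\<Prod>k=1..n. 1 - (\<i> * z)^2 / of_nat k^2) = \<i> * of_real (pi * z * (\<Prod>k=1..n. 1 + z\<^sup>2 / (real k)\<^sup>2))" for n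
    by (simp add: power_mult_distrib)
  ultimately have "(\<lambda>n. \<i> * of_real (pi * z * (\<Prod>k=1..n. 1 + z\<^sup>2 / (real k)\<^sup>2))) \<longlonglongrightarrow> \<i> * complex_of_real (sinh (pi * z))"
    by (simp only:)
  from tendsto_Im[OF this] have "(\<lambda>n. pi * z * (\<Prod>k=1..n. 1 + z\<^sup>2 / (real k)\<^sup>2)) \<longlonglongrightarrow> sinh (pi * z)"
    by (simp only: Im_i_times Re_complex_of_real)
  from tendsto_divide[OF this tendsto_const[of "pi * z"]] show ?thesis using assms by simp
qed

lemma summable_inverse_Suc_square: "summable (\<lambda>m. 1 / (real (Suc m))\<^sup>2)"
  using inverse_squares_sums by (simp add: sums_iff)

text \<open>The logarithmic derivative of the product formula. Termwise differentiation is legitimate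
because the differentiated series converges uniformly on bounded intervals.\<close>

lemma coth_partial_fractions:
  assumes z: "z > (0::real)"
  shows "(\<lambda>m. 2 * z / ((real (Suc m))\<^sup>2 + z\<^sup>2)) sums (pi * cosh (pi * z) / sinh (pi * z) - 1 / z)"
proof -
  define f where "f m x = ln (1 + x\<^sup>2 / (real (Suc m))\<^sup>2)" for m and x :: real
  define f' where "f' m x = 2 * x / ((real (Suc m))\<^sup>2 + x\<^sup>2)" for m and x :: real
  have f_sums: "(\<lambda>m. f m x) sums ln (sinh (pi * x) / (pi * x))" if "x > 0" for x
  proof -
    have pos: "sinh (pi * x) / (pi * x) > 0" using that by simp
    have "(\<lambda>n. ln (\<Prod>k=1..n. 1 + x\<^sup>2 / (real k)\<^sup>2)) \<longlonglongrightarrow> ln (sinh (pi * x) / (pi * x))"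
      by (intro tendsto_ln sinh_product that) (use pos in auto)
    moreover have "ln (\<Prod>k=1..n. 1 + x\<^sup>2 / (real k)\<^sup>2) = (\<Sum>m<n. f m x)" for n
    proof -
      have "ln (\<Prod>k=1..n. 1 + x\<^sup>2 / (real k)\<^sup>2) = (\<Sum>k=1..n. ln (1 + x\<^sup>2 / (real k)\<^sup>2))"
        by (rule ln_prod) (auto intro!: add_pos_nonneg simp: add_nonneg_eq_0_iff)
      also have "\<dots> = (\<Sum>m<n. f m x)"
        unfolding f_def by (rule sum.reindex_bij_witness[of _ Suc "\<lambda>k. k - 1"]) auto
      finally show ?thesis .
    qed
    ultimately show ?thesis by (simp add: sums_def)
  qed
  have der: "(f m has_field_derivative f' m x) (at x within S)" for m x S
  proof -
    have pos: "1 + x\<^sup>2 / (real (Suc m))\<^sup>2 > 0" by (intro add_pos_nonneg) auto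
    have "(f m has_field_derivative (1 / (1 + x\<^sup>2 / (real (Suc m))\<^sup>2)) * (2 * x / (real (Suc m))\<^sup>2)) (at x within S)"
      unfolding f_def[abs_def] using pos
      by (auto intro!: derivative_eq_intros simp del: of_nat_Suc) (simp add: power2_eq_square power4_eq_xxxx del: of_nat_Suc)
    moreover have "(1 / (1 + x\<^sup>2 / (real (Suc m))\<^sup>2)) * (2 * x / (real (Suc m))\<^sup>2) = 2 * x / ((1 + x\<^sup>2 / (real (Suc m))\<^sup>2) * (real (Suc m))\<^sup>2)"
      by (simp only: times_divide_times_eq mult_1)
    moreover have "(1 + x\<^sup>2 / (real (Suc m))\<^sup>2) * (real (Suc m))\<^sup>2 = (real (Suc m))\<^sup>2 + x\<^sup>2"
      by (simp add: distrib_right)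
    ultimately show ?thesis unfolding f'_def by (simp only:)
  qed
  have unif: "uniformly_convergent_on {0..z+1} (\<lambda>n x. \<Sum>i<n. f' i x)"
  proof (rule Weierstrass_m_test')
    show "norm (f' m x) \<le> 2 * (z + 1) * (1 / (real (Suc m))\<^sup>2)" if "x \<in> {0..z+1}" for m x
    proof -
      have "2 * x / ((real (Suc m))\<^sup>2 + x\<^sup>2) \<le> 2 * (z + 1) / (real (Suc m))\<^sup>2"
        using that by (intro frac_le) auto
      then show ?thesis using that by (simp add: f'_def)
    qed
    show "summable (\<lambda>m. 2 * (z + 1) * (1 / (real (Suc m))\<^sup>2))"
      by (intro summable_mult summable_inverse_Suc_square)
  qed
  have "summable (\<lambda>m. f m z)" using f_sums[OF z] by (simp add: sums_iff)
  then have D: "((\<lambda>x. \<Sum>m. f m x) has_field_derivative (\<Sum>m. f' m z)) (at z)"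
    by (intro has_field_derivative_series'(2)[where S="{0..z+1}", OF _ der unif]) (use z in auto)
  have D2: "((\<lambda>x. ln (sinh (pi * x) / (pi * x))) has_field_derivative (pi * cosh (pi * z) / sinh (pi * z) - 1 / z)) (at z)"
    using z by (auto intro!: derivative_eq_intros simp: field_simps power2_eq_square)
  have "((\<lambda>x. \<Sum>m. f m x) has_field_derivative (pi * cosh (pi * z) / sinh (pi * z) - 1 / z)) (at z)"
  proof (rule has_field_derivative_transform_within_open[OF D2, of "{0<..}"])
    show "ln (sinh (pi * x) / (pi * x)) = (\<Sum>m. f m x)" if "x \<in> {0<..}" for x
      using f_sums[of x] that by (auto simp: sums_iff)
  qed (use z in auto)
  with D have "(\<Sum>m. f' m z) = pi * cosh (pi * z) / sinh (pi * z) - 1 / z"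
    by (rule DERIV_unique)
  moreover have "summable (\<lambda>m. f' m z)"
    by (rule summable_comparison_test'[OF summable_mult[OF summable_inverse_Suc_square, of "2*z"], of 0])
       (use z in \<open>auto simp: f'_def intro!: frac_le\<close>)
  ultimately show ?thesis unfolding f'_def by (simp add: sums_iff)
qed

section \<open>Convolution kernels of logarithmic type\<close>

text \<open>The Fourier transform of \<open>exp (- (m + 1) \<bar>t\<bar> / a) / (m + 1)\<close>, a Cauchy density up to the
factor \<open>1 / (m + 1)\<close>; the sum over \<open>m\<close> is the Fourier transform of the kernel \<open>kap a\<close> below.\<close>

definition kap_coeff :: "real \<Rightarrow> nat \<Rightarrow> real \<Rightarrow> real" where
  "kap_coeff a m \<xi> = a / (pi * ((real (Suc m))\<^sup>2 + a\<^sup>2 * \<xi>\<^sup>2))"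

definition kap_hat :: "real \<Rightarrow> real \<Rightarrow> real" where
  "kap_hat a \<xi> = (\<Sum>m. kap_coeff a m \<xi>)"

lemma kap_denominator_pos: "(real (Suc m))\<^sup>2 + a\<^sup>2 * \<xi>\<^sup>2 > 0"
  by (intro add_pos_nonneg) auto

lemma kap_coeff_nonneg: "a \<ge> 0 \<Longrightarrow> kap_coeff a m \<xi> \<ge> 0"
  unfolding kap_coeff_def using kap_denominator_pos[of m a \<xi>] by simp

lemma summable_kap_coeff:
  assumes "a > 0" shows "summable (\<lambda>m. kap_coeff a m \<xi>)"
proof (rule summable_comparison_test'[OF summable_mult[OF summable_inverse_Suc_square, of "a / pi"], of 0])
  fix m
  have "a / (pi * ((real (Suc m))\<^sup>2 + a\<^sup>2 * \<xi>\<^sup>2)) \<le> a / (pi * (real (Suc m))\<^sup>2)"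
    using assms kap_denominator_pos[of m a \<xi>] by (intro divide_left_mono mult_left_mono mult_pos_pos) auto
  then show "norm (kap_coeff a m \<xi>) \<le> a / pi * (1 / (real (Suc m))\<^sup>2)"
    using kap_coeff_nonneg[of a m \<xi>] assms by (simp add: kap_coeff_def)
qed

lemma measurable_kap_coeff [measurable]: "kap_coeff a m \<in> borel_measurable borel"
  unfolding kap_coeff_def[abs_def] by measurable

lemma measurable_kap_hat [measurable]: "kap_hat a \<in> borel_measurable borel"
  unfolding kap_hat_def[abs_def] by measurable

lemma kap_hat_nonneg: "a > 0 \<Longrightarrow> kap_hat a \<xi> \<ge> 0"
  unfolding kap_hat_def by (intro suminf_nonneg summable_kap_coeff kap_coeff_nonneg) auto

lemma kap_hat_pos: "a > 0 \<Longrightarrow> kap_hat a \<xi> > 0"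
  unfolding kap_hat_def
  by (intro suminf_pos summable_kap_coeff) (auto simp: kap_coeff_def intro!: divide_pos_pos mult_pos_pos add_pos_nonneg)

lemma kap_hat_closed_form:
  assumes a: "a > 0" and nz: "\<xi> \<noteq> 0"
  shows "kap_hat a \<xi> = cosh (pi * a * \<xi>) / (2 * \<xi> * sinh (pi * a * \<xi>)) - 1 / (2 * pi * a * \<xi>\<^sup>2)"
proof -
  have main: "kap_hat a x = cosh (pi * a * x) / (2 * x * sinh (pi * a * x)) - 1 / (2 * pi * a * x\<^sup>2)" if x: "x > 0" for x
  proof -
    have "(\<lambda>m. 1 / (2 * pi * x) * (2 * (a * x) / ((real (Suc m))\<^sup>2 + (a * x)\<^sup>2))) sums
       (1 / (2 * pi * x) * (pi * cosh (pi * (a * x)) / sinh (pi * (a * x)) - 1 / (a * x)))"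
      using a x by (intro sums_mult coth_partial_fractions) auto
    also have "(\<lambda>m. 1 / (2 * pi * x) * (2 * (a * x) / ((real (Suc m))\<^sup>2 + (a * x)\<^sup>2))) = (\<lambda>m. kap_coeff a m x)"
      using x by (auto simp: kap_coeff_def power_mult_distrib fun_eq_iff divide_simps simp del: of_nat_Suc)
    finally have "kap_hat a x = 1 / (2 * pi * x) * (pi * cosh (pi * (a * x)) / sinh (pi * (a * x)) - 1 / (a * x))"
      unfolding kap_hat_def by (simp add: sums_iff)
    then show ?thesis using a x by (simp add: field_simps power2_eq_square)
  qed
  have "kap_hat a \<xi> = kap_hat a \<bar>\<xi>\<bar>" unfolding kap_hat_def kap_coeff_def by simp
  also have "\<dots> = cosh (pi * a * \<bar>\<xi>\<bar>) / (2 * \<bar>\<xi>\<bar> * sinh (pi * a * \<bar>\<xi>\<bar>)) - 1 / (2 * pi * a * \<bar>\<xi>\<bar>\<^sup>2)"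
    using nz by (intro main) auto
  also have "\<dots> = cosh (pi * a * \<xi>) / (2 * \<xi> * sinh (pi * a * \<xi>)) - 1 / (2 * pi * a * \<xi>\<^sup>2)"
    by (cases "\<xi> > 0") (auto simp: abs_if)
  finally show ?thesis .
qed

text \<open>The transforms for different parameters are comparable, so that finiteness of one
\<open>kap\<close> energy implies that of all the others.\<close>

lemma kap_hat_le:
  assumes a: "a > 0"
  shows "kap_hat a \<xi> \<le> max a (1 / a) * kap_hat 1 \<xi>"
  unfolding kap_hat_def
proof (subst suminf_mult[symmetric], rule summable_kap_coeff, simp, rule suminf_le)
  fix m
  have "kap_coeff a m \<xi> \<le> max a (1 / a) * kap_coeff 1 m \<xi>"
  proof (cases "a \<ge> 1")
    case True
    have "(real (Suc m))\<^sup>2 + \<xi>\<^sup>2 \<le> (real (Suc m))\<^sup>2 + a\<^sup>2 * \<xi>\<^sup>2"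
      using True by (simp add: mult_le_cancel_right1)
    then have "a / (pi * ((real (Suc m))\<^sup>2 + a\<^sup>2 * \<xi>\<^sup>2)) \<le> a / (pi * ((real (Suc m))\<^sup>2 + \<xi>\<^sup>2))"
      using kap_denominator_pos[of m a \<xi>] kap_denominator_pos[of m 1 \<xi>] True
      by (intro divide_left_mono mult_left_mono mult_pos_pos) auto
    then have "kap_coeff a m \<xi> \<le> a * kap_coeff 1 m \<xi>" by (simp add: kap_coeff_def)
    moreover have "a * kap_coeff 1 m \<xi> \<le> max a (1 / a) * kap_coeff 1 m \<xi>"
      using kap_coeff_nonneg[of 1] by (intro mult_right_mono) auto
    ultimately show ?thesis by simp
  next
    case False
    have "a\<^sup>2 * ((real (Suc m))\<^sup>2 + \<xi>\<^sup>2) \<le> (real (Suc m))\<^sup>2 + a\<^sup>2 * \<xi>\<^sup>2"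
      using False a by (auto simp: algebra_simps mult_le_cancel_right2 power_le_one simp del: of_nat_Suc)
    then have "a / (pi * ((real (Suc m))\<^sup>2 + a\<^sup>2 * \<xi>\<^sup>2)) \<le> a / (pi * (a\<^sup>2 * ((real (Suc m))\<^sup>2 + \<xi>\<^sup>2)))"
      using kap_denominator_pos[of m a \<xi>] kap_denominator_pos[of m 1 \<xi>] a
      by (intro divide_left_mono mult_left_mono mult_pos_pos) auto
    also have "\<dots> = (1 / a) * (1 / (pi * ((real (Suc m))\<^sup>2 + \<xi>\<^sup>2)))"
      using a by (simp add: power2_eq_square)
    finally have "kap_coeff a m \<xi> \<le> (1 / a) * kap_coeff 1 m \<xi>" by (simp add: kap_coeff_def)
    moreover have "(1 / a) * kap_coeff 1 m \<xi> \<le> max a (1 / a) * kap_coeff 1 m \<xi>"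
      using kap_coeff_nonneg[of 1] by (intro mult_right_mono) auto
    ultimately show ?thesis by simp
  qed
  then show "kap_coeff a m \<xi> \<le> max a (1 / a) * kap_coeff 1 m \<xi>" .
qed (use a in \<open>auto intro!: summable_kap_coeff summable_mult\<close>)

text \<open>A rescaling of the Cauchy transform.\<close>

lemma fourier_kap_coeff:
  assumes a: "a > 0"
  shows "integrable lborel (kap_coeff a m)"
    and "(\<integral>\<xi>. cos (t * \<xi>) * kap_coeff a m \<xi> \<partial>lborel) = exp (- (real (Suc m) * \<bar>t\<bar> / a)) / real (Suc m)"
proof -
  define \<alpha> where "\<alpha> = real (Suc m) / a"
  have \<alpha>: "\<alpha> > 0" using a by (simp add: \<alpha>_def)
  have k: "kap_coeff a m \<xi> = (1 / (real (Suc m) * \<alpha> * pi)) * (1 / (1 + (\<xi> / \<alpha>)\<^sup>2))" for \<xi>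
  proof -
    have "real (Suc m) * \<alpha> * pi * (1 + (\<xi> / \<alpha>)\<^sup>2) = pi * ((real (Suc m))\<^sup>2 + a\<^sup>2 * \<xi>\<^sup>2) / a"
      using a by (simp add: \<alpha>_def field_simps power2_eq_square del: of_nat_Suc)
    then show ?thesis using a by (simp add: kap_coeff_def divide_divide_eq_left)
  qed
  have i: "integrable lborel (\<lambda>\<xi>. 1 / (1 + (\<xi> / \<alpha>)\<^sup>2))"
    using lborel_integrable_real_affine[OF integrable_inverse_1_plus_square, of "1 / \<alpha>" 0] \<alpha> by simp
  show "integrable lborel (kap_coeff a m)"
    unfolding k[abs_def] by (intro integrable_mult_right i)
  have "(\<integral>\<xi>. cos (t * \<xi>) * kap_coeff a m \<xi> \<partial>lborel) = \<alpha> * (\<integral>\<eta>. cos (t * (\<alpha> * \<eta>)) * kap_coeff a m (\<alpha> * \<eta>) \<partial>lborel)"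
    using lborel_integral_real_affine[of \<alpha> "\<lambda>\<xi>. cos (t * \<xi>) * kap_coeff a m \<xi>" 0] \<alpha> by simp
  also have "(\<integral>\<eta>. cos (t * (\<alpha> * \<eta>)) * kap_coeff a m (\<alpha> * \<eta>) \<partial>lborel) =
      (\<integral>\<eta>. (1 / (real (Suc m) * \<alpha> * pi)) * (cos ((t * \<alpha>) * \<eta>) / (1 + \<eta>\<^sup>2)) \<partial>lborel)"
    using \<alpha> by (intro Bochner_Integration.integral_cong refl) (simp add: k mult_ac del: of_nat_Suc)
  also have "\<dots> = (1 / (real (Suc m) * \<alpha> * pi)) * (pi * exp (- \<bar>t * \<alpha>\<bar>))"
    by (subst integral_mult_right_zero) (simp only: fourier_cauchy_kernel)
  also have "\<alpha> * \<dots> = exp (- (real (Suc m) * \<bar>t\<bar> / a)) / real (Suc m)"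
    using \<alpha> a by (simp add: abs_mult \<alpha>_def mult_ac del: of_nat_Suc)
  finally show "(\<integral>\<xi>. cos (t * \<xi>) * kap_coeff a m \<xi> \<partial>lborel) = exp (- (real (Suc m) * \<bar>t\<bar> / a)) / real (Suc m)" .
qed

text \<open>The power series of \<open>- ln (1 - exp (- \<bar>t\<bar> / a))\<close>, taken as the definition because it
gives the value \<open>\<infinity>\<close> at \<open>t = 0\<close> and because it splits the kernel into positive terms of known
Fourier transform.\<close>

definition kap :: "real \<Rightarrow> real \<Rightarrow> ennreal" where
  "kap a t = (\<Sum>m. ennreal (exp (- (real (Suc m) * \<bar>t\<bar> / a)) / real (Suc m)))"

lemma measurable_kap [measurable]: "kap a \<in> borel_measurable borel"
  unfolding kap_def[abs_def] by measurable

lemma kap_eq: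
  assumes "a > 0" "t \<noteq> 0"
  shows "kap a t = ennreal (- ln (1 - exp (- (\<bar>t\<bar> / a))))"
proof -
  define z where "z = exp (- (\<bar>t\<bar> / a))"
  have z: "0 < z" "z < 1" using assms by (auto simp: z_def)
  have "(\<lambda>n. - ((- (- z)) ^ n) / of_nat n) sums ln (1 + - z)"
    by (rule ln_series') (use z in auto)
  then have "(\<lambda>n. - (z ^ n / real n)) sums ln (1 - z)" by simp
  from sums_minus[OF this] have "(\<lambda>n. z ^ n / real n) sums (- ln (1 - z))" by simp
  then have s: "(\<lambda>n. z ^ Suc n / real (Suc n)) sums (- ln (1 - z))"
    by (subst sums_Suc_iff) simp
  have e: "exp (- (real (Suc m) * \<bar>t\<bar> / a)) = z ^ Suc m" for m
    unfolding z_def by (simp add: exp_of_nat_mult[symmetric] del: of_nat_Suc power_Suc)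
  have "kap a t = ennreal (\<Sum>n. z ^ Suc n / real (Suc n))"
    unfolding kap_def e using z s by (intro suminf_ennreal2) (auto simp: sums_iff simp del: of_nat_Suc power_Suc)
  also have "(\<Sum>n. z ^ Suc n / real (Suc n)) = - ln (1 - z)"
    using s by (simp add: sums_iff)
  finally show ?thesis by (simp add: z_def)
qed

lemma kap_zero: "kap a 0 = \<infinity>"
proof (rule ccontr)
  assume "kap a 0 \<noteq> \<infinity>"
  then have "(\<Sum>m. ennreal (1 / real (Suc m))) \<noteq> \<infinity>" by (simp add: kap_def)
  then have "summable (\<lambda>m. 1 / real (Suc m))"
    by (intro summable_suminf_not_top) auto
  then have "summable (\<lambda>m. 1 / real m)" by (subst (asm) summable_Suc_iff)
  then show False using not_summable_harmonic[where 'a=real] by (simp add: inverse_eq_divide)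
qed

lemma kap_mono: 
  assumes "0 < a" "a \<le> b" shows "kap a t \<le> kap b t"
  unfolding kap_def
proof (intro suminf_le ennreal_leI divide_right_mono summableI)
  fix m
  have "real (Suc m) * \<bar>t\<bar> / b \<le> real (Suc m) * \<bar>t\<bar> / a"
    using assms by (intro divide_left_mono mult_nonneg_nonneg mult_pos_pos) auto
  then show "exp (- (real (Suc m) * \<bar>t\<bar> / a)) \<le> exp (- (real (Suc m) * \<bar>t\<bar> / b))" by simp
qed simp

text \<open>The law of \<open>X - Y\<close> for independent \<open>X\<close> and \<open>Y\<close>: the energy of a convolution kernel is an
integral against this law, whose characteristic function is a product.\<close>

definition diff_law :: "real measure \<Rightarrow> real measure \<Rightarrow> real measure" where
  "diff_law M N = distr (M \<Otimes>\<^sub>M N) borel (\<lambda>(x, y). x - y)"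

lemma sets_diff_law [simp, measurable_cong]: "sets (diff_law M N) = sets borel"
  by (simp add: diff_law_def)

lemma space_diff_law [simp]: "space (diff_law M N) = UNIV"
  by (simp add: diff_law_def)

abbreviation kap_energy :: "real \<Rightarrow> real measure \<Rightarrow> real measure \<Rightarrow> ennreal" where
  "kap_energy a M N \<equiv> (\<integral>\<^sup>+t. kap a t \<partial>diff_law M N)"

context
  fixes M N :: "real measure"
  assumes M: "real_distribution M" and N: "real_distribution N"
begin

interpretation M: real_distribution M by (rule M)
interpretation N: real_distribution N by (rule N)
interpretation P: pair_prob_space M N ..

lemma measurable_minus_pair: "(\<lambda>(x, y). x - y :: real) \<in> borel_measurable (M \<Otimes>\<^sub>M N)"
  by measurable

lemma real_distribution_diff_law: "real_distribution (diff_law M N)"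
  unfolding diff_law_def real_distribution_def real_distribution_axioms_def
  using P.prob_space_distr[OF measurable_minus_pair] by simp

lemma nn_integral_diff_law:
  assumes [measurable]: "f \<in> borel_measurable borel"
  shows "(\<integral>\<^sup>+t. f t \<partial>diff_law M N) = (\<integral>\<^sup>+x. \<integral>\<^sup>+y. f (x - y) \<partial>N \<partial>M)"
  unfolding diff_law_def
  by (subst nn_integral_distr) (auto simp: N.nn_integral_fst[symmetric])

lemma integral_diff_law:
  fixes f :: "real \<Rightarrow> real"
  assumes [measurable]: "f \<in> borel_measurable borel"
  shows "(\<integral>t. f t \<partial>diff_law M N) = (\<integral>(x, y). f (x - y) \<partial>(M \<Otimes>\<^sub>M N))"
  unfolding diff_law_def
  by (subst integral_distr) (auto simp: case_prod_beta')

lemma char_diff_law: "char (diff_law M N) \<xi> = char M \<xi> * cnj (char N \<xi>)"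
proof -
  have "char (diff_law M N) \<xi> = (\<integral>z. iexp (\<xi> * (fst z - snd z)) \<partial>(M \<Otimes>\<^sub>M N))"
    unfolding diff_law_def char_def by (subst integral_distr) (auto simp: case_prod_beta')
  also have "\<dots> = (\<integral>z. iexp (\<xi> * fst z) * iexp (-(\<xi> * snd z)) \<partial>(M \<Otimes>\<^sub>M N))"
    by (intro Bochner_Integration.integral_cong refl) (simp add: algebra_simps flip: exp_add)
  also have "\<dots> = (\<integral>x. \<integral>y. iexp (\<xi> * x) * iexp (-(\<xi> * y)) \<partial>N \<partial>M)"
    by (subst P.integral_fst'[symmetric])
       (auto intro!: P.integrable_const_bound[where B=1] simp: norm_mult)
  also have "\<dots> = (\<integral>x. iexp (\<xi> * x) \<partial>M) * (\<integral>y. iexp (-(\<xi> * y)) \<partial>N)"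
    by simp
  also have "(\<integral>y. iexp (-(\<xi> * y)) \<partial>N) = (\<integral>y. cnj (iexp (\<xi> * y)) \<partial>N)"
    by (simp add: exp_cnj)
  also have "(\<integral>y. cnj (iexp (\<xi> * y)) \<partial>N) = cnj (\<integral>y. iexp (\<xi> * y) \<partial>N)"
    by (rule Bochner_Integration.integral_cnj)
  finally show ?thesis by (simp add: char_def)
qed

end

context
  fixes D :: "real measure"
  assumes D: "real_distribution D"
begin

interpretation D: real_distribution D by (rule D)

text \<open>Fubini, applied to the Fourier representation of one term of the series of \<open>kap\<close>.\<close>

lemma exp_integral_as_fourier:
  assumes a: "a > 0"
  shows "(\<integral>t. exp (- (real (Suc m) * \<bar>t\<bar> / a)) / real (Suc m) \<partial>D) = (\<integral>\<xi>. kap_coeff a m \<xi> * Re (char D \<xi>) \<partial>lborel)"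
    and "integrable lborel (\<lambda>\<xi>. kap_coeff a m \<xi> * Re (char D \<xi>))"
proof -
  interpret P: pair_sigma_finite D lborel ..
  let ?f = "\<lambda>t \<xi>. cos (t * \<xi>) * kap_coeff a m \<xi>"
  have int: "integrable (D \<Otimes>\<^sub>M lborel) (case_prod ?f)"
  proof (rule Bochner_Integration.integrable_bound)
    show "integrable (D \<Otimes>\<^sub>M lborel) (\<lambda>(t, \<xi>). kap_coeff a m \<xi>)"
    proof (rule P.Fubini_integrable)
      show "integrable D (\<lambda>x. LBINT y. norm (case (x, y) of (t, \<xi>) \<Rightarrow> kap_coeff a m \<xi>))" by simp
    qed (use fourier_kap_coeff(1)[OF a] in auto)
    show "AE x in D \<Otimes>\<^sub>M lborel. norm (case_prod ?f x) \<le> norm (case x of (t, \<xi>) \<Rightarrow> kap_coeff a m \<xi>)"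
      using abs_cos_le_one by (intro AE_I2) (auto simp: abs_mult intro!: mult_left_le_one_le)
  qed measurable
  have c: "(\<integral>t. ?f t \<xi> \<partial>D) = kap_coeff a m \<xi> * Re (char D \<xi>)" for \<xi>
  proof -
    have "Re (char D \<xi>) = (\<integral>t. Re (iexp (\<xi> * t)) \<partial>D)"
      unfolding char_def by (rule integral_Re[symmetric]) (rule D.integrable_iexp, auto)
    then show ?thesis by (simp add: Re_exp mult_ac)
  qed
  have "(\<integral>t. exp (- (real (Suc m) * \<bar>t\<bar> / a)) / real (Suc m) \<partial>D) = (\<integral>t. \<integral>\<xi>. ?f t \<xi> \<partial>lborel \<partial>D)"
    by (simp only: fourier_kap_coeff(2)[OF a])
  also have "\<dots> = (\<integral>\<xi>. \<integral>t. ?f t \<xi> \<partial>D \<partial>lborel)"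
    by (rule P.Fubini_integral[OF int, symmetric])
  finally show "(\<integral>t. exp (- (real (Suc m) * \<bar>t\<bar> / a)) / real (Suc m) \<partial>D) = (\<integral>\<xi>. kap_coeff a m \<xi> * Re (char D \<xi>) \<partial>lborel)"
    unfolding c .
  show "integrable lborel (\<lambda>\<xi>. kap_coeff a m \<xi> * Re (char D \<xi>))"
    using P.integrable_snd[OF int] unfolding c .
qed

lemma exp_nn_integral_as_fourier:
  assumes a: "a > 0"
  shows "(\<integral>\<^sup>+t. ennreal (exp (- (real (Suc m) * \<bar>t\<bar> / a)) / real (Suc m)) \<partial>D) = ennreal (\<integral>\<xi>. kap_coeff a m \<xi> * Re (char D \<xi>) \<partial>lborel)"
proof -
  have "integrable D (\<lambda>t. exp (- (real (Suc m) * \<bar>t\<bar> / a)) / real (Suc m))"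
  proof (intro D.integrable_const_bound[where B=1] AE_I2)
    fix t :: real
    have "exp (- (real (Suc m) * \<bar>t\<bar> / a)) \<le> 1" using a by simp
    also have "1 \<le> real (Suc m)" by simp
    finally show "norm (exp (- (real (Suc m) * \<bar>t\<bar> / a)) / real (Suc m)) \<le> 1"
      by (simp add: divide_le_eq)
  qed measurable
  then show ?thesis
    by (subst nn_integral_eq_integral, assumption, simp, simp only: exp_integral_as_fourier(1)[OF a])
qed

lemma kap_integral_as_series:
  assumes "a > 0"
  shows "(\<integral>\<^sup>+t. kap a t \<partial>D) = (\<Sum>m. ennreal (\<integral>\<xi>. kap_coeff a m \<xi> * Re (char D \<xi>) \<partial>lborel))"
  unfolding kap_def exp_nn_integral_as_fourier[OF assms, symmetric]
  by (rule nn_integral_suminf) measurable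

text \<open>For a law with nonnegative characteristic function all exchanges of sums and integrals are
monotone, so the identity holds also when both sides are infinite. This covers the
self-energies, for which the characteristic function is \<open>\<bar>f\<bar>\<^sup>2\<close>.\<close>

lemma kap_integral_positive_definite:
  assumes a: "a > 0" and pos: "\<And>\<xi>. Re (char D \<xi>) \<ge> 0"
  shows "(\<integral>\<^sup>+t. kap a t \<partial>D) = (\<integral>\<^sup>+\<xi>. ennreal (kap_hat a \<xi> * Re (char D \<xi>)) \<partial>lborel)"
proof -
  have [measurable]: "(\<lambda>\<xi>. Re (char D \<xi>)) \<in> borel_measurable borel" by measurable
  have "(\<integral>\<^sup>+t. kap a t \<partial>D) = (\<Sum>m. \<integral>\<^sup>+\<xi>. ennreal (kap_coeff a m \<xi> * Re (char D \<xi>)) \<partial>lborel)"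
    unfolding kap_integral_as_series[OF a]
    by (intro arg_cong[where f=suminf] ext nn_integral_eq_integral[symmetric] exp_integral_as_fourier a)
       (use a pos kap_coeff_nonneg in auto)
  also have "\<dots> = (\<integral>\<^sup>+\<xi>. (\<Sum>m. ennreal (kap_coeff a m \<xi> * Re (char D \<xi>))) \<partial>lborel)"
    by (rule nn_integral_suminf[symmetric]) measurable
  also have "\<dots> = (\<integral>\<^sup>+\<xi>. ennreal (kap_hat a \<xi> * Re (char D \<xi>)) \<partial>lborel)"
  proof (intro nn_integral_cong)
    fix \<xi>
    have "(\<Sum>m. ennreal (kap_coeff a m \<xi> * Re (char D \<xi>))) = ennreal (\<Sum>m. kap_coeff a m \<xi> * Re (char D \<xi>))"
      using a pos by (intro suminf_ennreal2 summable_mult2 summable_kap_coeff) (auto simp: kap_coeff_nonneg)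
    also have "(\<Sum>m. kap_coeff a m \<xi> * Re (char D \<xi>)) = kap_hat a \<xi> * Re (char D \<xi>)"
      unfolding kap_hat_def by (rule suminf_mult2[symmetric]) (rule summable_kap_coeff[OF a])
    finally show "(\<Sum>m. ennreal (kap_coeff a m \<xi> * Re (char D \<xi>))) = ennreal (kap_hat a \<xi> * Re (char D \<xi>))" .
  qed
  finally show ?thesis .
qed

end

lemma cmod_diff_squared:
  "(cmod (z - w))\<^sup>2 = Re (z * cnj z) - 2 * Re (w * cnj z) + Re (w * cnj w)"
  unfolding cmod_power2 by (simp add: power2_eq_square algebra_simps)

lemma char_diff_law_self:
  assumes "real_distribution M"
  shows "Re (char (diff_law M M) \<xi>) = (cmod (char M \<xi>))\<^sup>2"
  unfolding char_diff_law[OF assms assms] cmod_power2 by (simp add: power2_eq_square)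

lemma Re_mult_cnj_le: "\<bar>Re (z * cnj w)\<bar> \<le> ((cmod z)\<^sup>2 + (cmod w)\<^sup>2) / 2"
proof -
  have "\<bar>Re (z * cnj w)\<bar> \<le> cmod z * cmod w"
    using abs_Re_le_cmod[of "z * cnj w"] by (simp add: norm_mult)
  also have "\<dots> \<le> ((cmod z)\<^sup>2 + (cmod w)\<^sup>2) / 2"
    using sum_squares_bound[of "cmod z" "cmod w"] by simp
  finally show ?thesis .
qed

context
  fixes M :: "real measure"
  assumes M: "real_distribution M"
begin

interpretation M: real_distribution M by (rule M)

lemma kap_energy_self:
  assumes "a > 0"
  shows "kap_energy a M M = (\<integral>\<^sup>+\<xi>. ennreal (kap_hat a \<xi> * (cmod (char M \<xi>))\<^sup>2) \<partial>lborel)"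
  using kap_integral_positive_definite[OF real_distribution_diff_law[OF M M] assms]
  by (simp add: char_diff_law_self[OF M])

lemma kap_energy_self_integrable:
  assumes a: "a > 0" and fin: "kap_energy a M M < \<infinity>"
  shows "integrable lborel (\<lambda>\<xi>. kap_hat a \<xi> * (cmod (char M \<xi>))\<^sup>2)"
  using fin kap_hat_nonneg[OF a] unfolding kap_energy_self[OF a]
  by (intro integrableI_nonneg) auto

lemma kap_energy_finite:
  assumes a: "a > 0" and fin: "kap_energy 1 M M < \<infinity>"
  shows "kap_energy a M M < \<infinity>"
proof -
  have "(\<integral>\<^sup>+\<xi>. ennreal (kap_hat a \<xi> * (cmod (char M \<xi>))\<^sup>2) \<partial>lborel)
     \<le> (\<integral>\<^sup>+\<xi>. ennreal (max a (1 / a)) * ennreal (kap_hat 1 \<xi> * (cmod (char M \<xi>))\<^sup>2) \<partial>lborel)"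
  proof (intro nn_integral_mono)
    fix \<xi>
    have "kap_hat a \<xi> * (cmod (char M \<xi>))\<^sup>2 \<le> max a (1 / a) * kap_hat 1 \<xi> * (cmod (char M \<xi>))\<^sup>2"
      by (intro mult_right_mono kap_hat_le a) auto
    then show "ennreal (kap_hat a \<xi> * (cmod (char M \<xi>))\<^sup>2) \<le> ennreal (max a (1 / a)) * ennreal (kap_hat 1 \<xi> * (cmod (char M \<xi>))\<^sup>2)"
      using a kap_hat_nonneg[of 1 \<xi>] by (subst ennreal_mult[symmetric]) (auto simp: mult.assoc intro!: ennreal_leI)
  qed
  also have "\<dots> = ennreal (max a (1 / a)) * (kap_energy 1 M M)"
    by (subst nn_integral_cmult) (auto simp: kap_energy_self)
  also have "\<dots> < \<infinity>" using fin by (simp add: ennreal_mult_less_top)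
  finally show ?thesis by (simp add: kap_energy_self[OF a])
qed

end

text \<open>For two different laws the integrand changes sign. It is dominated by the mean of the two
self-energy integrands, and the partial sums of the series of \<open>kap\<close> converge by dominated
convergence; each single term is nonnegative on the space side, which brings the identity
back to extended nonnegative reals.\<close>

lemma kap_energy_mixed:
  assumes M: "real_distribution M" and N: "real_distribution N" and a: "a > 0"
    and finM: "kap_energy a M M < \<infinity>" and finN: "kap_energy a N N < \<infinity>"
  shows "integrable lborel (\<lambda>\<xi>. kap_hat a \<xi> * Re (char M \<xi> * cnj (char N \<xi>)))"
    and "kap_energy a M N = ennreal (\<integral>\<xi>. kap_hat a \<xi> * Re (char M \<xi> * cnj (char N \<xi>)) \<partial>lborel)"
    and "0 \<le> (\<integral>\<xi>. kap_hat a \<xi> * Re (char M \<xi> * cnj (char N \<xi>)) \<partial>lborel)"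
proof -
  interpret M: real_distribution M by (rule M)
  interpret N: real_distribution N by (rule N)
  define \<phi> where "\<phi> \<xi> = Re (char M \<xi> * cnj (char N \<xi>))" for \<xi>
  define w where "w \<xi> = (kap_hat a \<xi> * (cmod (char M \<xi>))\<^sup>2 + kap_hat a \<xi> * (cmod (char N \<xi>))\<^sup>2) / 2" for \<xi>
  have \<phi>: "\<phi> \<xi> = Re (char (diff_law M N) \<xi>)" for \<xi>
    unfolding \<phi>_def char_diff_law[OF M N] ..
  interpret D: real_distribution "diff_law M N" by (rule real_distribution_diff_law[OF M N])
  have [measurable]: "\<phi> \<in> borel_measurable borel" unfolding \<phi>[abs_def] by measurable
  have w: "integrable lborel w" unfolding w_def
    by (intro integrable_divide Bochner_Integration.integrable_add kap_energy_self_integrable M N a finM finN)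
  have bound: "\<bar>kap_hat a \<xi> * \<phi> \<xi>\<bar> \<le> w \<xi>" for \<xi>
  proof -
    have "\<bar>kap_hat a \<xi> * \<phi> \<xi>\<bar> = kap_hat a \<xi> * \<bar>\<phi> \<xi>\<bar>" using kap_hat_nonneg[OF a] by (simp add: abs_mult)
    also have "\<dots> \<le> kap_hat a \<xi> * (((cmod (char M \<xi>))\<^sup>2 + (cmod (char N \<xi>))\<^sup>2) / 2)"
      unfolding \<phi>_def by (intro mult_left_mono Re_mult_cnj_le kap_hat_nonneg a)
    finally show ?thesis by (simp add: w_def algebra_simps)
  qed
  show int: "integrable lborel (\<lambda>\<xi>. kap_hat a \<xi> * Re (char M \<xi> * cnj (char N \<xi>)))"
    unfolding \<phi>_def[symmetric]
    using bound by (intro Bochner_Integration.integrable_bound[OF w] AE_I2) (auto intro: order_trans[OF _ abs_ge_self])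
  define e where "e m = (\<integral>\<xi>. kap_coeff a m \<xi> * \<phi> \<xi> \<partial>lborel)" for m
  have e_int: "integrable lborel (\<lambda>\<xi>. kap_coeff a m \<xi> * \<phi> \<xi>)" for m
    unfolding \<phi> by (rule exp_integral_as_fourier(2)[OF real_distribution_diff_law[OF M N] a])
  have e_nonneg: "e m \<ge> 0" for m
    unfolding e_def \<phi> exp_integral_as_fourier(1)[OF real_distribution_diff_law[OF M N] a, symmetric]
    by simp
  have "(\<lambda>n. \<integral>\<xi>. (\<Sum>m<n. kap_coeff a m \<xi>) * \<phi> \<xi> \<partial>lborel) \<longlonglongrightarrow> (\<integral>\<xi>. kap_hat a \<xi> * \<phi> \<xi> \<partial>lborel)"
  proof (rule integral_dominated_convergence[OF _ _ w])
    show "AE \<xi> in lborel. (\<lambda>n. (\<Sum>m<n. kap_coeff a m \<xi>) * \<phi> \<xi>) \<longlonglongrightarrow> kap_hat a \<xi> * \<phi> \<xi>"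
      unfolding kap_hat_def by (intro AE_I2 tendsto_mult tendsto_const summable_LIMSEQ summable_kap_coeff a)
    show "AE \<xi> in lborel. norm ((\<Sum>m<n. kap_coeff a m \<xi>) * \<phi> \<xi>) \<le> w \<xi>" for n
    proof (rule AE_I2)
      fix \<xi>
      have "0 \<le> (\<Sum>m<n. kap_coeff a m \<xi>)" using a by (intro sum_nonneg kap_coeff_nonneg) auto
      moreover have "(\<Sum>m<n. kap_coeff a m \<xi>) \<le> kap_hat a \<xi>"
        unfolding kap_hat_def using a by (intro sum_le_suminf summable_kap_coeff) (auto intro: kap_coeff_nonneg)
      ultimately have "norm ((\<Sum>m<n. kap_coeff a m \<xi>) * \<phi> \<xi>) \<le> \<bar>kap_hat a \<xi> * \<phi> \<xi>\<bar>"
        unfolding real_norm_def abs_mult by (intro mult_right_mono) auto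
      also have "\<dots> \<le> w \<xi>" by (rule bound)
      finally show "norm ((\<Sum>m<n. kap_coeff a m \<xi>) * \<phi> \<xi>) \<le> w \<xi>" .
    qed
  qed auto
  moreover have "(\<integral>\<xi>. (\<Sum>m<n. kap_coeff a m \<xi>) * \<phi> \<xi> \<partial>lborel) = (\<Sum>m<n. e m)" for n
    unfolding e_def sum_distrib_right by (rule Bochner_Integration.integral_sum) (rule e_int)
  ultimately have s: "e sums (\<integral>\<xi>. kap_hat a \<xi> * \<phi> \<xi> \<partial>lborel)"
    by (simp add: sums_def)
  have "kap_energy a M N = (\<Sum>m. ennreal (e m))"
    unfolding kap_integral_as_series[OF real_distribution_diff_law[OF M N] a] e_def \<phi> ..
  also have "\<dots> = ennreal (suminf e)"
    using s e_nonneg by (intro suminf_ennreal2) (auto simp: sums_iff)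
  also have "suminf e = (\<integral>\<xi>. kap_hat a \<xi> * \<phi> \<xi> \<partial>lborel)"
    using s by (simp add: sums_iff)
  finally show "kap_energy a M N = ennreal (\<integral>\<xi>. kap_hat a \<xi> * Re (char M \<xi> * cnj (char N \<xi>)) \<partial>lborel)"
    by (simp add: \<phi>_def)
  show "0 \<le> (\<integral>\<xi>. kap_hat a \<xi> * Re (char M \<xi> * cnj (char N \<xi>)) \<partial>lborel)"
    unfolding \<phi>_def[symmetric] using s e_nonneg by (metis sums_iff suminf_nonneg)
qed

section \<open>The Brownian covariance\<close>

text \<open>The covariance function of two-sided Brownian motion. Through
\<open>max u v = max u 0 + max v 0 - brownian u v\<close> it carries the leading part
\<open>- max u v\<close> of the kernel \<open>- ln \<bar>exp u - exp v\<bar>\<close>.\<close>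

definition brownian :: "real \<Rightarrow> real \<Rightarrow> real" where
  "brownian u v = (\<bar>u\<bar> + \<bar>v\<bar> - \<bar>u - v\<bar>) / 2"

lemma measurable_brownian [measurable]: "case_prod brownian \<in> borel_measurable (borel \<Otimes>\<^sub>M borel)"
  unfolding brownian_def[abs_def] by measurable

lemma brownian_nonneg: "brownian u v \<ge> 0" by (simp add: brownian_def)

lemma max_eq_brownian: "max u v = max u 0 + max v 0 - brownian u v"
  by (simp add: brownian_def max_def abs_if)

text \<open>The indicator of the points \<open>w\<close> strictly between \<open>0\<close> and \<open>u\<close>. The value \<open>brownian u v\<close> is the
length of the common part of the segments from \<open>0\<close> to \<open>u\<close> and from \<open>0\<close> to \<open>v\<close>, which shows
that the Brownian form is a Gram form.\<close>

definition passes :: "real \<Rightarrow> real \<Rightarrow> ennreal" where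
  "passes u w = (if 0 < w \<and> w < u \<or> u < w \<and> w < 0 then 1 else 0)"

lemma measurable_passes [measurable (raw)]:
  assumes [measurable]: "f \<in> borel_measurable M" "g \<in> borel_measurable M"
  shows "(\<lambda>z. passes (f z) (g z)) \<in> borel_measurable M"
  unfolding passes_def by measurable

lemma brownian_overlap:
  "(\<integral>\<^sup>+w. passes u w * passes v w \<partial>lborel) = ennreal (brownian u v)"
proof -
  have "(\<integral>\<^sup>+w. passes u w * passes v w \<partial>lborel) =
     (\<integral>\<^sup>+w. indicator {0<..<min u v} w + indicator {max u v<..<0} w \<partial>lborel)"
    by (intro nn_integral_cong) (auto simp: passes_def split: split_indicator)
  also have "\<dots> = emeasure lborel {0<..<min u v} + emeasure lborel {max u v<..<0}"
    by (subst nn_integral_add) auto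
  also have "\<dots> = ennreal (max 0 (min u v)) + ennreal (max 0 (- max u v))"
    by (auto simp: max_def min_def)
  also have "\<dots> = ennreal (brownian u v)"
    by (subst ennreal_plus[symmetric]) (auto simp: brownian_def max_def min_def abs_if)
  finally show ?thesis .
qed

lemma ennreal_twice_mult_le: 
  fixes a b :: ennreal assumes "a < \<infinity>" "b < \<infinity>" shows "2 * (a * b) \<le> a * a + b * b"
proof -
  obtain x y where xy: "a = ennreal x" "b = ennreal y" "0 \<le> x" "0 \<le> y"
    using assms by (cases a; cases b) auto
  have "2 * (x * y) \<le> x * x + y * y" using sum_squares_bound[of x y] by (simp add: power2_eq_square)
  then have "ennreal (2 * (x * y)) \<le> ennreal (x * x + y * y)" by (rule ennreal_leI)
  then show ?thesis using xy by (simp add: ennreal_mult flip: ennreal_plus) (simp add: ennreal_mult)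
qed

definition brownian_energy :: "real measure \<Rightarrow> real measure \<Rightarrow> ennreal" where
  "brownian_energy M N = (\<integral>\<^sup>+u. \<integral>\<^sup>+v. ennreal (brownian u v) \<partial>N \<partial>M)"

lemma brownian_energy_overlap:
  assumes M: "real_distribution M" and N: "real_distribution N"
  shows "brownian_energy M N = (\<integral>\<^sup>+w. (\<integral>\<^sup>+u. passes u w \<partial>M) * (\<integral>\<^sup>+v. passes v w \<partial>N) \<partial>lborel)"
proof -
  interpret M: real_distribution M by (rule M)
  interpret N: real_distribution N by (rule N)
  interpret MN: pair_sigma_finite M N ..
  interpret LM: pair_sigma_finite M lborel ..
  interpret LN: pair_sigma_finite N lborel ..
  have "brownian_energy M N = (\<integral>\<^sup>+u. \<integral>\<^sup>+v. \<integral>\<^sup>+w. passes u w * passes v w \<partial>lborel \<partial>N \<partial>M)"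
    unfolding brownian_energy_def brownian_overlap ..
  also have "\<dots> = (\<integral>\<^sup>+u. \<integral>\<^sup>+w. \<integral>\<^sup>+v. passes u w * passes v w \<partial>N \<partial>lborel \<partial>M)"
    by (intro nn_integral_cong LN.Fubini'[symmetric]) measurable
  also have "\<dots> = (\<integral>\<^sup>+u. \<integral>\<^sup>+w. passes u w * (\<integral>\<^sup>+v. passes v w \<partial>N) \<partial>lborel \<partial>M)"
    by (intro nn_integral_cong nn_integral_cmult) measurable
  also have "\<dots> = (\<integral>\<^sup>+w. \<integral>\<^sup>+u. passes u w * (\<integral>\<^sup>+v. passes v w \<partial>N) \<partial>M \<partial>lborel)"
    by (intro LM.Fubini'[symmetric]) measurable
  also have "\<dots> = (\<integral>\<^sup>+w. (\<integral>\<^sup>+u. passes u w \<partial>M) * (\<integral>\<^sup>+v. passes v w \<partial>N) \<partial>lborel)"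
    by (intro nn_integral_cong nn_integral_multc) measurable
  finally show ?thesis .
qed

lemma brownian_energy_sym:
  assumes M: "real_distribution M" and N: "real_distribution N"
  shows "brownian_energy M N = brownian_energy N M"
  unfolding brownian_energy_overlap[OF M N] brownian_energy_overlap[OF N M] by (simp add: mult.commute)

text \<open>The form is a scalar product in \<open>L\<^sup>2\<close>, so \<open>2 a b \<le> a\<^sup>2 + b\<^sup>2\<close> suffices pointwise.\<close>

lemma brownian_energy_mixed_le:
  assumes M: "real_distribution M" and N: "real_distribution N"
  shows "2 * brownian_energy M N \<le> brownian_energy M M + brownian_energy N N"
proof -
  interpret M: real_distribution M by (rule M)
  interpret N: real_distribution N by (rule N)
  interpret LM: pair_sigma_finite M lborel ..
  interpret LN: pair_sigma_finite N lborel ..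
  have fin: "(\<integral>\<^sup>+u. passes u w \<partial>M) < \<infinity>" "(\<integral>\<^sup>+u. passes u w \<partial>N) < \<infinity>" for w
  proof -
    have "(\<integral>\<^sup>+u. passes u w \<partial>M) \<le> (\<integral>\<^sup>+u. 1 \<partial>M)"
      by (intro nn_integral_mono) (auto simp: passes_def)
    then show "(\<integral>\<^sup>+u. passes u w \<partial>M) < \<infinity>" using M.emeasure_space_1 by (auto simp: less_top[symmetric] top_unique)
    have "(\<integral>\<^sup>+u. passes u w \<partial>N) \<le> (\<integral>\<^sup>+u. 1 \<partial>N)"
      by (intro nn_integral_mono) (auto simp: passes_def)
    then show "(\<integral>\<^sup>+u. passes u w \<partial>N) < \<infinity>" using N.emeasure_space_1 by (auto simp: less_top[symmetric] top_unique)
  qed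
  have [measurable]: "(\<lambda>w. \<integral>\<^sup>+u. passes u w \<partial>M) \<in> borel_measurable borel"
     "(\<lambda>w. \<integral>\<^sup>+u. passes u w \<partial>N) \<in> borel_measurable borel" by measurable
  show ?thesis
    unfolding brownian_energy_overlap[OF M N] brownian_energy_overlap[OF M M] brownian_energy_overlap[OF N N]
    by (subst nn_integral_cmult[symmetric], measurable, subst nn_integral_add[symmetric], measurable)
       (intro nn_integral_mono ennreal_twice_mult_le fin)
qed

text \<open>A bounded substitute for \<open>\<bar>t\<bar> / 2\<close>, with an explicit Fourier transform. It keeps the
three terms of the Brownian covariance separately integrable, which \<open>\<bar>u\<bar>\<close>, \<open>\<bar>v\<bar>\<close> and
\<open>\<bar>u - v\<bar>\<close> themselves need not be, as the negative parts of the laws may have no first moment.\<close>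

definition laplace_bump :: "real \<Rightarrow> real \<Rightarrow> real" where
  "laplace_bump e t = (1 - exp (- (e * \<bar>t\<bar>))) / (2 * e)"

lemma laplace_bump_le: "e > 0 \<Longrightarrow> laplace_bump e t \<le> \<bar>t\<bar> / 2"
  using exp_ge_add_one_self[of "- (e * \<bar>t\<bar>)"] by (simp add: laplace_bump_def field_simps)

lemma laplace_bump_mono: "e > 0 \<Longrightarrow> \<bar>s\<bar> \<le> \<bar>t\<bar> \<Longrightarrow> laplace_bump e s \<le> laplace_bump e t"
  by (simp add: laplace_bump_def divide_right_mono)

text \<open>With \<open>x = exp (- e \<bar>s\<bar>)\<close> and \<open>y = exp (- e \<bar>t\<bar>)\<close> this is \<open>(1 - x) (1 - y) \<ge> 0\<close>.\<close>

lemma laplace_bump_triangle: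
  assumes e: "e > 0"
  shows "laplace_bump e (s - t) \<le> laplace_bump e s + laplace_bump e t"
proof -
  define x y where "x = exp (- (e * \<bar>s\<bar>))" and "y = exp (- (e * \<bar>t\<bar>))"
  have xy: "x \<le> 1" "y \<le> 1" "0 < x" "0 < y" using e by (auto simp: x_def y_def)
  have "\<bar>s - t\<bar> \<le> \<bar>s\<bar> + \<bar>t\<bar>" by (rule abs_triangle_ineq4)
  then have "exp (- (e * (\<bar>s\<bar> + \<bar>t\<bar>))) \<le> exp (- (e * \<bar>s - t\<bar>))" using e by simp
  moreover have "exp (- (e * (\<bar>s\<bar> + \<bar>t\<bar>))) = x * y"
    by (simp add: x_def y_def algebra_simps flip: exp_add)
  moreover have "(1 - x) * (1 - y) \<ge> 0" using xy by simp
  ultimately have "x * y \<le> exp (- (e * \<bar>s - t\<bar>))" "x + y \<le> 1 + x * y"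
    by (simp_all only:) (simp add: algebra_simps)
  then have "1 - exp (- (e * \<bar>s - t\<bar>)) \<le> (1 - x) + (1 - y)" by linarith
  then show ?thesis
    unfolding laplace_bump_def x_def[symmetric] y_def[symmetric] add_divide_distrib[symmetric]
    using e by (intro divide_right_mono) auto
qed

lemma laplace_bump_le_1: "e > 0 \<Longrightarrow> \<bar>laplace_bump e t\<bar> \<le> 1 / (2 * e)"
  by (auto simp: laplace_bump_def intro!: divide_right_mono)

lemma measurable_laplace_bump [measurable]: "laplace_bump e \<in> borel_measurable borel"
  unfolding laplace_bump_def[abs_def] by measurable

lemma laplace_bump_tendsto:
  fixes e :: "nat \<Rightarrow> real"
  assumes "\<And>n. e n > 0" "e \<longlonglongrightarrow> 0"
  shows "(\<lambda>n. laplace_bump (e n) t) \<longlonglongrightarrow> \<bar>t\<bar> / 2"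
proof -
  have "((\<lambda>x. exp (- (x * \<bar>t\<bar>))) has_real_derivative - \<bar>t\<bar>) (at 0)"
    by (auto intro!: derivative_eq_intros)
  then have "((\<lambda>x. (exp (- (x * \<bar>t\<bar>)) - 1) / x) \<longlongrightarrow> - \<bar>t\<bar>) (at 0)" by (simp add: DERIV_def)
  moreover have "filterlim e (at 0) sequentially"
  proof -
    have "e n \<noteq> 0" for n using assms(1)[of n] by simp
    then show ?thesis using assms(2) by (simp add: filterlim_at)
  qed
  ultimately have "(\<lambda>n. (exp (- (e n * \<bar>t\<bar>)) - 1) / e n) \<longlonglongrightarrow> - \<bar>t\<bar>"
    by (rule filterlim_compose)
  from tendsto_mult[OF this tendsto_const[of "- 1 / 2"]]
  have "(\<lambda>n. (exp (- (e n * \<bar>t\<bar>)) - 1) / e n * (- 1 / 2)) \<longlonglongrightarrow> \<bar>t\<bar> / 2" by simp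
  moreover have "(exp (- (e n * \<bar>t\<bar>)) - 1) / e n * (- 1 / 2) = laplace_bump (e n) t" for n
  proof -
    have "((x - 1) / y * (- 1 / 2)) = (1 - x) / (2 * y)" if "y > 0" for x y :: real
      using that by (simp add: field_simps)
    then show ?thesis unfolding laplace_bump_def by (metis assms(1))
  qed
  ultimately show ?thesis by simp
qed

definition damped_brownian :: "real \<Rightarrow> real \<Rightarrow> real \<Rightarrow> real" where
  "damped_brownian e u v = laplace_bump e u + laplace_bump e v - laplace_bump e (u - v)"

text \<open>The majorant for the passage to the limit \<open>e \<rightarrow> 0\<close>. On equal signs \<open>brownian u v\<close> is
the smaller of \<open>\<bar>u\<bar>\<close> and \<open>\<bar>v\<bar>\<close> and suffices by itself. On opposite signs it vanishes while the
damped kernel need not; there the positive one of the two variables takes over, whose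
integrability is part of finite energy.\<close>

lemma damped_brownian_bound:
  assumes e: "e > 0"
  shows "\<bar>damped_brownian e u v\<bar> \<le> brownian u v + max u 0 + max v 0"
proof -
  have 0: "damped_brownian e u v \<ge> 0"
    using laplace_bump_triangle[OF e, of u v] by (simp add: damped_brownian_def)
  have uv: "laplace_bump e u \<le> laplace_bump e (u - v) + laplace_bump e v"
    using laplace_bump_triangle[OF e, of "u - v" "- v"] by (simp add: laplace_bump_def)
  have vu: "laplace_bump e v \<le> laplace_bump e (u - v) + laplace_bump e u"
    using laplace_bump_triangle[OF e, of u "u - v"] by (simp add: add.commute)
  have u: "laplace_bump e u \<le> \<bar>u\<bar> / 2" and v: "laplace_bump e v \<le> \<bar>v\<bar> / 2"
    using laplace_bump_le[OF e] by auto
  have "damped_brownian e u v \<le> brownian u v + max u 0 + max v 0"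
  proof -
    have mx: "max u 0 \<ge> 0" "max v 0 \<ge> 0" by simp_all
    consider "(u \<ge> 0 \<longleftrightarrow> v \<ge> 0)" "\<bar>u\<bar> \<le> \<bar>v\<bar>" | "(u \<ge> 0 \<longleftrightarrow> v \<ge> 0)" "\<bar>v\<bar> \<le> \<bar>u\<bar>"
      | "u \<ge> 0" "v < 0" | "u < 0" "v \<ge> 0" by linarith
    then show ?thesis
    proof cases
      case 1
      then have "brownian u v = \<bar>u\<bar>" by (auto simp: brownian_def)
      then show ?thesis using vu u mx unfolding damped_brownian_def by simp
    next
      case 2
      then have "brownian u v = \<bar>v\<bar>" by (auto simp: brownian_def)
      then show ?thesis using uv v mx unfolding damped_brownian_def by simp
    next
      case 3
      then have "laplace_bump e v \<le> laplace_bump e (u - v)" by (intro laplace_bump_mono e) auto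
      moreover have "\<bar>u\<bar> / 2 \<le> max u 0" using 3 by simp
      ultimately show ?thesis using u mx brownian_nonneg[of u v] unfolding damped_brownian_def by simp
    next
      case 4
      then have "laplace_bump e u \<le> laplace_bump e (u - v)" by (intro laplace_bump_mono e) auto
      moreover have "\<bar>v\<bar> / 2 \<le> max v 0" using 4 by simp
      ultimately show ?thesis using v mx brownian_nonneg[of u v] unfolding damped_brownian_def by simp
    qed
  qed
  with 0 show ?thesis by simp
qed

text \<open>The laws of \<open>ln \<bar>x\<bar>\<close> for \<open>x\<close> distributed according to a normalized measure of finite logarithmic
energy on a half-line (see \<open>finite_energy_law_of_scaled\<close> and \<open>log_energy_scaled_law\<close>). Only the
positive part is integrable in general: mass may accumulate at the origin so slowly that
\<open>ln \<bar>x\<bar>\<close> has no first moment.\<close>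

definition finite_energy_law :: "real measure \<Rightarrow> bool" where
  "finite_energy_law M \<longleftrightarrow> real_distribution M \<and> (\<integral>\<^sup>+u. ennreal (max u 0) \<partial>M) < \<infinity> \<and>
     brownian_energy M M < \<infinity> \<and> kap_energy 1 M M < \<infinity>"

definition brown_form :: "real measure \<Rightarrow> real measure \<Rightarrow> real" where
  "brown_form M N = enn2real (brownian_energy M N)"

definition kap_form :: "real \<Rightarrow> real measure \<Rightarrow> real measure \<Rightarrow> real" where
  "kap_form a M N = enn2real (kap_energy a M N)"

lemma finite_energy_law_dist: "finite_energy_law M \<Longrightarrow> real_distribution M"
  by (simp add: finite_energy_law_def)

lemma kap_form_fourier:
  assumes M: "finite_energy_law M" and N: "finite_energy_law N" and a: "a > 0"
  shows "integrable lborel (\<lambda>\<xi>. kap_hat a \<xi> * Re (char M \<xi> * cnj (char N \<xi>)))"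
    and "kap_energy a M N < \<infinity>"
    and "kap_form a M N = (\<integral>\<xi>. kap_hat a \<xi> * Re (char M \<xi> * cnj (char N \<xi>)) \<partial>lborel)"
proof -
  note D = M[THEN finite_energy_law_dist] N[THEN finite_energy_law_dist]
  have finM: "kap_energy a M M < \<infinity>"
    by (rule kap_energy_finite[OF D(1) a]) (use M in \<open>simp add: finite_energy_law_def\<close>)
  have finN: "kap_energy a N N < \<infinity>"
    by (rule kap_energy_finite[OF D(2) a]) (use N in \<open>simp add: finite_energy_law_def\<close>)
  note * = kap_energy_mixed[OF D a finM finN]
  show "integrable lborel (\<lambda>\<xi>. kap_hat a \<xi> * Re (char M \<xi> * cnj (char N \<xi>)))" by (rule *)
  show "kap_energy a M N < \<infinity>" unfolding *(2) by simp
  show "kap_form a M N = (\<integral>\<xi>. kap_hat a \<xi> * Re (char M \<xi> * cnj (char N \<xi>)) \<partial>lborel)"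
    unfolding kap_form_def *(2) using *(3) by simp
qed

lemma kap_form_sym:
  assumes M: "finite_energy_law M" and N: "finite_energy_law N" and a: "a > 0"
  shows "kap_form a M N = kap_form a N M"
  unfolding kap_form_fourier(3)[OF M N a] kap_form_fourier(3)[OF N M a]
  by (simp add: mult.commute)

lemma brown_form_sym:
  assumes M: "finite_energy_law M" and N: "finite_energy_law N"
  shows "brown_form M N = brown_form N M"
  unfolding brown_form_def by (simp add: brownian_energy_sym M N finite_energy_law_dist)

lemma finite_energy_positive_part:
  assumes M: "finite_energy_law M"
  shows "integrable M (\<lambda>u. max u 0)"
proof -
  interpret real_distribution M using M by (rule finite_energy_law_dist)
  show ?thesis using M unfolding finite_energy_law_def by (intro integrableI_nonneg) auto
qed

text \<open>The mixed energy is finite because the self-energies are.\<close>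

lemma brown_form_integral:
  assumes M: "finite_energy_law M" and N: "finite_energy_law N"
  shows "brownian_energy M N < \<infinity>"
    and "integrable (M \<Otimes>\<^sub>M N) (\<lambda>(u, v). brownian u v)"
    and "brown_form M N = (\<integral>(u, v). brownian u v \<partial>(M \<Otimes>\<^sub>M N))"
proof -
  note D = M[THEN finite_energy_law_dist] N[THEN finite_energy_law_dist]
  interpret M: real_distribution M by (rule D)
  interpret N: real_distribution N by (rule D)
  interpret P: pair_prob_space M N ..
  have "brownian_energy M N \<le> 2 * brownian_energy M N"
    using add_left_mono[of 0 "brownian_energy M N" "brownian_energy M N"] by (simp add: mult_2)
  also have "2 * brownian_energy M N < \<infinity>"
    using brownian_energy_mixed_le[OF D] M N unfolding finite_energy_law_def
    by (auto intro: le_less_trans)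
  finally show fin: "brownian_energy M N < \<infinity>" .
  have nn: "(\<integral>\<^sup>+z. ennreal (case z of (u, v) \<Rightarrow> brownian u v) \<partial>(M \<Otimes>\<^sub>M N)) = brownian_energy M N"
    unfolding brownian_energy_def by (subst N.nn_integral_fst[symmetric]) (auto intro!: nn_integral_cong)
  show int: "integrable (M \<Otimes>\<^sub>M N) (\<lambda>(u, v). brownian u v)"
    using fin brownian_nonneg unfolding nn[symmetric] by (intro integrableI_nonneg) auto
  show "brown_form M N = (\<integral>(u, v). brownian u v \<partial>(M \<Otimes>\<^sub>M N))"
  proof -
    have "0 \<le> (\<integral>(u, v). brownian u v \<partial>(M \<Otimes>\<^sub>M N))"
      by (intro integral_nonneg_AE AE_I2) (auto simp: brownian_nonneg)
    then show ?thesis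
      unfolding brown_form_def nn[symmetric]
      by (subst nn_integral_eq_integral[OF int]) (auto simp: brownian_nonneg)
  qed
qed

lemma (in pair_prob_space) integral_marginals:
  fixes f :: "_ \<Rightarrow> real"
  shows integrable_marginal1: "integrable M1 f \<Longrightarrow> integrable (M1 \<Otimes>\<^sub>M M2) (\<lambda>z. f (fst z))"
    and integrable_marginal2: "integrable M2 g \<Longrightarrow> integrable (M1 \<Otimes>\<^sub>M M2) (\<lambda>z. g (snd z))"
    and integral_marginal1: "integrable M1 f \<Longrightarrow> (\<integral>z. f (fst z) \<partial>(M1 \<Otimes>\<^sub>M M2)) = (\<integral>x. f x \<partial>M1)"
    and integral_marginal2: "integrable M2 g \<Longrightarrow> (\<integral>z. g (snd z) \<partial>(M1 \<Otimes>\<^sub>M M2)) = (\<integral>x. (g x :: real) \<partial>M2)"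
proof -
  have i1: "integrable (M1 \<Otimes>\<^sub>M M2) (\<lambda>z. f (fst z))" if "integrable M1 f"
  proof (rule integrableI_bounded)
    have [measurable]: "f \<in> borel_measurable M1" using that by simp
    show "(\<lambda>z. f (fst z)) \<in> borel_measurable (M1 \<Otimes>\<^sub>M M2)" by measurable
    show "(\<integral>\<^sup>+z. ennreal (norm (f (fst z))) \<partial>(M1 \<Otimes>\<^sub>M M2)) < \<infinity>"
      using that by (subst M2.nn_integral_fst[symmetric]) (auto simp: integrable_iff_bounded M2.emeasure_space_1)
  qed
  have i2: "integrable (M1 \<Otimes>\<^sub>M M2) (\<lambda>z. g (snd z))" if "integrable M2 g"
  proof (rule integrableI_bounded)
    have [measurable]: "g \<in> borel_measurable M2" using that by simp
    show "(\<lambda>z. g (snd z)) \<in> borel_measurable (M1 \<Otimes>\<^sub>M M2)" by measurable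
    show "(\<integral>\<^sup>+z. ennreal (norm (g (snd z))) \<partial>(M1 \<Otimes>\<^sub>M M2)) < \<infinity>"
      using that by (subst M2.nn_integral_fst[symmetric]) (auto simp: integrable_iff_bounded M1.emeasure_space_1)
  qed
  show "integrable M1 f \<Longrightarrow> integrable (M1 \<Otimes>\<^sub>M M2) (\<lambda>z. f (fst z))"
    and "integrable M2 g \<Longrightarrow> integrable (M1 \<Otimes>\<^sub>M M2) (\<lambda>z. g (snd z))"
    by (fact i1 i2)+
  show "(\<integral>z. f (fst z) \<partial>(M1 \<Otimes>\<^sub>M M2)) = (\<integral>x. f x \<partial>M1)" if "integrable M1 f"
    using integral_fst'[OF i1[OF that]] by (simp add: M2.prob_space)
  show "(\<integral>z. g (snd z) \<partial>(M1 \<Otimes>\<^sub>M M2)) = (\<integral>x. g x \<partial>M2)" if "integrable M2 g"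
    using integral_fst'[OF i2[OF that]] by (simp add: M1.prob_space)
qed

lemma damped_brownian_integral_tendsto:
  assumes M: "finite_energy_law M" and N: "finite_energy_law N"
    and e: "\<And>n. e n > 0" "e \<longlonglongrightarrow> 0"
  shows "(\<lambda>n. \<integral>(u, v). damped_brownian (e n) u v \<partial>(M \<Otimes>\<^sub>M N)) \<longlonglongrightarrow> brown_form M N"
  unfolding brown_form_integral(3)[OF M N]
proof -
  note D = M[THEN finite_energy_law_dist] N[THEN finite_energy_law_dist]
  interpret M: real_distribution M by (rule D)
  interpret N: real_distribution N by (rule D)
  interpret P: pair_prob_space M N ..
  have 1: "integrable (M \<Otimes>\<^sub>M N) (\<lambda>z. max (fst z) 0)"
    by (rule P.integrable_marginal1[OF finite_energy_positive_part[OF M]])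
  have 2: "integrable (M \<Otimes>\<^sub>M N) (\<lambda>z. max (snd z) 0)"
    by (rule P.integrable_marginal2[OF finite_energy_positive_part[OF N]])
  show "(\<lambda>n. \<integral>(u, v). damped_brownian (e n) u v \<partial>(M \<Otimes>\<^sub>M N)) \<longlonglongrightarrow> (\<integral>(u, v). brownian u v \<partial>(M \<Otimes>\<^sub>M N))"
  proof (rule integral_dominated_convergence[where w="\<lambda>(u, v). brownian u v + max u 0 + max v 0"])
    show "integrable (M \<Otimes>\<^sub>M N) (\<lambda>(u, v). brownian u v + max u 0 + max v 0)"
      using brown_form_integral(2)[OF M N] 1 2 by (simp add: case_prod_beta')
    show "AE z in M \<Otimes>\<^sub>M N. (\<lambda>n. case z of (u, v) \<Rightarrow> damped_brownian (e n) u v) \<longlonglongrightarrow> (case z of (u, v) \<Rightarrow> brownian u v)"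
    proof (intro AE_I2, clarify)
      fix u v
      have "(\<lambda>n. damped_brownian (e n) u v) \<longlonglongrightarrow> \<bar>u\<bar> / 2 + \<bar>v\<bar> / 2 - \<bar>u - v\<bar> / 2"
        unfolding damped_brownian_def by (intro tendsto_intros laplace_bump_tendsto e)
      then show "(\<lambda>n. damped_brownian (e n) u v) \<longlonglongrightarrow> brownian u v"
        by (simp add: brownian_def add_divide_distrib diff_divide_distrib)
    qed
    show "AE z in M \<Otimes>\<^sub>M N. norm (case z of (u, v) \<Rightarrow> damped_brownian (e n) u v) \<le> (case z of (u, v) \<Rightarrow> brownian u v + max u 0 + max v 0)" for n
      using damped_brownian_bound[OF e(1)] by (auto simp: case_prod_beta')
  qed (simp_all add: damped_brownian_def[abs_def])
qed

text \<open>Every term of the damped kernel is bounded, so the integral separates; the term in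
\<open>u - v\<close> involves \<open>exp (- e \<bar>u - v\<bar>)\<close>, whose transform is the zeroth Cauchy density with
parameter \<open>1 / e\<close>.\<close>

lemma damped_brownian_integral:
  assumes M: "real_distribution M" and N: "real_distribution N" and e: "e > 0"
  shows "(\<integral>(u, v). damped_brownian e u v \<partial>(M \<Otimes>\<^sub>M N)) =
    (\<integral>u. laplace_bump e u \<partial>M) + (\<integral>v. laplace_bump e v \<partial>N)
     - (1 / (2 * e)) * (1 - (\<integral>\<xi>. kap_coeff (1 / e) 0 \<xi> * Re (char M \<xi> * cnj (char N \<xi>)) \<partial>lborel))"
proof -
  interpret M: real_distribution M by (rule M)
  interpret N: real_distribution N by (rule N)
  interpret P: pair_prob_space M N ..
  interpret D: real_distribution "diff_law M N" by (rule real_distribution_diff_law[OF M N])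
  have b: "\<bar>laplace_bump e t\<bar> \<le> 1 / (2 * e)" for t by (rule laplace_bump_le_1[OF e])
  have i: "integrable M (laplace_bump e)" "integrable N (laplace_bump e)" "integrable (diff_law M N) (laplace_bump e)"
    using b by (auto intro!: M.integrable_const_bound[where B="1 / (2 * e)"] N.integrable_const_bound[where B="1 / (2 * e)"]
       D.integrable_const_bound[where B="1 / (2 * e)"])
  have i3: "integrable (M \<Otimes>\<^sub>M N) (\<lambda>z. laplace_bump e (fst z - snd z))"
    using b by (auto intro!: P.integrable_const_bound[where B="1 / (2 * e)"])
  have ie: "integrable (diff_law M N) (\<lambda>t. exp (- (e * \<bar>t\<bar>)))"
    using e by (intro D.integrable_const_bound[where B=1]) auto
  have "(\<integral>(u, v). damped_brownian e u v \<partial>(M \<Otimes>\<^sub>M N)) =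
     (\<integral>z. laplace_bump e (fst z) \<partial>(M \<Otimes>\<^sub>M N)) + (\<integral>z. laplace_bump e (snd z) \<partial>(M \<Otimes>\<^sub>M N))
      - (\<integral>z. laplace_bump e (fst z - snd z) \<partial>(M \<Otimes>\<^sub>M N))"
    unfolding damped_brownian_def case_prod_beta'
    using P.integrable_marginal1[OF i(1)] P.integrable_marginal2[OF i(2)] i3 by simp
  also have "(\<integral>z. laplace_bump e (fst z) \<partial>(M \<Otimes>\<^sub>M N)) = (\<integral>u. laplace_bump e u \<partial>M)"
    by (rule P.integral_marginal1[OF i(1)])
  also have "(\<integral>z. laplace_bump e (snd z) \<partial>(M \<Otimes>\<^sub>M N)) = (\<integral>v. laplace_bump e v \<partial>N)"
    by (rule P.integral_marginal2[OF i(2)])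
  also have "(\<integral>z. laplace_bump e (fst z - snd z) \<partial>(M \<Otimes>\<^sub>M N)) = (\<integral>t. laplace_bump e t \<partial>diff_law M N)"
    by (subst integral_diff_law[OF M N]) (auto simp: case_prod_beta')
  also have "\<dots> = (\<integral>t. (1 / (2 * e)) * (1 - exp (- (e * \<bar>t\<bar>))) \<partial>diff_law M N)"
    by (intro Bochner_Integration.integral_cong refl) (simp add: laplace_bump_def)
  also have "\<dots> = (1 / (2 * e)) * (1 - (\<integral>t. exp (- (e * \<bar>t\<bar>)) \<partial>diff_law M N))"
    using ie by (subst integral_mult_right_zero) (use D.prob_space in simp)
  also have "(\<integral>t. exp (- (e * \<bar>t\<bar>)) \<partial>diff_law M N) = (\<integral>\<xi>. kap_coeff (1 / e) 0 \<xi> * Re (char M \<xi> * cnj (char N \<xi>)) \<partial>lborel)"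
    using exp_integral_as_fourier(1)[OF real_distribution_diff_law[OF M N], of "1 / e" 0] e
    unfolding char_diff_law[OF M N] by (simp add: mult.commute)
  finally show ?thesis .
qed

text \<open>In the combination \<open>N N - 2 M N + M M\<close> the one-variable terms of the damped kernel cancel, and
what remains is the integral of \<open>\<bar>g - f\<bar>\<^sup>2 / (2 \<pi> (e\<^sup>2 + \<xi>\<^sup>2))\<close>. For \<open>e \<rightarrow> 0\<close> this increases to
the right-hand side, while the left-hand side converges by domination. Monotone convergence then yields the
integrability together with the identity.\<close>

theorem brown_form_spectral:
  assumes M: "finite_energy_law M" and N: "finite_energy_law N"
  shows "integrable lborel (\<lambda>\<xi>. (cmod (char N \<xi> - char M \<xi>))\<^sup>2 / (2 * pi * \<xi>\<^sup>2))"
    and "brown_form N N - 2 * brown_form M N + brown_form M M =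
      (\<integral>\<xi>. (cmod (char N \<xi> - char M \<xi>))\<^sup>2 / (2 * pi * \<xi>\<^sup>2) \<partial>lborel)"
proof -
  note D = M[THEN finite_energy_law_dist] N[THEN finite_energy_law_dist]
  interpret M: real_distribution M by (rule D)
  interpret N: real_distribution N by (rule D)
  define e where "e n = 1 / real (Suc n)" for n
  have e0: "e n > 0" for n by (simp add: e_def)
  have elim: "e \<longlonglongrightarrow> 0" unfolding e_def by (rule LIMSEQ_Suc[OF lim_1_over_n])
  define h where "h n \<xi> = (cmod (char N \<xi> - char M \<xi>))\<^sup>2 / (2 * pi * ((e n)\<^sup>2 + \<xi>\<^sup>2))" for n \<xi>
  have hk: "h n \<xi> = (1 / (2 * e n)) * (kap_coeff (1 / e n) 0 \<xi> * Re (char N \<xi> * cnj (char N \<xi>))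
      - 2 * (kap_coeff (1 / e n) 0 \<xi> * Re (char M \<xi> * cnj (char N \<xi>)))
      + kap_coeff (1 / e n) 0 \<xi> * Re (char M \<xi> * cnj (char M \<xi>)))" for n \<xi>
  proof -
    have pos: "(e n)\<^sup>2 + \<xi>\<^sup>2 > 0" using e0[of n] by (intro add_pos_nonneg) auto
    have "1 + (1 / e n)\<^sup>2 * \<xi>\<^sup>2 = ((e n)\<^sup>2 + \<xi>\<^sup>2) / (e n)\<^sup>2"
      using e0[of n] by (simp add: field_simps)
    then have k: "(1 / (2 * e n)) * kap_coeff (1 / e n) 0 \<xi> = 1 / (2 * pi * ((e n)\<^sup>2 + \<xi>\<^sup>2))"
      using e0[of n] pos by (simp add: kap_coeff_def power2_eq_square)
    have "h n \<xi> = (1 / (2 * pi * ((e n)\<^sup>2 + \<xi>\<^sup>2))) * (cmod (char N \<xi> - char M \<xi>))\<^sup>2"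
      by (simp add: h_def)
    also have "\<dots> = (1 / (2 * e n)) * kap_coeff (1 / e n) 0 \<xi> * 
       (Re (char N \<xi> * cnj (char N \<xi>)) - 2 * Re (char M \<xi> * cnj (char N \<xi>)) + Re (char M \<xi> * cnj (char M \<xi>)))"
      unfolding cmod_diff_squared k ..
    finally show ?thesis by (simp only: algebra_simps)
  qed
  have int: "integrable lborel (\<lambda>\<xi>. kap_coeff (1 / e n) 0 \<xi> * Re (char A \<xi> * cnj (char B \<xi>)))"
    if "real_distribution A" "real_distribution B" for A B n
    using exp_integral_as_fourier(2)[OF real_distribution_diff_law[OF that], of "1 / e n" 0] e0[of n]
    by (simp add: char_diff_law[OF that])
  have h_int: "integrable lborel (h n)" for n
    unfolding hk[abs_def] by (intro integrable_mult_right Bochner_Integration.integrable_add Bochner_Integration.integrable_diff int D)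
  have "(\<integral>\<xi>. h n \<xi> \<partial>lborel) = (1 / (2 * e n)) * ((\<integral>\<xi>. kap_coeff (1 / e n) 0 \<xi> * Re (char N \<xi> * cnj (char N \<xi>)) \<partial>lborel)
      - 2 * (\<integral>\<xi>. kap_coeff (1 / e n) 0 \<xi> * Re (char M \<xi> * cnj (char N \<xi>)) \<partial>lborel)
      + (\<integral>\<xi>. kap_coeff (1 / e n) 0 \<xi> * Re (char M \<xi> * cnj (char M \<xi>)) \<partial>lborel))" for n
    unfolding hk[abs_def] integral_mult_right_zero
    by (subst Bochner_Integration.integral_add, intro Bochner_Integration.integrable_diff integrable_mult_right int D, intro int D,
        subst Bochner_Integration.integral_diff, intro int D, intro integrable_mult_right int D, simp only: integral_mult_right_zero)
  moreover have "c * (A - 2 * B + C) = (b + b - c * (1 - A)) - 2 * (a + b - c * (1 - B)) + (a + a - c * (1 - C))"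
    for a b c A B C :: real by (simp add: algebra_simps)
  ultimately have h_eq: "(\<integral>\<xi>. h n \<xi> \<partial>lborel) = (\<integral>(u, v). damped_brownian (e n) u v \<partial>(N \<Otimes>\<^sub>M N))
     - 2 * (\<integral>(u, v). damped_brownian (e n) u v \<partial>(M \<Otimes>\<^sub>M N)) + (\<integral>(u, v). damped_brownian (e n) u v \<partial>(M \<Otimes>\<^sub>M M))" for n
    unfolding damped_brownian_integral[OF D(2) D(2) e0] damped_brownian_integral[OF D e0] damped_brownian_integral[OF D(1) D(1) e0]
    by (simp only:)
  have lim: "(\<lambda>n. \<integral>\<xi>. h n \<xi> \<partial>lborel) \<longlonglongrightarrow> brown_form N N - 2 * brown_form M N + brown_form M M"
    unfolding h_eq by (intro tendsto_intros damped_brownian_integral_tendsto M N e0 elim)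
  have mono: "h n \<xi> \<le> h m \<xi>" if "n \<le> m" for n m \<xi>
  proof -
    have "e m \<le> e n" using that by (auto simp: e_def frac_le)
    then have "(e m)\<^sup>2 + \<xi>\<^sup>2 \<le> (e n)\<^sup>2 + \<xi>\<^sup>2" using e0[of m] by (auto intro: power_mono)
    moreover have "(e m)\<^sup>2 + \<xi>\<^sup>2 > 0" "(e n)\<^sup>2 + \<xi>\<^sup>2 > 0" using e0[of m] e0[of n] by (auto intro!: add_pos_nonneg)
    ultimately show ?thesis unfolding h_def by (intro divide_left_mono mult_left_mono mult_pos_pos) auto
  qed
  have conv: "(\<lambda>n. h n \<xi>) \<longlonglongrightarrow> (cmod (char N \<xi> - char M \<xi>))\<^sup>2 / (2 * pi * \<xi>\<^sup>2)" for \<xi>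
  proof (cases "\<xi> = 0")
    case True then show ?thesis by (simp add: h_def M.char_zero N.char_zero)
  next
    case False
    have "(\<lambda>n. (cmod (char N \<xi> - char M \<xi>))\<^sup>2 / (2 * pi * ((e n)\<^sup>2 + \<xi>\<^sup>2))) \<longlonglongrightarrow> (cmod (char N \<xi> - char M \<xi>))\<^sup>2 / (2 * pi * (0\<^sup>2 + \<xi>\<^sup>2))"
      using False by (intro tendsto_divide tendsto_mult tendsto_add tendsto_power tendsto_const elim) auto
    then show ?thesis by (simp add: h_def)
  qed
  have m: "AE \<xi> in lborel. mono (\<lambda>n. h n \<xi>)" by (intro AE_I2 monoI mono)
  have c: "AE \<xi> in lborel. (\<lambda>n. h n \<xi>) \<longlonglongrightarrow> (cmod (char N \<xi> - char M \<xi>))\<^sup>2 / (2 * pi * \<xi>\<^sup>2)" by (intro AE_I2 conv)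
  show "integrable lborel (\<lambda>\<xi>. (cmod (char N \<xi> - char M \<xi>))\<^sup>2 / (2 * pi * \<xi>\<^sup>2))"
    by (rule integrable_monotone_convergence[OF h_int m c lim]) measurable
  show "brown_form N N - 2 * brown_form M N + brown_form M M = (\<integral>\<xi>. (cmod (char N \<xi> - char M \<xi>))\<^sup>2 / (2 * pi * \<xi>\<^sup>2) \<partial>lborel)"
    by (rule integral_monotone_convergence[OF h_int m c lim, symmetric]) measurable
qed

section \<open>Mixtures and quotients of hyperbolic sines\<close>

text \<open>The mixture is encoded by a biased coin that selects one of two independent variables. As a
push-forward of a product measure it inherits its integrals from Fubini's theorem.\<close>

definition mix_law :: "real \<Rightarrow> real measure \<Rightarrow> real measure \<Rightarrow> real measure" where
  "mix_law p M N = distr (measure_pmf (bernoulli_pmf p) \<Otimes>\<^sub>M (M \<Otimes>\<^sub>M N)) borel (\<lambda>(b, x, y). if b then x else y)"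

lemma sets_mix_law [simp, measurable_cong]: "sets (mix_law p M N) = sets borel"
  by (simp add: mix_law_def)

lemma space_mix_law [simp]: "space (mix_law p M N) = UNIV"
  by (simp add: mix_law_def)

context
  fixes M N :: "real measure" and p :: real
  assumes M: "real_distribution M" and N: "real_distribution N" and p: "0 \<le> p" "p \<le> 1"
begin

interpretation M: real_distribution M by (rule M)
interpretation N: real_distribution N by (rule N)
interpretation MN: pair_prob_space M N ..
interpretation B: prob_space "measure_pmf (bernoulli_pmf p)" by (rule prob_space_measure_pmf)
interpretation P: pair_prob_space "measure_pmf (bernoulli_pmf p)" "M \<Otimes>\<^sub>M N" ..

lemma measurable_choice: "(\<lambda>(b, x, y). if b then x else y) \<in> borel_measurable (measure_pmf (bernoulli_pmf p) \<Otimes>\<^sub>M (M \<Otimes>\<^sub>M N))"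
  unfolding case_prod_beta' by measurable

lemma real_distribution_mix_law: "real_distribution (mix_law p M N)"
  unfolding mix_law_def real_distribution_def real_distribution_axioms_def
  using P.prob_space_distr[OF measurable_choice] by simp

lemma nn_integral_mix_law:
  assumes [measurable]: "f \<in> borel_measurable borel"
  shows "(\<integral>\<^sup>+t. f t \<partial>mix_law p M N) = ennreal p * (\<integral>\<^sup>+x. f x \<partial>M) + ennreal (1 - p) * (\<integral>\<^sup>+y. f y \<partial>N)"
proof -
  have c: "(\<integral>\<^sup>+z. (if b then f (fst z) else f (snd z)) \<partial>(M \<Otimes>\<^sub>M N)) = (if b then (\<integral>\<^sup>+x. f x \<partial>M) else (\<integral>\<^sup>+y. f y \<partial>N))" for b
    by (cases b) (simp_all add: N.nn_integral_fst[symmetric] N.emeasure_space_1[simplified] M.emeasure_space_1[simplified])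
  have "(\<integral>\<^sup>+t. f t \<partial>mix_law p M N) = (\<integral>\<^sup>+b. \<integral>\<^sup>+z. (if b then f (fst z) else f (snd z)) \<partial>(M \<Otimes>\<^sub>M N) \<partial>measure_pmf (bernoulli_pmf p))"
    unfolding mix_law_def
    by (subst nn_integral_distr[OF measurable_choice], simp, subst MN.nn_integral_fst[symmetric])
       (auto intro!: nn_integral_cong simp: case_prod_beta' split: if_splits)
  also have "\<dots> = ennreal p * (\<integral>\<^sup>+x. f x \<partial>M) + ennreal (1 - p) * (\<integral>\<^sup>+y. f y \<partial>N)"
    unfolding c using p by (subst nn_integral_bernoulli_pmf) (auto simp: mult.commute)
  finally show ?thesis .
qed

lemma char_mix_law: "char (mix_law p M N) t = p *\<^sub>R char M t + (1 - p) *\<^sub>R char N t"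
proof -
  have c: "(\<integral>z. (if b then iexp (t * fst z) else iexp (t * snd z)) \<partial>(M \<Otimes>\<^sub>M N)) = (if b then char M t else char N t)" for b
  proof (cases b)
    case True
    have "(\<integral>z. iexp (t * fst z) \<partial>(M \<Otimes>\<^sub>M N)) = (\<integral>x. \<integral>y. iexp (t * x) \<partial>N \<partial>M)"
      by (subst MN.integral_fst'[symmetric]) (auto intro!: MN.integrable_const_bound[where B=1])
    then show ?thesis using True N.prob_space by (simp add: char_def)
  next
    case False
    have "(\<integral>z. iexp (t * snd z) \<partial>(M \<Otimes>\<^sub>M N)) = (\<integral>x. \<integral>y. iexp (t * y) \<partial>N \<partial>M)"
      by (subst MN.integral_fst'[symmetric]) (auto intro!: MN.integrable_const_bound[where B=1])
    then show ?thesis using False M.prob_space by (simp add: char_def)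
  qed
  have "char (mix_law p M N) t = (\<integral>w. (if fst w then iexp (t * fst (snd w)) else iexp (t * snd (snd w))) \<partial>(measure_pmf (bernoulli_pmf p) \<Otimes>\<^sub>M (M \<Otimes>\<^sub>M N)))"
    unfolding char_def mix_law_def
    by (subst integral_distr[OF measurable_choice]) (auto intro!: Bochner_Integration.integral_cong split: if_splits)
  also have "\<dots> = (\<integral>b. \<integral>z. (if b then iexp (t * fst z) else iexp (t * snd z)) \<partial>(M \<Otimes>\<^sub>M N) \<partial>measure_pmf (bernoulli_pmf p))"
    by (subst P.integral_fst'[symmetric]) (auto intro!: P.integrable_const_bound[where B=1] cong: if_cong)
  also have "\<dots> = p *\<^sub>R char M t + (1 - p) *\<^sub>R char N t"
    unfolding c using p by (subst integral_measure_pmf[of UNIV]) (auto simp: UNIV_bool)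
  finally show ?thesis .
qed

end

lemma convolution_law:
  assumes M: "real_distribution M" and N: "real_distribution N"
  shows real_distribution_convolution: "real_distribution (M \<star> N)"
    and char_convolution: "char (M \<star> N) t = char M t * char N t"
    and nn_integral_exp_convolution: "(\<integral>\<^sup>+x. ennreal (exp (l * x)) \<partial>(M \<star> N)) = (\<integral>\<^sup>+x. ennreal (exp (l * x)) \<partial>M) * (\<integral>\<^sup>+x. ennreal (exp (l * x)) \<partial>N)"
proof -
  interpret M: real_distribution M by (rule M)
  interpret N: real_distribution N by (rule N)
  interpret P: pair_prob_space M N ..
  have meas: "(\<lambda>(x, y). x + y :: real) \<in> borel_measurable (M \<Otimes>\<^sub>M N)" by measurable
  show "real_distribution (M \<star> N)"
    unfolding convolution_def real_distribution_def real_distribution_axioms_def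
    using P.prob_space_distr[OF meas] by simp
  have "char (M \<star> N) t = (\<integral>z. iexp (t * fst z) * iexp (t * snd z) \<partial>(M \<Otimes>\<^sub>M N))"
    unfolding char_def convolution_def
    by (subst integral_distr[OF meas]) (auto intro!: Bochner_Integration.integral_cong simp: algebra_simps simp flip: exp_add)
  also have "\<dots> = (\<integral>x. \<integral>y. iexp (t * x) * iexp (t * y) \<partial>N \<partial>M)"
    by (subst P.integral_fst'[symmetric]) (auto intro!: P.integrable_const_bound[where B=1] simp: norm_mult)
  also have "\<dots> = char M t * char N t" by (simp add: char_def)
  finally show "char (M \<star> N) t = char M t * char N t" .
  have "(\<integral>\<^sup>+x. ennreal (exp (l * x)) \<partial>(M \<star> N)) = (\<integral>\<^sup>+x. \<integral>\<^sup>+y. ennreal (exp (l * (x + y))) \<partial>N \<partial>M)"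
    by (intro nn_integral_convolution) (auto intro: M.finite_measure_axioms N.finite_measure_axioms)
  also have "\<dots> = (\<integral>\<^sup>+x. \<integral>\<^sup>+y. ennreal (exp (l * x)) * ennreal (exp (l * y)) \<partial>N \<partial>M)"
    by (intro nn_integral_cong) (simp add: ennreal_mult[symmetric] algebra_simps flip: exp_add)
  also have "\<dots> = (\<integral>\<^sup>+x. ennreal (exp (l * x)) \<partial>M) * (\<integral>\<^sup>+x. ennreal (exp (l * x)) \<partial>N)"
    by (simp add: nn_integral_cmult nn_integral_multc)
  finally show "(\<integral>\<^sup>+x. ennreal (exp (l * x)) \<partial>(M \<star> N)) = (\<integral>\<^sup>+x. ennreal (exp (l * x)) \<partial>M) * (\<integral>\<^sup>+x. ennreal (exp (l * x)) \<partial>N)" .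
qed

text \<open>Exponential moments of the Laplace law; they give tightness of the convolution
products below.\<close>

lemma laplace_mgf:
  assumes l: "\<bar>l\<bar> < 1"
  shows "(\<integral>\<^sup>+x. ennreal (exp (l * x)) \<partial>laplace_distribution) = ennreal (1 / (1 - l\<^sup>2))"
proof -
  have h: "(\<integral>\<^sup>+x. ennreal (exp (- x) / 2) * (ennreal (exp (m * x)) * indicator {0..} x) \<partial>lborel) = ennreal (1 / (2 * (1 - m)))"
    if "\<bar>m\<bar> < 1" for m
  proof -
    have "(\<integral>\<^sup>+x. ennreal (exp (- x) / 2) * (ennreal (exp (m * x)) * indicator {0..} x) \<partial>lborel) =
       (\<integral>\<^sup>+x. ennreal (1/2) * (ennreal (exp (- ((1 - m) * x))) * indicator {0..} x) \<partial>lborel)"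
    proof (intro nn_integral_cong)
      fix x :: real
      have "ennreal (exp (- x) / 2) * ennreal (exp (m * x)) = ennreal (1/2) * ennreal (exp (- ((1 - m) * x)))"
        by (subst (1 2) ennreal_mult[symmetric]) (simp_all add: exp_add[symmetric] algebra_simps)
      then show "ennreal (exp (- x) / 2) * (ennreal (exp (m * x)) * indicator {0..} x) = ennreal (1/2) * (ennreal (exp (- ((1 - m) * x))) * indicator {0..} x)"
        by (simp only: mult.assoc[symmetric])
    qed
    also have "\<dots> = ennreal (1/2) * ennreal (1 / (1 - m))"
      using that by (subst nn_integral_cmult) (auto simp: exp_half_line_rate)
    also have "\<dots> = ennreal (1 / (2 * (1 - m)))" using that by (subst ennreal_mult[symmetric]) auto
    finally show ?thesis .
  qed
  have "(\<integral>\<^sup>+x. ennreal (exp (l * x)) \<partial>laplace_distribution) = (\<integral>\<^sup>+x. ennreal (exp (- \<bar>x\<bar>) / 2) * ennreal (exp (l * x)) \<partial>lborel)"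
    unfolding laplace_distribution_def by (subst nn_integral_density) auto
  also have "\<dots> = (\<integral>\<^sup>+x. ennreal (exp (- x) / 2) * (ennreal (exp (l * x)) * indicator {0..} x) +
       ennreal (exp (- (-x)) / 2) * (ennreal (exp (-l * (-x))) * indicator {0..} (-x)) \<partial>lborel)"
  proof (rule nn_integral_cong_AE)
    show "AE x in lborel. ennreal (exp (- \<bar>x\<bar>) / 2) * ennreal (exp (l * x)) = ennreal (exp (- x) / 2) * (ennreal (exp (l * x)) * indicator {0..} x) +
       ennreal (exp (- (-x)) / 2) * (ennreal (exp (-l * (-x))) * indicator {0..} (-x))"
      using AE_lborel_singleton[of "0::real"] by eventually_elim (auto split: split_indicator)
  qed
  also have "\<dots> = (\<integral>\<^sup>+x. ennreal (exp (- x) / 2) * (ennreal (exp (l * x)) * indicator {0..} x) \<partial>lborel) +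
      (\<integral>\<^sup>+x. ennreal (exp (- (-x)) / 2) * (ennreal (exp (-l * (-x))) * indicator {0..} (-x)) \<partial>lborel)"
    by (intro nn_integral_add) auto
  also have "(\<integral>\<^sup>+x. ennreal (exp (- (-x)) / 2) * (ennreal (exp (-l * (-x))) * indicator {0..} (-x)) \<partial>lborel) =
     (\<integral>\<^sup>+x. ennreal (exp (- x) / 2) * (ennreal (exp (-l * x)) * indicator {0..} x) \<partial>lborel)"
    using nn_integral_real_affine[of "\<lambda>x. ennreal (exp (- x) / 2) * (ennreal (exp (-l * x)) * indicator {0..} x)" "-1" 0] by simp
  also have "(\<integral>\<^sup>+x. ennreal (exp (- x) / 2) * (ennreal (exp (l * x)) * indicator {0..} x) \<partial>lborel) + \<dots> =
      ennreal (1 / (2 * (1 - l)) + 1 / (2 * (1 - (- l))))"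
    using l unfolding h[OF l] by (subst h) (auto intro!: ennreal_plus[symmetric])
  also have "1 / (2 * (1 - l)) + 1 / (2 * (1 - (- l))) = 1 / (1 - l\<^sup>2)"
  proof -
    have "1 - l\<^sup>2 = (1 - l) * (1 + l)" by (simp add: power2_eq_square algebra_simps)
    moreover have "1 / (2 * (1 - l)) + 1 / (2 * (1 - (- l))) = 1 / ((1 - l) * (1 + l))"
    proof -
      have "1 / (2 * x) + 1 / (2 * y) = 1 / (x * y)" if "x \<noteq> 0" "y \<noteq> 0" "x + y = 2" for x y :: real
        using that by (simp add: field_simps)
      from this[of "1 - l" "1 + l"] show ?thesis using l by simp
    qed
    ultimately show ?thesis by simp
  qed
  finally show ?thesis .
qed

text \<open>The mixture of a point mass at \<open>0\<close> and a Laplace law of scale \<open>\<beta>\<close> whose characteristic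
function is a single factor in the product formula for a quotient of hyperbolic sines. The weight
of the point mass is at most \<open>1\<close> exactly when \<open>\<alpha> \<le> \<beta>\<close>.\<close>

definition ratio_law :: "real \<Rightarrow> real \<Rightarrow> real measure" where
  "ratio_law \<alpha> \<beta> = mix_law (1 - \<alpha>\<^sup>2 / \<beta>\<^sup>2) (distr laplace_distribution borel (\<lambda>x. \<beta> * x)) (return borel 0)"

text \<open>Since \<open>1 \<le> 1 / (1 - (\<beta> l)\<^sup>2)\<close>, the point mass does not raise the exponential moment above that
of the Laplace law.\<close>

lemma ratio_law:
  assumes "0 < \<alpha>" "\<alpha> \<le> \<beta>"
  shows real_distribution_ratio_law: "real_distribution (ratio_law \<alpha> \<beta>)"
    and char_ratio_law: "char (ratio_law \<alpha> \<beta>) t = complex_of_real ((1 + \<alpha>\<^sup>2 * t\<^sup>2) / (1 + \<beta>\<^sup>2 * t\<^sup>2))"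
    and mgf_ratio_law: "\<bar>\<beta> * l\<bar> < 1 \<Longrightarrow> (\<integral>\<^sup>+x. ennreal (exp (l * x)) \<partial>ratio_law \<alpha> \<beta>) \<le> ennreal (1 / (1 - (\<beta> * l)\<^sup>2))"
proof -
  interpret L: real_distribution laplace_distribution by (rule real_distribution_laplace)
  let ?p = "1 - \<alpha>\<^sup>2 / \<beta>\<^sup>2"
  have p: "0 \<le> ?p" "?p \<le> 1" using assms by (auto simp: divide_le_eq intro!: power_mono)
  have D: "real_distribution (distr laplace_distribution borel (\<lambda>x. \<beta> * x))"
    unfolding real_distribution_def real_distribution_axioms_def by (auto intro!: L.prob_space_distr)
  have R: "real_distribution (return borel (0::real))"
    unfolding real_distribution_def real_distribution_axioms_def by (auto intro!: prob_space_return)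
  show "real_distribution (ratio_law \<alpha> \<beta>)"
    unfolding ratio_law_def by (rule real_distribution_mix_law[OF D R p])
  have 1: "char (distr laplace_distribution borel (\<lambda>x. \<beta> * x)) t = complex_of_real (1 / (1 + (\<beta> * t)\<^sup>2))"
  proof -
    have "char (distr laplace_distribution borel (\<lambda>x. \<beta> * x)) t = char laplace_distribution (\<beta> * t)"
      unfolding char_def by (subst integral_distr) (auto simp: mult_ac)
    then show ?thesis by (simp only: char_laplace)
  qed
  have 2: "char (return borel (0::real)) t = 1"
    unfolding char_def by (subst integral_return) auto
  have pos: "1 + \<beta>\<^sup>2 * t\<^sup>2 > 0" by (intro add_pos_nonneg) auto
  have "char (ratio_law \<alpha> \<beta>) t = complex_of_real (?p * (1 / (1 + (\<beta> * t)\<^sup>2)) + (1 - ?p))"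
    unfolding ratio_law_def char_mix_law[OF D R p] 1 2 by (simp add: scaleR_conv_of_real)
  also have "?p * (1 / (1 + (\<beta> * t)\<^sup>2)) + (1 - ?p) = (1 + \<alpha>\<^sup>2 * t\<^sup>2) / (1 + \<beta>\<^sup>2 * t\<^sup>2)"
  proof -
    have "?p + (1 - ?p) * (1 + \<beta>\<^sup>2 * t\<^sup>2) = 1 + \<alpha>\<^sup>2 * t\<^sup>2" using assms by (simp add: field_simps)
    then show ?thesis using pos by (simp add: power_mult_distrib divide_simps)
  qed
  finally show "char (ratio_law \<alpha> \<beta>) t = complex_of_real ((1 + \<alpha>\<^sup>2 * t\<^sup>2) / (1 + \<beta>\<^sup>2 * t\<^sup>2))" .
  assume l: "\<bar>\<beta> * l\<bar> < 1"
  then have l2: "(\<beta> * l)\<^sup>2 < 1" by (simp add: abs_square_less_1)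
  have "(\<integral>\<^sup>+x. ennreal (exp (l * x)) \<partial>distr laplace_distribution borel (\<lambda>x. \<beta> * x)) = ennreal (1 / (1 - (\<beta> * l)\<^sup>2))"
    using laplace_mgf[OF l] by (subst nn_integral_distr) (auto simp: mult_ac)
  moreover have "(\<integral>\<^sup>+x. ennreal (exp (l * x)) \<partial>return borel 0) = 1"
    by (subst nn_integral_return) auto
  ultimately have "(\<integral>\<^sup>+x. ennreal (exp (l * x)) \<partial>ratio_law \<alpha> \<beta>) = ennreal ?p * ennreal (1 / (1 - (\<beta> * l)\<^sup>2)) + ennreal (1 - ?p) * 1"
    unfolding ratio_law_def by (subst nn_integral_mix_law[OF D R p]) auto
  also have "\<dots> = ennreal (?p * (1 / (1 - (\<beta> * l)\<^sup>2)) + (1 - ?p))"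
  proof -
    have *: "ennreal x * ennreal y + ennreal z * 1 = ennreal (x * y + z)" if "0 \<le> x" "0 \<le> y" "0 \<le> z" for x y z
      using that by (simp add: ennreal_mult ennreal_plus)
    show ?thesis by (rule *) (use p l2 in auto)
  qed
  also have "\<dots> \<le> ennreal (1 / (1 - (\<beta> * l)\<^sup>2))"
  proof (rule ennreal_leI)
    have "1 \<le> 1 / (1 - (\<beta> * l)\<^sup>2)" using l2 by simp
    then have "(1 - ?p) * 1 \<le> (1 - ?p) * (1 / (1 - (\<beta> * l)\<^sup>2))" using p by (intro mult_left_mono) auto
    moreover have "p * Z + (1 - p) \<le> Z" if "(1 - p) * 1 \<le> (1 - p) * Z" for p Z :: real
      using that by (simp add: algebra_simps)
    ultimately show "?p * (1 / (1 - (\<beta> * l)\<^sup>2)) + (1 - ?p) \<le> 1 / (1 - (\<beta> * l)\<^sup>2)" by blast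
  qed
  finally show "(\<integral>\<^sup>+x. ennreal (exp (l * x)) \<partial>ratio_law \<alpha> \<beta>) \<le> ennreal (1 / (1 - (\<beta> * l)\<^sup>2))" .
qed

primrec sinh_ratio_partial :: "real \<Rightarrow> real \<Rightarrow> nat \<Rightarrow> real measure" where
  "sinh_ratio_partial a b 0 = return borel 0"
| "sinh_ratio_partial a b (Suc n) = (sinh_ratio_partial a b n \<star> ratio_law (a / real (Suc n)) (b / real (Suc n)))"

text \<open>For \<open>a = 1\<close> and \<open>b = 2\<close> this is \<open>1 / cosh (\<pi> t)\<close>, the Mellin transform of the Poisson
kernel \<open>1 / (\<pi> \<surd>x (1 + x))\<close> that sweeps a unit mass at \<open>1\<close> onto the opposite half-line.\<close>

definition sinh_ratio :: "real \<Rightarrow> real \<Rightarrow> real \<Rightarrow> real" where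
  "sinh_ratio a b t = (if t = 0 then 1 else b * sinh (a * pi * t) / (a * sinh (b * pi * t)))"

text \<open>The quotient of the product formulas for numerator and denominator.\<close>

lemma sinh_ratio_product:
  assumes "0 < a" "0 < b"
  shows "(\<lambda>n. \<Prod>k=1..n. (1 + (a / real k)\<^sup>2 * t\<^sup>2) / (1 + (b / real k)\<^sup>2 * t\<^sup>2)) \<longlonglongrightarrow> sinh_ratio a b t"
proof (cases "t = 0")
  case True then show ?thesis by (simp add: sinh_ratio_def)
next
  case False
  have p: "(\<lambda>n. \<Prod>k=1..n. 1 + (c * \<bar>t\<bar>)\<^sup>2 / (real k)\<^sup>2) \<longlonglongrightarrow> sinh (pi * (c * \<bar>t\<bar>)) / (pi * (c * \<bar>t\<bar>))" if "c > 0" for c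
    using that False by (intro sinh_product) auto
  have "(\<lambda>n. (\<Prod>k=1..n. 1 + (a * \<bar>t\<bar>)\<^sup>2 / (real k)\<^sup>2) / (\<Prod>k=1..n. 1 + (b * \<bar>t\<bar>)\<^sup>2 / (real k)\<^sup>2))
     \<longlonglongrightarrow> (sinh (pi * (a * \<bar>t\<bar>)) / (pi * (a * \<bar>t\<bar>))) / (sinh (pi * (b * \<bar>t\<bar>)) / (pi * (b * \<bar>t\<bar>)))"
    using assms False by (intro tendsto_divide p) auto
  moreover have "(\<Prod>k=1..n. 1 + (a * \<bar>t\<bar>)\<^sup>2 / (real k)\<^sup>2) / (\<Prod>k=1..n. 1 + (b * \<bar>t\<bar>)\<^sup>2 / (real k)\<^sup>2)
     = (\<Prod>k=1..n. (1 + (a / real k)\<^sup>2 * t\<^sup>2) / (1 + (b / real k)\<^sup>2 * t\<^sup>2))" for n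
    by (simp add: prod_dividef power_mult_distrib power_divide)
  moreover have "(sinh (pi * (a * \<bar>t\<bar>)) / (pi * (a * \<bar>t\<bar>))) / (sinh (pi * (b * \<bar>t\<bar>)) / (pi * (b * \<bar>t\<bar>))) = sinh_ratio a b t"
    using False assms by (cases "t > 0") (auto simp: sinh_ratio_def abs_if field_simps)
  ultimately show ?thesis by simp
qed

context
  fixes a b :: real
  assumes ab: "0 < a" "a \<le> b"
begin

text \<open>The exponential moments are taken at \<open>l = \<plusminus> 1 / (2 b)\<close>, where the \<open>k\<close>-th factor has
\<open>(b / k) l = \<plusminus> 1 / (2 k)\<close> and its moment bound \<open>1 / (1 - 1 / (4 k\<^sup>2))\<close> is the \<open>k\<close>-th factor of
Wallis's product.\<close>

lemma sinh_ratio_partial_law: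
  shows "real_distribution (sinh_ratio_partial a b n)"
    and "char (sinh_ratio_partial a b n) t = complex_of_real (\<Prod>k=1..n. (1 + (a / real k)\<^sup>2 * t\<^sup>2) / (1 + (b / real k)\<^sup>2 * t\<^sup>2))"
    and "\<bar>l\<bar> = 1 / (2 * b) \<Longrightarrow> (\<integral>\<^sup>+x. ennreal (exp (l * x)) \<partial>sinh_ratio_partial a b n) \<le> ennreal (\<Prod>k=1..n. (4 * real k^2) / (4 * real k^2 - 1))"
proof (induction n)
  case 0
  show "real_distribution (sinh_ratio_partial a b 0)"
    unfolding real_distribution_def real_distribution_axioms_def by (auto intro!: prob_space_return)
  show "char (sinh_ratio_partial a b 0) t = complex_of_real (\<Prod>k=1..0. (1 + (a / real k)\<^sup>2 * t\<^sup>2) / (1 + (b / real k)\<^sup>2 * t\<^sup>2))"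
    unfolding char_def by (simp add: integral_return)
  show "(\<integral>\<^sup>+x. ennreal (exp (l * x)) \<partial>sinh_ratio_partial a b 0) \<le> ennreal (\<Prod>k=1..0. (4 * real k^2) / (4 * real k^2 - 1))"
    by (simp add: nn_integral_return)
next
  case (Suc n)
  have f: "0 < a / real (Suc n)" "a / real (Suc n) \<le> b / real (Suc n)"
    using ab by (auto intro!: divide_right_mono)
  note R = real_distribution_ratio_law[OF f]
  show "real_distribution (sinh_ratio_partial a b (Suc n))"
    using real_distribution_convolution[OF Suc.IH(1) R] by simp
  show "char (sinh_ratio_partial a b (Suc n)) t = complex_of_real (\<Prod>k=1..Suc n. (1 + (a / real k)\<^sup>2 * t\<^sup>2) / (1 + (b / real k)\<^sup>2 * t\<^sup>2))"
  proof -
    have "char (sinh_ratio_partial a b (Suc n)) t = char (sinh_ratio_partial a b n) t * char (ratio_law (a / real (Suc n)) (b / real (Suc n))) t"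
      unfolding sinh_ratio_partial.simps by (rule char_convolution[OF Suc.IH(1) R])
    also have "\<dots> = complex_of_real ((\<Prod>k=1..n. (1 + (a / real k)\<^sup>2 * t\<^sup>2) / (1 + (b / real k)\<^sup>2 * t\<^sup>2)) *
        ((1 + (a / real (Suc n))\<^sup>2 * t\<^sup>2) / (1 + (b / real (Suc n))\<^sup>2 * t\<^sup>2)))"
      unfolding Suc.IH(2) char_ratio_law[OF f] by (rule of_real_mult[symmetric])
    finally show ?thesis by (simp only: prod.nat_ivl_Suc' le_add1 plus_1_eq_Suc mult.commute)
  qed
  assume l: "\<bar>l\<bar> = 1 / (2 * b)"
  have "\<bar>b / real (Suc n) * l\<bar> = 1 / (2 * real (Suc n))"
    using ab l by (simp add: abs_mult)
  then have bl: "\<bar>b / real (Suc n) * l\<bar> < 1" "(b / real (Suc n) * l)\<^sup>2 = (1 / (2 * real (Suc n)))\<^sup>2"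
    by (simp, metis power2_abs)
  have "(\<integral>\<^sup>+x. ennreal (exp (l * x)) \<partial>sinh_ratio_partial a b (Suc n)) =
      (\<integral>\<^sup>+x. ennreal (exp (l * x)) \<partial>sinh_ratio_partial a b n) * (\<integral>\<^sup>+x. ennreal (exp (l * x)) \<partial>ratio_law (a / real (Suc n)) (b / real (Suc n)))"
    unfolding sinh_ratio_partial.simps by (rule nn_integral_exp_convolution[OF Suc.IH(1) R])
  also have "\<dots> \<le> ennreal (\<Prod>k=1..n. (4 * real k^2) / (4 * real k^2 - 1)) * ennreal (1 / (1 - (b / real (Suc n) * l)\<^sup>2))"
    by (intro mult_mono Suc.IH(3)[OF l] mgf_ratio_law[OF f bl(1)]) auto
  also have "1 / (1 - (b / real (Suc n) * l)\<^sup>2) = (4 * real (Suc n)^2) / (4 * real (Suc n)^2 - 1)"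
  proof -
    have "4 * x\<^sup>2 - 1 > 0" if "x \<ge> 1" for x :: real
      using one_le_power[OF that, of 2] by linarith
    from this[of "real (Suc n)"] have "4 * (real (Suc n))\<^sup>2 - 1 > 0" by simp
    moreover have "1 / (1 - (1 / (2 * x))\<^sup>2) = (4 * x\<^sup>2) / (4 * x\<^sup>2 - 1)" if "4 * x\<^sup>2 - 1 > 0" "x \<noteq> 0" for x :: real
      using that by (simp add: power_divide power_mult_distrib field_simps)
    ultimately show ?thesis unfolding bl(2) by (simp del: of_nat_Suc)
  qed
  also have "ennreal (\<Prod>k=1..n. (4 * real k^2) / (4 * real k^2 - 1)) * ennreal ((4 * real (Suc n)^2) / (4 * real (Suc n)^2 - 1))
     = ennreal (\<Prod>k=1..Suc n. (4 * real k^2) / (4 * real k^2 - 1))"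
  proof -
    have nn: "0 \<le> (4 * real k^2) / (4 * real k^2 - 1)" for k
      by (cases "k = 0") (auto intro!: divide_nonneg_nonneg simp: le_diff_eq, metis One_nat_def Suc_leI mult_le_cancel_left1 numeral_One one_le_numeral one_le_power order_trans real_of_nat_ge_one_iff zero_le_one not_less)
    show ?thesis
      by (subst ennreal_mult[symmetric]) (auto intro!: prod_nonneg nn simp: prod.nat_ivl_Suc' mult.commute simp del: of_nat_Suc)
  qed
  finally show "(\<integral>\<^sup>+x. ennreal (exp (l * x)) \<partial>sinh_ratio_partial a b (Suc n)) \<le> ennreal (\<Prod>k=1..Suc n. (4 * real k^2) / (4 * real k^2 - 1))" .
qed

text \<open>Wallis's product converges, hence is bounded.\<close>

lemma sinh_ratio_partial_exp_moment:
  "\<exists>C\<ge>0. \<forall>n. (\<integral>\<^sup>+x. ennreal (exp (\<bar>x\<bar> / (2 * b))) \<partial>sinh_ratio_partial a b n) \<le> ennreal C"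
proof -
  have "Bseq (\<lambda>n. \<Prod>k=1..n. (4 * real k^2) / (4 * real k^2 - 1))"
    using wallis by (rule convergent_imp_Bseq[OF convergentI])
  then obtain K where K: "K > 0" "\<And>n. norm (\<Prod>k=1..n. (4 * real k^2) / (4 * real k^2 - 1)) \<le> K"
    unfolding Bseq_def by auto
  have "(\<integral>\<^sup>+x. ennreal (exp (\<bar>x\<bar> / (2 * b))) \<partial>sinh_ratio_partial a b n) \<le> ennreal (2 * K)" for n
  proof -
    interpret real_distribution "sinh_ratio_partial a b n" by (rule sinh_ratio_partial_law)
    have "(\<integral>\<^sup>+x. ennreal (exp (\<bar>x\<bar> / (2 * b))) \<partial>sinh_ratio_partial a b n) \<le>
       (\<integral>\<^sup>+x. ennreal (exp (1 / (2 * b) * x)) + ennreal (exp (- (1 / (2 * b)) * x)) \<partial>sinh_ratio_partial a b n)"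
      by (intro nn_integral_mono) (auto simp: abs_if add_increasing add_increasing2 simp flip: ennreal_plus)
    also have "\<dots> = (\<integral>\<^sup>+x. ennreal (exp (1 / (2 * b) * x)) \<partial>sinh_ratio_partial a b n) + (\<integral>\<^sup>+x. ennreal (exp (- (1 / (2 * b)) * x)) \<partial>sinh_ratio_partial a b n)"
      by (rule nn_integral_add) auto
    also have "\<dots> \<le> ennreal K + ennreal K"
    proof (rule add_mono)
      have "(\<Prod>k=1..n. (4 * real k^2) / (4 * real k^2 - 1)) \<le> K" using K(2)[of n] by simp
      then have le: "ennreal (\<Prod>k=1..n. (4 * real k^2) / (4 * real k^2 - 1)) \<le> ennreal K" by (rule ennreal_leI)
      show "(\<integral>\<^sup>+x. ennreal (exp (1 / (2 * b) * x)) \<partial>sinh_ratio_partial a b n) \<le> ennreal K"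
        using ab by (intro order_trans[OF sinh_ratio_partial_law(3) le]) auto
      show "(\<integral>\<^sup>+x. ennreal (exp (- (1 / (2 * b)) * x)) \<partial>sinh_ratio_partial a b n) \<le> ennreal K"
        using ab by (intro order_trans[OF sinh_ratio_partial_law(3) le]) auto
    qed
    also have "\<dots> = ennreal (2 * K)" using K(1) by (simp flip: ennreal_plus)
    finally show ?thesis .
  qed
  then show ?thesis using K(1) by (intro exI[of _ "2 * K"]) auto
qed

text \<open>Markov's inequality for the exponential moments.\<close>

lemma sinh_ratio_partial_tight: "tight (sinh_ratio_partial a b)"
  unfolding tight_def
proof (intro conjI allI impI)
  show "real_distribution (sinh_ratio_partial a b n)" for n by (rule sinh_ratio_partial_law)
  fix \<epsilon> :: real assume \<epsilon>: "\<epsilon> > 0"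
  obtain C where C: "C \<ge> 0" "\<And>n. (\<integral>\<^sup>+x. ennreal (exp (\<bar>x\<bar> / (2 * b))) \<partial>sinh_ratio_partial a b n) \<le> ennreal C"
    using sinh_ratio_partial_exp_moment by blast
  \<comment> \<open>With this level Markov's bound \<open>C / E\<close> lies below \<open>\<epsilon>\<close>, and \<open>E > 1\<close> makes \<open>R\<close> positive.\<close>
  define E where "E = C / \<epsilon> + 2"
  define R where "R = 2 * b * ln E"
  have E: "E > 1" using divide_nonneg_pos[OF C(1) \<epsilon>] unfolding E_def by linarith
  have R: "R > 0" using ab E by (simp add: R_def)
  have eR: "exp (R / (2 * b)) = E" using ab E by (simp add: R_def)
  show "\<exists>x y. x < y \<and> (\<forall>n. 1 - \<epsilon> < measure (sinh_ratio_partial a b n) {x<..y})"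
  proof (rule exI[of _ "- R"], rule exI[of _ R], intro conjI allI)
    show "- R < R" using R by simp
    fix n
    interpret real_distribution "sinh_ratio_partial a b n" by (rule sinh_ratio_partial_law)
    have "ennreal E * emeasure (sinh_ratio_partial a b n) (- {- R<..R}) = (\<integral>\<^sup>+x. ennreal E * indicator (- {- R<..R}) x \<partial>sinh_ratio_partial a b n)"
      by (subst nn_integral_cmult_indicator) auto
    also have "\<dots> \<le> (\<integral>\<^sup>+x. ennreal (exp (\<bar>x\<bar> / (2 * b))) \<partial>sinh_ratio_partial a b n)"
    proof (rule nn_integral_mono)
      fix x :: real
      have "exp (R / (2 * b)) \<le> exp (\<bar>x\<bar> / (2 * b))" if "x \<notin> {- R<..R}"
      proof -
        have "R \<le> \<bar>x\<bar>" using that by auto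
        then show ?thesis using ab by (auto intro: divide_right_mono)
      qed
      then show "ennreal E * indicator (- {- R<..R}) x \<le> ennreal (exp (\<bar>x\<bar> / (2 * b)))"
        unfolding eR by (auto split: split_indicator)
    qed
    also have "\<dots> \<le> ennreal C" using C(2) by blast
    finally have "E * prob (- {- R<..R}) \<le> C"
      using E C(1) by (simp add: emeasure_eq_measure ennreal_mult[symmetric])
    then have "prob (- {- R<..R}) \<le> C / E" using E by (simp add: field_simps)
    also have "C / E < \<epsilon>" using C(1) \<epsilon> E by (simp add: E_def field_simps)
    finally show "1 - \<epsilon> < prob {- R<..R}"
      using prob_compl[of "{- R<..R}"] by (simp add: Compl_eq_Diff_UNIV)
  qed
qed

text \<open>A weak limit of the partial products has the limiting characteristic function. The first moment
passes to the limit by Fatou's lemma along an almost sure representation of the convergence; it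
keeps the energies finite under convolution with this law.\<close>

theorem sinh_ratio_law_exists:
  "\<exists>T. real_distribution T \<and> (\<forall>t. char T t = complex_of_real (sinh_ratio a b t)) \<and> (\<integral>\<^sup>+x. ennreal \<bar>x\<bar> \<partial>T) < \<infinity>"
proof -
  let ?W = "sinh_ratio_partial a b"
  obtain r T where r: "strict_mono (r :: nat \<Rightarrow> nat)" and T: "real_distribution T" and conv: "weak_conv_m (?W \<circ> id \<circ> r) T"
    using tight_imp_convergent_subsubsequence[OF sinh_ratio_partial_tight strict_mono_id] by blast
  have conv': "weak_conv_m (\<lambda>n. ?W (r n)) T" using conv by (simp add: comp_def)
  have D: "real_distribution (?W (r n))" for n by (rule sinh_ratio_partial_law)
  have ch: "char T t = complex_of_real (sinh_ratio a b t)" for t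
  proof (rule LIMSEQ_unique)
    show "(\<lambda>n. char (?W (r n)) t) \<longlonglongrightarrow> char T t"
      by (rule levy_continuity1[OF D T conv'])
    have "(\<lambda>n. complex_of_real (\<Prod>k=1..n. (1 + (a / real k)\<^sup>2 * t\<^sup>2) / (1 + (b / real k)\<^sup>2 * t\<^sup>2))) \<longlonglongrightarrow> complex_of_real (sinh_ratio a b t)"
      using ab by (intro tendsto_of_real sinh_ratio_product) auto
    from LIMSEQ_subseq_LIMSEQ[OF this r]
    show "(\<lambda>n. char (?W (r n)) t) \<longlonglongrightarrow> complex_of_real (sinh_ratio a b t)"
      by (simp add: sinh_ratio_partial_law(2) comp_def)
  qed
  obtain C where C: "C \<ge> 0" "\<And>n. (\<integral>\<^sup>+x. ennreal (exp (\<bar>x\<bar> / (2 * b))) \<partial>?W n) \<le> ennreal C"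
    using sinh_ratio_partial_exp_moment by blast
  obtain \<Omega> :: "real measure" and Y_seq Y where Y: "prob_space \<Omega>" "\<And>n. Y_seq n \<in> measurable \<Omega> borel"
     "\<And>n. distr \<Omega> borel (Y_seq n) = ?W (r n)" "Y \<in> measurable \<Omega> lborel" "distr \<Omega> borel Y = T"
     "\<And>x. x \<in> space \<Omega> \<Longrightarrow> (\<lambda>n. Y_seq n x) \<longlonglongrightarrow> Y x"
    using Skorohod[OF D T conv'] by blast
  note [measurable] = Y(2)
  have [measurable]: "Y \<in> borel_measurable \<Omega>" using Y(4) by simp
  have "(\<integral>\<^sup>+x. ennreal (exp (\<bar>x\<bar> / (2 * b))) \<partial>T) = (\<integral>\<^sup>+\<omega>. ennreal (exp (\<bar>Y \<omega>\<bar> / (2 * b))) \<partial>\<Omega>)"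
    unfolding Y(5)[symmetric] by (subst nn_integral_distr) auto
  also have "\<dots> = (\<integral>\<^sup>+\<omega>. liminf (\<lambda>n. ennreal (exp (\<bar>Y_seq n \<omega>\<bar> / (2 * b)))) \<partial>\<Omega>)"
  proof (intro nn_integral_cong)
    fix \<omega> assume "\<omega> \<in> space \<Omega>"
    then have "(\<lambda>n. ennreal (exp (\<bar>Y_seq n \<omega>\<bar> / (2 * b)))) \<longlonglongrightarrow> ennreal (exp (\<bar>Y \<omega>\<bar> / (2 * b)))"
      using ab by (intro tendsto_intros Y(6)) auto
    from lim_imp_Liminf[OF _ this] show "ennreal (exp (\<bar>Y \<omega>\<bar> / (2 * b))) = liminf (\<lambda>n. ennreal (exp (\<bar>Y_seq n \<omega>\<bar> / (2 * b))))"
      by simp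
  qed
  also have "\<dots> \<le> liminf (\<lambda>n. \<integral>\<^sup>+\<omega>. ennreal (exp (\<bar>Y_seq n \<omega>\<bar> / (2 * b))) \<partial>\<Omega>)"
    by (rule nn_integral_liminf) measurable
  also have "\<dots> \<le> liminf (\<lambda>n. ennreal C)"
  proof (intro Liminf_mono always_eventually allI)
    fix n
    have "(\<integral>\<^sup>+\<omega>. ennreal (exp (\<bar>Y_seq n \<omega>\<bar> / (2 * b))) \<partial>\<Omega>) = (\<integral>\<^sup>+x. ennreal (exp (\<bar>x\<bar> / (2 * b))) \<partial>?W (r n))"
      unfolding Y(3)[symmetric] by (subst nn_integral_distr) auto
    then show "(\<integral>\<^sup>+\<omega>. ennreal (exp (\<bar>Y_seq n \<omega>\<bar> / (2 * b))) \<partial>\<Omega>) \<le> ennreal C" using C(2) by simp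
  qed
  also have "\<dots> = ennreal C" by (simp add: Liminf_const)
  finally have expm: "(\<integral>\<^sup>+x. ennreal (exp (\<bar>x\<bar> / (2 * b))) \<partial>T) \<le> ennreal C" .
  interpret T: real_distribution T by (rule T)
  have "(\<integral>\<^sup>+x. ennreal \<bar>x\<bar> \<partial>T) \<le> (\<integral>\<^sup>+x. ennreal (2 * b) * ennreal (exp (\<bar>x\<bar> / (2 * b))) \<partial>T)"
  proof (intro nn_integral_mono)
    fix x :: real
    have "\<bar>x\<bar> = 2 * b * (\<bar>x\<bar> / (2 * b))" using ab by simp
    also have "\<dots> \<le> 2 * b * exp (\<bar>x\<bar> / (2 * b))"
    proof (rule mult_left_mono)
      show "\<bar>x\<bar> / (2 * b) \<le> exp (\<bar>x\<bar> / (2 * b))"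
        using exp_ge_add_one_self[of "\<bar>x\<bar> / (2 * b)"] by linarith
    qed (use ab in simp)
    finally show "ennreal \<bar>x\<bar> \<le> ennreal (2 * b) * ennreal (exp (\<bar>x\<bar> / (2 * b)))"
      using ab by (subst ennreal_mult[symmetric]) (auto intro: ennreal_leI)
  qed
  also have "\<dots> \<le> ennreal (2 * b) * ennreal C"
    by (subst nn_integral_cmult) (auto intro!: mult_left_mono expm)
  also have "\<dots> < \<infinity>" by (simp add: ennreal_mult_less_top)
  finally show ?thesis using T ch by blast
qed

end

section \<open>The defect of two neighbours in a chain\<close>

lemma continuous_AE_eq_0:
  fixes h :: "real \<Rightarrow> complex"
  assumes cont: "continuous_on UNIV h" and ae: "AE x in lborel. h x = 0"
  shows "h x = 0"
proof (rule ccontr)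
  assume "h x \<noteq> 0"
  let ?U = "h -` (- {0})"
  have "open ?U" using cont by (intro open_vimage) auto
  moreover have "?U \<noteq> {}" using \<open>h x \<noteq> 0\<close> by auto
  ultimately have "\<not> negligible ?U" by (rule open_not_negligible)
  moreover have "negligible ?U"
  proof -
    have "?U \<in> sets borel" using \<open>open ?U\<close> by auto
    moreover have "?U = {x \<in> space lborel. \<not> h x = 0}" by auto
    ultimately have "?U \<in> null_sets lborel" using ae by (subst AE_iff_null_sets) (auto intro: AE_mp)
    then show ?thesis by (auto simp: negligible_iff_null_sets null_sets_completionI)
  qed
  ultimately show False by contradiction
qed

text \<open>For neighbours \<open>M\<close> and \<open>N\<close> in a chain, with \<open>n\<close> measures from \<open>M\<close> to its end, this is the
excess of the energy of \<open>M\<close>, \<open>N\<close> and the optimal continuation after \<open>N\<close> over the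
energy of \<open>M\<close> with the optimal continuation after \<open>M\<close> (\<open>chain_defect_energies\<close>). It is written
through the two forms because the external field cancels.\<close>

definition chain_defect :: "real \<Rightarrow> real measure \<Rightarrow> real measure \<Rightarrow> real" where
  "chain_defect n M N =
     ((n - 1) / n)\<^sup>2 * ((1 + 1 / (n - 1)) * brown_form N N + kap_form 1 N N + kap_form (n - 1) N N)
     - 2 * ((n - 1) / n) * (brown_form M N + kap_form (1/2) M N - kap_form 1 M N)
     + ((1 - 1 / n) * brown_form M M + kap_form 1 M M - kap_form n M M)"

text \<open>Equal to \<open>(coth (\<pi> \<xi>) + coth ((n - 1) \<pi> \<xi>)) / (2 \<xi>)\<close>.\<close>

definition defect_weight :: "real \<Rightarrow> real \<Rightarrow> real" where
  "defect_weight n \<xi> = sinh (n * pi * \<xi>) / (2 * \<xi> * sinh (pi * \<xi>) * sinh ((n - 1) * pi * \<xi>))"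

lemma measurable_sinh [measurable]: "(sinh :: real \<Rightarrow> real) \<in> borel_measurable borel"
  by (intro borel_measurable_continuous_onI continuous_intros)

lemma defect_weight_pos:
  assumes "n > 1" "\<xi> \<noteq> 0" shows "defect_weight n \<xi> > 0"
proof (cases "\<xi> > 0")
  case True
  with assms show ?thesis unfolding defect_weight_def by (intro divide_pos_pos mult_pos_pos) auto
next
  case False
  with assms have "\<xi> < 0" by simp
  then have "sinh (n * pi * \<xi>) < 0" "sinh (pi * \<xi>) < 0" "sinh ((n - 1) * pi * \<xi>) < 0"
    using assms(1) by (auto simp: mult_pos_neg)
  with \<open>\<xi> < 0\<close> show ?thesis unfolding defect_weight_def
    by (intro divide_neg_neg mult_pos_neg mult_neg_neg) (auto simp: mult_pos_neg mult_neg_neg)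
qed

text \<open>The identity behind the elimination of one measure: the quadratic form of the defect at a single
frequency is a complete square. The terms \<open>1 / \<xi>\<^sup>2\<close> of the four transforms of \<open>kap\<close>
combine to cancel the Brownian term, and for the hyperbolic remainder the addition theorems give
\<open>coth x + coth y = sinh (x + y) / (sinh x sinh y)\<close> with \<open>x = \<pi> \<xi>\<close> and \<open>y = (n - 1) \<pi> \<xi>\<close>,
\<open>coth x - coth (x + y) = sinh y / (sinh x sinh (x + y))\<close> and
\<open>coth (x / 2) - coth x = 1 / sinh x\<close>, which are the three coefficients of a square.\<close>

lemma defect_symbol:
  assumes n: "n > 1" and nz: "\<xi> \<noteq> 0"
  shows "(n - 1) / n * ((cmod (g - f))\<^sup>2 / (2 * pi * \<xi>\<^sup>2))
     + ((n - 1) / n)\<^sup>2 * ((kap_hat 1 \<xi> + kap_hat (n - 1) \<xi>) * Re (g * cnj g))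
     + 2 * ((n - 1) / n) * ((kap_hat 1 \<xi> - kap_hat (1/2) \<xi>) * Re (f * cnj g))
     + (kap_hat 1 \<xi> - kap_hat n \<xi>) * Re (f * cnj f)
     = defect_weight n \<xi> * (cmod (((n - 1) / n) *\<^sub>R g - (sinh ((n - 1) * pi * \<xi>) / sinh (n * pi * \<xi>)) *\<^sub>R f))\<^sup>2"
proof -
  define k where "k = (n - 1) / n"
  define s1 c1 s c S C where "s1 = sinh (pi * \<xi>)" and "c1 = cosh (pi * \<xi>)"
    and "s = sinh ((n - 1) * pi * \<xi>)" and "c = cosh ((n - 1) * pi * \<xi>)"
    and "S = sinh (n * pi * \<xi>)" and "C = cosh (n * pi * \<xi>)"
  note defs = s1_def c1_def s_def c_def S_def C_def
  have nz': "s1 \<noteq> 0" "s \<noteq> 0" "S \<noteq> 0" using n nz by (auto simp: defs)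
  have arg: "n * pi * \<xi> = (n - 1) * pi * \<xi> + pi * \<xi>" by (simp add: algebra_simps)
  have S: "S = s * c1 + c * s1" and C: "C = c * c1 + s * s1"
    unfolding defs arg by (simp_all add: sinh_add cosh_add)
  have pyth: "c1\<^sup>2 = s1\<^sup>2 + 1" unfolding defs by (rule cosh_square_eq)
  define P where "P = 1 / (2 * pi * \<xi>\<^sup>2)"
  have K1: "kap_hat 1 \<xi> = 1 / (2 * \<xi>) * (c1 / s1) - P"
    using kap_hat_closed_form[of 1 \<xi>] nz by (simp add: defs P_def)
  have Kn: "kap_hat n \<xi> = 1 / (2 * \<xi>) * (C / S) - P / n"
    using kap_hat_closed_form[of n \<xi>] n nz by (simp add: defs P_def mult_ac)
  have Km: "kap_hat (n - 1) \<xi> = 1 / (2 * \<xi>) * (c / s) - P / (n - 1)"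
    using kap_hat_closed_form[of "n - 1" \<xi>] n nz by (simp add: defs P_def mult_ac)
  have Kh: "kap_hat (1/2) \<xi> = 1 / (2 * \<xi>) * (c1 / s1 + 1 / s1) - 2 * P"
  proof -
    define sh ch where "sh = sinh (pi * \<xi> / 2)" and "ch = cosh (pi * \<xi> / 2)"
    have "sh \<noteq> 0" "ch \<noteq> 0" using nz by (auto simp: sh_def ch_def)
    have dbl: "s1 = 2 * sh * ch" "c1 = ch\<^sup>2 + sh\<^sup>2"
      using sinh_double[of "pi * \<xi> / 2"] cosh_double[of "pi * \<xi> / 2"] by (simp_all add: defs sh_def ch_def)
    have "ch\<^sup>2 = sh\<^sup>2 + 1" unfolding sh_def ch_def by (rule cosh_square_eq)
    then have "ch / sh = c1 / s1 + 1 / s1"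
      unfolding dbl using \<open>sh \<noteq> 0\<close> \<open>ch \<noteq> 0\<close> by (simp add: divide_simps) (simp add: power2_eq_square algebra_simps)
    moreover have "kap_hat (1/2) \<xi> = 1 / (2 * \<xi>) * (ch / sh) - 2 * P"
      using kap_hat_closed_form[of "1/2" \<xi>] nz by (simp add: sh_def ch_def P_def mult_ac)
    ultimately show ?thesis by simp
  qed
  have sum1: "c1 / s1 + c / s = S / (s1 * s)" using nz' unfolding S by (simp add: field_simps)
  have sum2: "c1 / s1 - C / S = s / (s1 * S)"
  proof -
    have "c1 * S - s1 * C = s * (c1\<^sup>2 - s1\<^sup>2)" unfolding S C by (simp add: power2_eq_square algebra_simps)
    then have "c1 * S - s1 * C = s" using pyth by simp
    then show ?thesis using nz' by (simp add: field_simps)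
  qed
  define A B E where "A = Re (g * cnj g)" and "B = Re (f * cnj g)" and "E = Re (f * cnj f)"
  \<comment> \<open>The coefficients for which all multiples of \<open>1 / \<xi>\<^sup>2\<close> disappear.\<close>
  have kk: "k\<^sup>2 * (1 + 1 / (n - 1)) = k" "1 - 1 / n = k"
    using n by (simp_all add: k_def field_simps power2_eq_square)
  have D: "(cmod (g - f))\<^sup>2 = A - 2 * B + E" unfolding cmod_diff_squared A_def B_def E_def ..
  have D2: "(cmod (k *\<^sub>R g - (s / S) *\<^sub>R f))\<^sup>2 = k\<^sup>2 * A - 2 * k * (s / S) * B + (s / S)\<^sup>2 * E"
  proof -
    have "(cmod (x *\<^sub>R g - y *\<^sub>R f))\<^sup>2 = x\<^sup>2 * A - 2 * x * y * B + y\<^sup>2 * E" for x y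
      unfolding cmod_diff_squared A_def B_def E_def by (simp add: power2_eq_square algebra_simps)
    from this[of k "s / S"] show ?thesis by simp
  qed
  have "k * (P * (A - 2 * B + E)) + k\<^sup>2 * ((kap_hat 1 \<xi> + kap_hat (n - 1) \<xi>) * A)
     + 2 * k * ((kap_hat 1 \<xi> - kap_hat (1/2) \<xi>) * B) + (kap_hat 1 \<xi> - kap_hat n \<xi>) * E
     = 1 / (2 * \<xi>) * (k\<^sup>2 * (c1 / s1 + c / s) * A - 2 * k * (1 / s1) * B + (c1 / s1 - C / S) * E)
       + P * ((k - k\<^sup>2 * (1 + 1 / (n - 1))) * A + (k - (1 - 1 / n)) * E)"
    unfolding K1 Kn Km Kh by (simp add: algebra_simps add_divide_distrib diff_divide_distrib)
  also have "\<dots> = 1 / (2 * \<xi>) * (k\<^sup>2 * (S / (s1 * s)) * A - 2 * k * (1 / s1) * B + (s / (s1 * S)) * E)"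
    unfolding kk sum1 sum2 by simp
  also have "\<dots> = S / (2 * \<xi> * s1 * s) * (k\<^sup>2 * A - 2 * k * (s / S) * B + (s / S)\<^sup>2 * E)"
    using nz nz' by (simp add: field_simps power2_eq_square)
  finally show ?thesis
    unfolding defect_weight_def k_def[symmetric] defs[symmetric] D D2
      A_def[symmetric] B_def[symmetric] E_def[symmetric] by (simp add: P_def mult_ac)
qed

theorem chain_defect_spectral:
  assumes M: "finite_energy_law M" and N: "finite_energy_law N" and n: "n > 1"
  defines "h \<equiv> \<lambda>\<xi>. defect_weight n \<xi> * (cmod (((n - 1) / n) *\<^sub>R char N \<xi> - (sinh ((n - 1) * pi * \<xi>) / sinh (n * pi * \<xi>)) *\<^sub>R char M \<xi>))\<^sup>2"
  shows "integrable lborel h" and "chain_defect n M N = (\<integral>\<xi>. h \<xi> \<partial>lborel)"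
proof -
  define k where "k = (n - 1) / n"
  let ?f = "char M :: real \<Rightarrow> complex" and ?g = "char N :: real \<Rightarrow> complex"
  interpret M: real_distribution M using M by (rule finite_energy_law_dist)
  interpret N: real_distribution N using N by (rule finite_energy_law_dist)
  define B where "B \<xi> = (cmod (?g \<xi> - ?f \<xi>))\<^sup>2 / (2 * pi * \<xi>\<^sup>2)" for \<xi>
  define Q where "Q a A C \<xi> = kap_hat a \<xi> * Re (char A \<xi> * cnj (char C \<xi>))" for a A C \<xi>
  have B: "integrable lborel B" "brown_form N N - 2 * brown_form M N + brown_form M M = integral\<^sup>L lborel B"
    unfolding B_def[abs_def] using brown_form_spectral[OF M N] by auto
  have Q: "integrable lborel (Q a A C)" "kap_form a A C = integral\<^sup>L lborel (Q a A C)"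
    if "finite_energy_law A" "finite_energy_law C" "a > 0" for a A C
    unfolding Q_def[abs_def] using kap_form_fourier[OF that] by auto
  note [simp] = Q(1)[OF N N zero_less_one] Q(1)[OF M N zero_less_one] Q(1)[OF M M zero_less_one] B(1)
  have [simp]: "integrable lborel (Q (n - 1) N N)" "integrable lborel (Q n M M)" "integrable lborel (Q (1/2) M N)"
    using n by (auto intro!: Q M N)
  define h' where "h' \<xi> = k * B \<xi> + k\<^sup>2 * (Q 1 N N \<xi> + Q (n - 1) N N \<xi>) + 2 * k * (Q 1 M N \<xi> - Q (1/2) M N \<xi>)
     + (Q 1 M M \<xi> - Q n M M \<xi>)" for \<xi>
  have h'_int: "integrable lborel h'" unfolding h'_def[abs_def] by simp
  have ae: "AE \<xi> in lborel. h' \<xi> = h \<xi>"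
    using AE_lborel_singleton[of 0]
  proof eventually_elim
    case (elim \<xi>)
    show ?case
      using defect_symbol[OF n elim, of "?g \<xi>" "?f \<xi>"]
      unfolding h_def h'_def Q_def B_def k_def by (simp only: distrib_right left_diff_distrib)
  qed
  have [measurable]: "h \<in> borel_measurable borel" unfolding h_def defect_weight_def by measurable
  show "integrable lborel h"
    by (rule integrable_cong_AE_imp[OF h'_int _ ae]) measurable
  have "k\<^sup>2 * (1 + 1 / (n - 1)) = k" "1 - 1 / n = k"
    using n by (simp_all add: k_def field_simps power2_eq_square)
  then have "chain_defect n M N = k * (brown_form N N - 2 * brown_form M N + brown_form M M)
     + k\<^sup>2 * (kap_form 1 N N + kap_form (n - 1) N N) + 2 * k * (kap_form 1 M N - kap_form (1/2) M N)
     + (kap_form 1 M M - kap_form n M M)"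
  proof -
    assume k1: "k\<^sup>2 * (1 + 1 / (n - 1)) = k" and k2: "1 - 1 / n = k"
    have "chain_defect n M N = (k\<^sup>2 * (1 + 1 / (n - 1))) * brown_form N N + k\<^sup>2 * (kap_form 1 N N + kap_form (n - 1) N N)
       - 2 * k * (brown_form M N + kap_form (1/2) M N - kap_form 1 M N)
       + (1 - 1 / n) * brown_form M M + (kap_form 1 M M - kap_form n M M)"
      unfolding chain_defect_def k_def by (simp add: algebra_simps)
    then show ?thesis unfolding k1 k2 by (simp add: algebra_simps)
  qed
  also have "\<dots> = (\<integral>\<xi>. h' \<xi> \<partial>lborel)"
    unfolding h'_def[abs_def] B(2) using n by (simp add: Q(2) M N)
  also have "\<dots> = (\<integral>\<xi>. h \<xi> \<partial>lborel)"
    by (rule integral_cong_AE[OF _ _ ae]) (use h'_int in auto)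
  finally show "chain_defect n M N = (\<integral>\<xi>. h \<xi> \<partial>lborel)" .
qed

theorem chain_defect_nonneg:
  assumes M: "finite_energy_law M" and N: "finite_energy_law N" and n: "n > 1"
  shows "chain_defect n M N \<ge> 0"
  unfolding chain_defect_spectral(2)[OF assms]
proof (rule integral_nonneg_AE)
  show "AE \<xi> in lborel. 0 \<le> defect_weight n \<xi> * (cmod (((n - 1) / n) *\<^sub>R char N \<xi> - (sinh ((n - 1) * pi * \<xi>) / sinh (n * pi * \<xi>)) *\<^sub>R char M \<xi>))\<^sup>2"
    using AE_lborel_singleton[of 0]
    by eventually_elim (intro mult_nonneg_nonneg less_imp_le[OF defect_weight_pos[OF n]] zero_le_power2)
qed

text \<open>The weight is positive off \<open>\<xi> = 0\<close>, so a vanishing defect makes the square vanish almost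
everywhere, and everywhere by continuity. Clearing the denominator \<open>sinh (n \<pi> \<xi>)\<close> includes \<open>\<xi> = 0\<close>.\<close>

theorem chain_defect_eq_0_iff:
  assumes M: "finite_energy_law M" and N: "finite_energy_law N" and n: "n > 1"
  shows "chain_defect n M N = 0 \<longleftrightarrow>
    (\<forall>\<xi>. ((n - 1) / n * sinh (n * pi * \<xi>)) *\<^sub>R char N \<xi> = sinh ((n - 1) * pi * \<xi>) *\<^sub>R char M \<xi>)"
proof -
  interpret M: real_distribution M using M by (rule finite_energy_law_dist)
  interpret N: real_distribution N using N by (rule finite_energy_law_dist)
  define h where "h \<xi> = defect_weight n \<xi> * (cmod (((n - 1) / n) *\<^sub>R char N \<xi> - (sinh ((n - 1) * pi * \<xi>) / sinh (n * pi * \<xi>)) *\<^sub>R char M \<xi>))\<^sup>2" for \<xi>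
  define d where "d \<xi> = ((n - 1) / n * sinh (n * pi * \<xi>)) *\<^sub>R char N \<xi> - sinh ((n - 1) * pi * \<xi>) *\<^sub>R char M \<xi>" for \<xi>
  have h_int: "integrable lborel h" and cd: "chain_defect n M N = integral\<^sup>L lborel h"
    using chain_defect_spectral[OF assms] unfolding h_def[abs_def] by auto
  have h0: "h \<xi> \<ge> 0 \<and> (h \<xi> = 0 \<longleftrightarrow> d \<xi> = 0)" if "\<xi> \<noteq> 0" for \<xi>
  proof -
    have S: "sinh (n * pi * \<xi>) \<noteq> 0" using n that by simp
    have "d \<xi> = sinh (n * pi * \<xi>) *\<^sub>R (((n - 1) / n) *\<^sub>R char N \<xi> - (sinh ((n - 1) * pi * \<xi>) / sinh (n * pi * \<xi>)) *\<^sub>R char M \<xi>)"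
      unfolding d_def using S by (simp add: algebra_simps)
    then have "d \<xi> = 0 \<longleftrightarrow> ((n - 1) / n) *\<^sub>R char N \<xi> - (sinh ((n - 1) * pi * \<xi>) / sinh (n * pi * \<xi>)) *\<^sub>R char M \<xi> = 0"
      using S by (simp only: scaleR_eq_0_iff) simp
    then show ?thesis using defect_weight_pos[OF n that] unfolding h_def by auto
  qed
  have hae: "AE \<xi> in lborel. 0 \<le> h \<xi>" "AE \<xi> in lborel. h \<xi> = 0 \<longleftrightarrow> d \<xi> = 0"
    using AE_lborel_singleton[of 0] by (eventually_elim, use h0 in blast)+
  have "chain_defect n M N = 0 \<longleftrightarrow> (AE \<xi> in lborel. h \<xi> = 0)"
    unfolding cd by (rule integral_nonneg_eq_0_iff_AE[OF h_int hae(1)])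
  also have "\<dots> \<longleftrightarrow> (AE \<xi> in lborel. d \<xi> = 0)"
    using hae(2) by (rule eventually_subst)
  also have "\<dots> \<longleftrightarrow> (\<forall>\<xi>. d \<xi> = 0)"
  proof
    have "continuous_on UNIV d"
      unfolding d_def using M.isCont_char N.isCont_char
      by (intro continuous_intros continuous_at_imp_continuous_on ballI) (auto simp: n[THEN less_imp_neq, symmetric])
    then show "\<forall>\<xi>. d \<xi> = 0" if "AE \<xi> in lborel. d \<xi> = 0"
      using continuous_AE_eq_0[OF _ that] by blast
  qed auto
  finally show ?thesis unfolding d_def by simp
qed

section \<open>Chains of measures\<close>

lemma brownian_perturb: "brownian (u + w) (v + w') \<le> brownian u v + \<bar>w\<bar> + \<bar>w'\<bar>"
proof -
  have "\<bar>u + w\<bar> \<le> \<bar>u\<bar> + \<bar>w\<bar>" "\<bar>v + w'\<bar> \<le> \<bar>v\<bar> + \<bar>w'\<bar>" by (rule abs_triangle_ineq)+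
  moreover have "\<bar>u - v\<bar> \<le> \<bar>u + w - (v + w')\<bar> + \<bar>w\<bar> + \<bar>w'\<bar>" by arith
  moreover have "A \<le> a + c \<Longrightarrow> B \<le> b + c' \<Longrightarrow> d \<le> D + c + c' \<Longrightarrow> (A + B - D) / 2 \<le> (a + b - d) / 2 + c + c'"
    for a b c c' d A B D :: real by (simp add: add_divide_distrib diff_divide_distrib)
  ultimately show ?thesis unfolding brownian_def by blast
qed

text \<open>Translations by \<open>w\<close> and \<open>w'\<close> change the Brownian kernel by at most \<open>\<bar>w\<bar> + \<bar>w'\<bar>\<close>, and
convolution can only decrease the \<open>kap\<close> energy, since characteristic functions are bounded by \<open>1\<close>.\<close>

lemma finite_energy_convolution:
  assumes M: "finite_energy_law M" and T: "real_distribution T" and mom: "(\<integral>\<^sup>+x. ennreal \<bar>x\<bar> \<partial>T) < \<infinity>"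
  shows "finite_energy_law (M \<star> T)"
proof -
  interpret M: real_distribution M using M by (rule finite_energy_law_dist)
  interpret T: real_distribution T by (rule T)
  interpret MT: real_distribution "M \<star> T" by (rule real_distribution_convolution) unfold_locales
  note D = M.real_distribution_axioms T.real_distribution_axioms
  have conv: "(\<integral>\<^sup>+x. f x \<partial>(M \<star> T)) = (\<integral>\<^sup>+x. \<integral>\<^sup>+y. f (x + y) \<partial>T \<partial>M)" if "f \<in> borel_measurable borel" for f
    using that by (intro nn_integral_convolution) (auto intro: M.finite_measure_axioms T.finite_measure_axioms)
  let ?m = "\<integral>\<^sup>+x. ennreal \<bar>x\<bar> \<partial>T"
  have "(\<integral>\<^sup>+u. ennreal (max u 0) \<partial>(M \<star> T)) \<le> (\<integral>\<^sup>+x. \<integral>\<^sup>+y. ennreal (max x 0) + ennreal \<bar>y\<bar> \<partial>T \<partial>M)"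
  proof (subst conv, measurable, intro nn_integral_mono)
    fix x y :: real
    show "ennreal (max (x + y) 0) \<le> ennreal (max x 0) + ennreal \<bar>y\<bar>"
    proof -
      have "max (x + y) 0 \<le> max x 0 + \<bar>y\<bar>" by simp
      then show ?thesis by (metis ennreal_leI ennreal_plus abs_ge_zero max.cobounded2)
    qed
  qed
  also have "\<dots> = (\<integral>\<^sup>+x. ennreal (max x 0) \<partial>M) + ?m"
    by (simp add: nn_integral_add T.emeasure_space_1[simplified] M.emeasure_space_1[simplified])
  also have "\<dots> < \<infinity>" using M mom by (simp add: finite_energy_law_def)
  finally have 1: "(\<integral>\<^sup>+u. ennreal (max u 0) \<partial>(M \<star> T)) < \<infinity>" .
  have "brownian_energy (M \<star> T) (M \<star> T) = (\<integral>\<^sup>+x. \<integral>\<^sup>+w. \<integral>\<^sup>+y. \<integral>\<^sup>+w'. ennreal (brownian (x + w) (y + w')) \<partial>T \<partial>M \<partial>T \<partial>M)"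
    unfolding brownian_energy_def by (subst conv, measurable, subst conv, measurable)
  also have "\<dots> \<le> (\<integral>\<^sup>+x. \<integral>\<^sup>+w. \<integral>\<^sup>+y. \<integral>\<^sup>+w'. ennreal (brownian x y) + (ennreal \<bar>w\<bar> + ennreal \<bar>w'\<bar>) \<partial>T \<partial>M \<partial>T \<partial>M)"
    using brownian_perturb brownian_nonneg
    by (intro nn_integral_mono) (auto intro!: ennreal_leI simp: add.assoc simp flip: ennreal_plus)
  also have "\<dots> = brownian_energy M M + (?m + ?m)"
    unfolding brownian_energy_def
    by (simp add: nn_integral_add T.emeasure_space_1[simplified] M.emeasure_space_1[simplified] add_ac)
  also have "\<dots> < \<infinity>" using M mom by (simp add: finite_energy_law_def)
  finally have 2: "brownian_energy (M \<star> T) (M \<star> T) < \<infinity>" .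
  have "kap_energy 1 (M \<star> T) (M \<star> T) \<le> (kap_energy 1 M M)"
    unfolding kap_energy_self[OF MT.real_distribution_axioms zero_less_one] kap_energy_self[OF D(1) zero_less_one]
  proof (intro nn_integral_mono ennreal_leI mult_left_mono)
    fix \<xi>
    have "cmod (char (M \<star> T) \<xi>) \<le> cmod (char M \<xi>)"
      unfolding char_convolution[OF D] norm_mult using T.cmod_char_le_1 by (intro mult_right_le_one_le) auto
    then show "(cmod (char (M \<star> T) \<xi>))\<^sup>2 \<le> (cmod (char M \<xi>))\<^sup>2" by (intro power_mono) auto
  qed (simp add: kap_hat_nonneg)
  also have "\<dots> < \<infinity>" using M by (simp add: finite_energy_law_def)
  finally have 3: "kap_energy 1 (M \<star> T) (M \<star> T) < \<infinity>" .
  show ?thesis using 1 2 3 MT.real_distribution_axioms by (simp add: finite_energy_law_def)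
qed

lemma sinh_ratio_convolution_exists:
  assumes M: "finite_energy_law M" and ab: "0 < a" "a \<le> b"
  shows "\<exists>N. finite_energy_law N \<and> (\<forall>t. char N t = sinh_ratio a b t *\<^sub>R char M t)"
proof -
  obtain T where T: "real_distribution T" "\<And>t. char T t = complex_of_real (sinh_ratio a b t)" "(\<integral>\<^sup>+x. ennreal \<bar>x\<bar> \<partial>T) < \<infinity>"
    using sinh_ratio_law_exists[OF ab] by blast
  have "char (M \<star> T) t = sinh_ratio a b t *\<^sub>R char M t" for t
    unfolding char_convolution[OF finite_energy_law_dist[OF M] T(1)] T(2) by (simp add: scaleR_conv_of_real mult.commute)
  then show ?thesis using finite_energy_convolution[OF M T(1,3)] by blast
qed

lemma law_eqI_char:
  assumes "finite_energy_law M" "finite_energy_law N" "\<And>t. char M t = char N t"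
  shows "M = N"
  using assms by (intro Levy_uniqueness) (auto intro: finite_energy_law_dist)

lemma chain_defect_zero_unique:
  assumes M: "finite_energy_law M" and N: "finite_energy_law N" and N': "finite_energy_law N'" and n: "n > 1"
    and z: "chain_defect n M N = 0" "chain_defect n M N' = 0"
  shows "N = N'"
proof (rule law_eqI_char[OF N N'])
  fix t
  interpret N: real_distribution N using N by (rule finite_energy_law_dist)
  interpret N': real_distribution N' using N' by (rule finite_energy_law_dist)
  show "char N t = char N' t"
  proof (cases "t = 0")
    case True then show ?thesis by (simp add: N.char_zero N'.char_zero)
  next
    case False
    have "((n - 1) / n * sinh (n * pi * t)) *\<^sub>R char N t = ((n - 1) / n * sinh (n * pi * t)) *\<^sub>R char N' t"
      using z unfolding chain_defect_eq_0_iff[OF M N n] chain_defect_eq_0_iff[OF M N' n] by simp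
    then show ?thesis using n False by (simp only: scaleR_cancel_left) simp
  qed
qed

text \<open>Every member of the chain is a convolution of \<open>M\<close> itself with a law that depends only on its position:
the successive quotients required by \<open>chain_defect_eq_0_iff\<close> telescope to the factor
\<open>sinh_ratio (r - j) r\<close> at position \<open>j\<close>.\<close>

theorem chain_extension_exists:
  assumes M: "finite_energy_law M" and r: "r \<ge> (1::nat)"
  shows "\<exists>\<pi>. \<pi> 0 = M \<and> (\<forall>j<r. finite_energy_law (\<pi> j)) \<and>
     (\<forall>j. Suc j < r \<longrightarrow> chain_defect (real (r - j)) (\<pi> j) (\<pi> (Suc j)) = 0)"
proof -
  have "\<exists>N. finite_energy_law N \<and> (\<forall>t. char N t = sinh_ratio (real (r - j)) (real r) t *\<^sub>R char M t)" if "j < r" for j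
    using that by (intro sinh_ratio_convolution_exists M) auto
  then obtain \<pi> where \<pi>: "\<And>j. j < r \<Longrightarrow> finite_energy_law (\<pi> j)"
     "\<And>j t. j < r \<Longrightarrow> char (\<pi> j) t = sinh_ratio (real (r - j)) (real r) t *\<^sub>R char M t"
    by metis
  have "\<pi> 0 = M"
    using r by (intro law_eqI_char \<pi> M) (auto simp: \<pi>(2) sinh_ratio_def)
  moreover have "chain_defect (real (r - j)) (\<pi> j) (\<pi> (Suc j)) = 0" if j: "Suc j < r" for j
  proof -
    define n where "n = real (r - j)"
    have n: "n > 1" "real (r - Suc j) = n - 1" using j by (auto simp: n_def)
    have "((n - 1) / n * sinh (n * pi * \<xi>)) *\<^sub>R char (\<pi> (Suc j)) \<xi> = sinh ((n - 1) * pi * \<xi>) *\<^sub>R char (\<pi> j) \<xi>" for \<xi>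
    proof (cases "\<xi> = 0")
      case True then show ?thesis by simp
    next
      case False
      have "(n - 1) / n * sinh (n * pi * \<xi>) * sinh_ratio (n - 1) (real r) \<xi> = sinh ((n - 1) * pi * \<xi>) * sinh_ratio n (real r) \<xi>"
        using n False r by (simp add: sinh_ratio_def field_simps)
      then show ?thesis unfolding \<pi>(2)[OF j] \<pi>(2)[OF Suc_lessD[OF j]] n_def[symmetric] n(2) scaleR_scaleR by (simp only:)
    qed
    then show ?thesis
      unfolding n_def[symmetric] using j by (subst chain_defect_eq_0_iff[OF \<pi>(1) \<pi>(1) n(1)]) auto
  qed
  ultimately show ?thesis using \<pi>(1) by blast
qed

lemma chain_extension_unique:
  assumes "\<forall>j<r. finite_energy_law (\<pi> j)" "\<forall>j<r. finite_energy_law (\<pi>' j)" "\<pi> 0 = \<pi>' 0"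
    and "\<forall>j. Suc j < r \<longrightarrow> chain_defect (real (r - j)) (\<pi> j) (\<pi> (Suc j)) = 0"
    and "\<forall>j. Suc j < r \<longrightarrow> chain_defect (real (r - j)) (\<pi>' j) (\<pi>' (Suc j)) = 0"
    and "j < r"
  shows "\<pi> j = \<pi>' j"
  using \<open>j < r\<close>
proof (induction j)
  case 0 then show ?case using assms(3) by simp
next
  case (Suc j)
  then have eq: "\<pi> j = \<pi>' j" by simp
  have "real (r - j) > 1" using Suc.prems by simp
  then show ?case
    using assms(1,2,4,5) Suc.prems unfolding eq[symmetric]
    by (intro chain_defect_zero_unique[of "\<pi> j" _ _ "real (r - j)"]) (auto simp: eq[symmetric])
qed

definition plus_moment :: "real measure \<Rightarrow> real" where
  "plus_moment M = (\<integral>u. max u 0 \<partial>M)"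

text \<open>The energy of the image of \<open>M\<close> under \<open>u \<mapsto> exp u\<close> for the kernel
\<open>- ln \<bar>root n x - root n y\<bar>\<close>; compare \<open>ln_root_exp_diff\<close>.\<close>

definition root_energy :: "real \<Rightarrow> real measure \<Rightarrow> real" where
  "root_energy n M = (brown_form M M - 2 * plus_moment M) / n + kap_form n M M"

text \<open>The mutual energy of the images of \<open>M\<close> and \<open>N\<close> on opposite half-lines; compare \<open>ln_exp_sum\<close>.\<close>

definition cross_energy :: "real measure \<Rightarrow> real measure \<Rightarrow> real" where
  "cross_energy M N = brown_form M N + kap_form (1/2) M N - kap_form 1 M N - plus_moment M - plus_moment N"

text \<open>In terms of energies, the contributions of \<open>plus_moment\<close> cancel by the same two relations between
\<open>n\<close> and \<open>k = (n - 1) / n\<close> as the poles at \<open>\<xi> = 0\<close> in \<open>defect_symbol\<close>.\<close>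

lemma chain_defect_energies:
  assumes n: "n > 1"
  shows "chain_defect n M N = ((n - 1) / n)\<^sup>2 * (root_energy 1 N + root_energy (n - 1) N)
     - 2 * ((n - 1) / n) * cross_energy M N + (root_energy 1 M - root_energy n M)"
proof -
  define k where "k = (n - 1) / n"
  have k: "k\<^sup>2 * (1 + 1 / (n - 1)) = k" "1 - 1 / n = k"
    using n by (simp_all add: k_def field_simps power2_eq_square)
  have "k\<^sup>2 * (root_energy 1 N + root_energy (n - 1) N) - 2 * k * cross_energy M N + (root_energy 1 M - root_energy n M)
    = k\<^sup>2 * ((1 + 1 / (n - 1)) * brown_form N N + kap_form 1 N N + kap_form (n - 1) N N)
     - 2 * k * (brown_form M N + kap_form (1/2) M N - kap_form 1 M N)
     + ((1 - 1 / n) * brown_form M M + kap_form 1 M M - kap_form n M M)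
     + 2 * plus_moment N * (k - k\<^sup>2 * (1 + 1 / (n - 1))) + 2 * plus_moment M * (k - (1 - 1 / n))"
    unfolding root_energy_def cross_energy_def by (simp add: algebra_simps add_divide_distrib diff_divide_distrib)
  also have "\<dots> = chain_defect n M N" unfolding k chain_defect_def k_def[symmetric] by simp
  finally show ?thesis by (simp add: k_def)
qed

text \<open>Multiplied by the squared masses the defects telescope: the energy \<open>root_energy (r - j)\<close> of the
\<open>j\<close>-th measure occurs with opposite signs in two consecutive defects, and at the last measure it
is the ordinary energy. Only half of the energy of the initial measure enters, because two chains
start from it.\<close>

theorem chain_energy_decomposition:
  fixes r :: nat and \<pi> :: "nat \<Rightarrow> real measure"
  assumes r: "r \<ge> 1"
  defines "m \<equiv> \<lambda>j::nat. 1 - real j / real r"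
  shows "root_energy 1 (\<pi> 0) / 2 + (\<Sum>j=1..<r. (m j)\<^sup>2 * root_energy 1 (\<pi> j))
      - (\<Sum>j<r-1. m j * m (Suc j) * cross_energy (\<pi> j) (\<pi> (Suc j)))
    = root_energy (real r) (\<pi> 0) / 2 + (\<Sum>j<r-1. (m j)\<^sup>2 * chain_defect (real (r - j)) (\<pi> j) (\<pi> (Suc j))) / 2"
proof -
  define a where "a j = (m j)\<^sup>2 * root_energy 1 (\<pi> j)" for j
  define e where "e j = (m j)\<^sup>2 * root_energy (real (r - j)) (\<pi> j)" for j
  have summand: "(m j)\<^sup>2 * chain_defect (real (r - j)) (\<pi> j) (\<pi> (Suc j)) =
     a (Suc j) + e (Suc j) + a j - e j - 2 * (m j * m (Suc j) * cross_energy (\<pi> j) (\<pi> (Suc j)))" if "j < r - 1" for j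
  proof -
    define n where "n = real (r - j)"
    have n: "n > 1" "real (r - Suc j) = n - 1" using that by (auto simp: n_def)
    have m: "m j = n / real r" "m (Suc j) = (n - 1) / real r" using that r by (auto simp: m_def n_def field_simps)
    then have mS: "m (Suc j) = m j * ((n - 1) / n)" using n by simp
    have *: "x\<^sup>2 * (k\<^sup>2 * (A + B) - 2 * k * X + (C - D)) = (x * k)\<^sup>2 * A + (x * k)\<^sup>2 * B + x\<^sup>2 * C - x\<^sup>2 * D - 2 * (x * (x * k) * X)"
      for x k A B C D X :: real by (simp add: power2_eq_square algebra_simps)
    show ?thesis
      unfolding n_def[symmetric] a_def e_def n(2) mS chain_defect_energies[OF n(1)]
      by (rule *)
  qed
  \<comment> \<open>The terms \<open>e j\<close> cancel between neighbours, and every inner \<open>a j\<close> is counted twice.\<close>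
  have tel: "(\<Sum>j<K. a (Suc j) + e (Suc j) + a j - e j) = a 0 - e 0 + 2 * (\<Sum>j=1..<Suc K. a j) - a K + e K" for K
    by (induction K) (auto simp: sum.atLeastLessThan_Suc)
  have "(\<Sum>j<r-1. (m j)\<^sup>2 * chain_defect (real (r - j)) (\<pi> j) (\<pi> (Suc j))) =
     (\<Sum>j<r-1. a (Suc j) + e (Suc j) + a j - e j) - 2 * (\<Sum>j<r-1. m j * m (Suc j) * cross_energy (\<pi> j) (\<pi> (Suc j)))"
    unfolding sum_distrib_left sum_subtractf[symmetric] by (intro sum.cong refl summand) simp
  also have "(\<Sum>j<r-1. a (Suc j) + e (Suc j) + a j - e j) = a 0 - e 0 + 2 * (\<Sum>j=1..<r. a j)"
  proof -
    have "a (r - 1) = e (r - 1)" "Suc (r - 1) = r" using r by (auto simp: a_def e_def)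
    then show ?thesis using tel[of "r - 1"] by simp
  qed
  finally have defects: "(\<Sum>j<r-1. (m j)\<^sup>2 * chain_defect (real (r - j)) (\<pi> j) (\<pi> (Suc j))) =
     a 0 - e 0 + 2 * (\<Sum>j=1..<r. a j) - 2 * (\<Sum>j<r-1. m j * m (Suc j) * cross_energy (\<pi> j) (\<pi> (Suc j)))" .
  have "a 0 = root_energy 1 (\<pi> 0)" "e 0 = root_energy (real r) (\<pi> 0)" by (simp_all add: a_def e_def m_def)
  then show ?thesis unfolding defects add_divide_distrib diff_divide_distrib unfolding a_def
    by (simp del: sum.op_ivl_Suc)
qed

section \<open>Logarithmic kernels in exponential coordinates\<close>

text \<open>The real-valued version of \<open>kap\<close>, which has the default value \<open>0\<close> at \<open>t = 0\<close>; this does not affect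
integrals, because product measures of finite energy do not charge the diagonal
(\<open>kap_finite_AE_distinct\<close>).\<close>

definition kap_real :: "real \<Rightarrow> real \<Rightarrow> real" where
  "kap_real a t = - ln (1 - exp (- (\<bar>t\<bar> / a)))"

lemma measurable_kap_real [measurable]: "kap_real a \<in> borel_measurable borel"
  unfolding kap_real_def[abs_def] by measurable

lemma kap_real_nonneg: "a > 0 \<Longrightarrow> t \<noteq> 0 \<Longrightarrow> kap_real a t \<ge> 0"
  unfolding kap_real_def by (simp add: ln_le_zero_iff)

lemma kap_eq_kap_real: "a > 0 \<Longrightarrow> t \<noteq> 0 \<Longrightarrow> kap a t = ennreal (kap_real a t)"
  unfolding kap_real_def by (rule kap_eq)

lemma kap_real_scale: "a > 0 \<Longrightarrow> kap_real 1 (u / a - v / a) = kap_real a (u - v)"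
  unfolding kap_real_def by (simp add: diff_divide_distrib[symmetric])

text \<open>Factor \<open>exp (max u v)\<close> out of the difference.\<close>

lemma ln_exp_diff:
  assumes "u \<noteq> (v::real)"
  shows "ln (1 / \<bar>exp u - exp v\<bar>) = brownian u v - max u 0 - max v 0 + kap_real 1 (u - v)"
proof -
  have main: "ln (1 / \<bar>exp x - exp y\<bar>) = - max x y + kap_real 1 (x - y)" if "x > y" for x y :: real
  proof -
    have "exp x - exp y = exp x * (1 - exp (- (\<bar>x - y\<bar> / 1)))"
      using that by (simp add: right_diff_distrib flip: exp_add)
    moreover have "1 - exp (- (\<bar>x - y\<bar> / 1)) > 0" using that by simp
    ultimately have "ln (exp x - exp y) = x + ln (1 - exp (- (\<bar>x - y\<bar> / 1)))"
      by (simp add: ln_mult)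
    moreover have "ln (1 / \<bar>exp x - exp y\<bar>) = - ln (exp x - exp y)" using that by (simp add: ln_div)
    ultimately show ?thesis using that by (simp add: kap_real_def)
  qed
  have "ln (1 / \<bar>exp u - exp v\<bar>) = - max u v + kap_real 1 (u - v)"
  proof (cases "u > v")
    case True then show ?thesis by (rule main)
  next
    case False
    then have "v > u" using assms by simp
    from main[OF this] show ?thesis by (simp add: abs_minus_commute max.commute kap_real_def)
  qed
  then show ?thesis using max_eq_brownian[of u v] by linarith
qed

text \<open>With \<open>z = exp (- \<bar>u - v\<bar>)\<close>, the factorization \<open>1 + z = (1 - z\<^sup>2) / (1 - z)\<close> turns the sum into
a difference of two kernels, and \<open>z\<^sup>2\<close> halves the parameter.\<close>

lemma ln_exp_sum:
  assumes "u \<noteq> (v::real)"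
  shows "ln (1 / (exp u + exp v)) = brownian u v - max u 0 - max v 0 + (kap_real (1/2) (u - v) - kap_real 1 (u - v))"
proof -
  define z where "z = exp (- \<bar>u - v\<bar>)"
  have z: "0 < z" "z < 1" using assms by (auto simp: z_def)
  have "exp u + exp v = exp (max u v) * (1 + z)"
    by (cases "u \<le> v") (auto simp: z_def max_def distrib_left simp flip: exp_add)
  then have "ln (1 / (exp u + exp v)) = - max u v - ln (1 + z)"
    using z by (simp add: ln_div ln_mult)
  moreover have "ln (1 - z\<^sup>2) = ln (1 - z) + ln (1 + z)"
  proof -
    have "1 - z\<^sup>2 = (1 - z) * (1 + z)" by (simp add: power2_eq_square algebra_simps)
    then show ?thesis using z by (simp add: ln_mult)
  qed
  moreover have "z\<^sup>2 = exp (- (\<bar>u - v\<bar> / (1/2)))"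
    by (simp add: z_def power2_eq_square flip: exp_add)
  ultimately show ?thesis using max_eq_brownian[of u v] by (simp add: kap_real_def z_def)
qed

lemma brownian_divide: "a > 0 \<Longrightarrow> brownian (u / a) (v / a) = brownian u v / a"
proof -
  assume a: "a > 0"
  have "\<bar>u / a - v / a\<bar> = \<bar>u - v\<bar> / a" "\<bar>u / a\<bar> = \<bar>u\<bar> / a" "\<bar>v / a\<bar> = \<bar>v\<bar> / a"
    using a by (simp_all flip: diff_divide_distrib)
  then have "brownian (u / a) (v / a) = (\<bar>u\<bar> / a + \<bar>v\<bar> / a - \<bar>u - v\<bar> / a) / 2" by (simp only: brownian_def)
  also have "\<dots> = brownian u v / a"
    unfolding brownian_def add_divide_distrib[symmetric] diff_divide_distrib[symmetric] by (simp add: mult.commute)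
  finally show ?thesis .
qed

lemma max_divide_0: "a > 0 \<Longrightarrow> max (u / a) 0 = max u 0 / (a::real)"
  by (auto simp: max_def divide_le_0_iff)

text \<open>Taking roots divides the exponents by \<open>n\<close>, and the Brownian covariance is homogeneous.\<close>

lemma ln_root_exp_diff:
  assumes "u \<noteq> (v::real)" "n \<ge> (1::nat)"
  shows "ln (1 / \<bar>root n (exp u) - root n (exp v)\<bar>) = (brownian u v - max u 0 - max v 0) / real n + kap_real (real n) (u - v)"
proof -
  have r: "root n (exp x) = exp (x / real n)" for x
    using assms by (intro real_root_pos_unique) (auto simp flip: exp_of_nat_mult)
  have "u / real n \<noteq> v / real n" using assms by simp
  from ln_exp_diff[OF this] show ?thesis
    using assms by (simp add: r brownian_divide max_divide_0 kap_real_scale diff_divide_distrib)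
qed

lemma log_kernel_exp:
  assumes "u \<noteq> v" "\<bar>s\<bar> = 1"
  shows "log_kernel (s * exp u) (s * exp v) = ereal (brownian u v - max u 0 - max v 0 + kap_real 1 (u - v))"
proof -
  have "\<bar>s * exp u - s * exp v\<bar> = \<bar>exp u - exp v\<bar>"
    using assms(2) by (metis abs_mult mult_1 right_diff_distrib)
  moreover have "s * exp u \<noteq> s * exp v" using assms by auto
  ultimately show ?thesis by (simp add: log_kernel_def ln_exp_diff[OF assms(1), symmetric])
qed

lemma log_kernel_exp_opposite:
  assumes "u \<noteq> v" "\<bar>s\<bar> = 1"
  shows "log_kernel (s * exp u) (- s * exp v) = ereal (brownian u v - max u 0 - max v 0 + (kap_real (1/2) (u - v) - kap_real 1 (u - v)))"
proof -
  have "s = 1 \<or> s = -1" using assms(2) by arith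
  then have e: "\<bar>s * exp u - (- s * exp v)\<bar> = exp u + exp v"
    using add_pos_pos[OF exp_gt_zero[of u] exp_gt_zero[of v]] by auto
  moreover have "exp u + exp v > 0" by (intro add_pos_pos) auto
  ultimately have "s * exp u \<noteq> - s * exp v" by auto
  then show ?thesis using e by (simp add: log_kernel_def ln_exp_sum[OF assms(1), symmetric])
qed

lemma measurable_log_kernel [measurable (raw)]:
  assumes [measurable]: "f \<in> borel_measurable M" "g \<in> borel_measurable M"
  shows "(\<lambda>x. log_kernel (f x) (g x)) \<in> borel_measurable M"
  unfolding log_kernel_def by measurable

lemma nn_integral_diff_law_pair:
  assumes M: "real_distribution M" and N: "real_distribution N" and [measurable]: "f \<in> borel_measurable borel"
  shows "(\<integral>\<^sup>+z. f (fst z - snd z) \<partial>(M \<Otimes>\<^sub>M N)) = (\<integral>\<^sup>+t. f t \<partial>diff_law M N)"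
proof -
  interpret M: real_distribution M by (rule M)
  interpret N: real_distribution N by (rule N)
  show ?thesis unfolding diff_law_def by (subst nn_integral_distr) (auto simp: case_prod_beta')
qed

lemma kap_finite_AE_distinct:
  assumes M: "real_distribution M" and N: "real_distribution N" and fin: "kap_energy a M N < \<infinity>"
  shows "AE z in M \<Otimes>\<^sub>M N. fst z \<noteq> snd z"
proof -
  interpret M: real_distribution M by (rule M)
  interpret N: real_distribution N by (rule N)
  have "(\<integral>\<^sup>+z. kap a (fst z - snd z) \<partial>(M \<Otimes>\<^sub>M N)) \<noteq> \<infinity>"
    using fin by (subst nn_integral_diff_law_pair[OF M N]) auto
  then have "AE z in M \<Otimes>\<^sub>M N. kap a (fst z - snd z) \<noteq> \<infinity>"
    by (intro nn_integral_PInf_AE) auto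
  then show ?thesis by eventually_elim (auto simp: kap_zero)
qed

lemma kap_form_integral:
  assumes M: "finite_energy_law M" and N: "finite_energy_law N" and a: "a > 0"
  shows "integrable (M \<Otimes>\<^sub>M N) (\<lambda>z. kap_real a (fst z - snd z))"
    and "(\<integral>z. kap_real a (fst z - snd z) \<partial>(M \<Otimes>\<^sub>M N)) = kap_form a M N"
proof -
  note D = M[THEN finite_energy_law_dist] N[THEN finite_energy_law_dist]
  interpret M: real_distribution M by (rule D)
  interpret N: real_distribution N by (rule D)
  note fin = kap_form_fourier(2)[OF M N a]
  have ae: "AE z in M \<Otimes>\<^sub>M N. fst z \<noteq> snd z" by (rule kap_finite_AE_distinct[OF D fin])
  have nn: "(\<integral>\<^sup>+z. ennreal (kap_real a (fst z - snd z)) \<partial>(M \<Otimes>\<^sub>M N)) = (kap_energy a M N)"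
    unfolding nn_integral_diff_law_pair[OF D measurable_kap, symmetric]
    by (rule nn_integral_cong_AE) (use ae in eventually_elim, simp add: kap_eq_kap_real[OF a])
  have pos: "AE z in M \<Otimes>\<^sub>M N. 0 \<le> kap_real a (fst z - snd z)"
    using ae by eventually_elim (simp add: kap_real_nonneg a)
  show int: "integrable (M \<Otimes>\<^sub>M N) (\<lambda>z. kap_real a (fst z - snd z))"
    using fin unfolding nn[symmetric] by (intro integrableI_nonneg pos) auto
  have "0 \<le> (\<integral>z. kap_real a (fst z - snd z) \<partial>(M \<Otimes>\<^sub>M N))" by (rule integral_nonneg_AE[OF pos])
  then show "(\<integral>z. kap_real a (fst z - snd z) \<partial>(M \<Otimes>\<^sub>M N)) = kap_form a M N"
    unfolding kap_form_def nn[symmetric] nn_integral_eq_integral[OF int pos] by simp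
qed

text \<open>Here \<open>s\<close> is the sign of the half-line and \<open>m\<close> the total mass.\<close>

definition scaled_law :: "real \<Rightarrow> real \<Rightarrow> real measure \<Rightarrow> real measure" where
  "scaled_law s m \<pi> = scale_measure (ennreal m) (distr \<pi> borel (\<lambda>u. s * exp u))"

lemma sets_scaled_law [simp, measurable_cong]: "sets (scaled_law s m \<pi>) = sets borel"
  by (simp add: scaled_law_def)

lemma space_scaled_law [simp]: "space (scaled_law s m \<pi>) = UNIV"
  by (simp add: scaled_law_def space_scale_measure)

lemma nn_integral_scaled_law:
  assumes P: "real_distribution \<pi>" and [measurable]: "f \<in> borel_measurable borel"
  shows "(\<integral>\<^sup>+x. f x \<partial>scaled_law s m \<pi>) = ennreal m * (\<integral>\<^sup>+u. f (s * exp u) \<partial>\<pi>)"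
proof -
  interpret real_distribution \<pi> by (rule P)
  show ?thesis unfolding scaled_law_def by (subst nn_integral_scale_measure) (auto simp: nn_integral_distr)
qed

lemma emeasure_scaled_law:
  assumes P: "real_distribution \<pi>" and A: "A \<in> sets borel"
  shows "emeasure (scaled_law s m \<pi>) A = ennreal m * emeasure \<pi> {u. s * exp u \<in> A}"
proof -
  interpret real_distribution \<pi> by (rule P)
  have "(\<lambda>u. s * exp u) \<in> measurable \<pi> borel" by measurable
  then show ?thesis unfolding scaled_law_def using A by (simp add: emeasure_distr vimage_def)
qed

lemma finite_measure_scaled_law:
  assumes P: "real_distribution \<pi>" shows "finite_measure (scaled_law s m \<pi>)"
proof -
  interpret real_distribution \<pi> by (rule P)
  show ?thesis
    using emeasure_space_1 by (intro finite_measureI) (simp add: emeasure_scaled_law[OF P] ennreal_mult_eq_top_iff)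
qed

lemma nn_integral_scaled_law_pair:
  assumes P: "real_distribution P" and Q: "real_distribution Q" and m: "0 \<le> m" "0 \<le> m'"
    and F [measurable]: "F \<in> borel_measurable (borel \<Otimes>\<^sub>M borel)"
  shows "(\<integral>\<^sup>+z. F z \<partial>(scaled_law s m P \<Otimes>\<^sub>M scaled_law s' m' Q)) =
     ennreal (m * m') * (\<integral>\<^sup>+z. F (s * exp (fst z), s' * exp (snd z)) \<partial>(P \<Otimes>\<^sub>M Q))"
proof -
  interpret P: real_distribution P by (rule P)
  interpret Q: real_distribution Q by (rule Q)
  interpret SQ: finite_measure "scaled_law s' m' Q" by (rule finite_measure_scaled_law[OF Q])
  have "(\<integral>\<^sup>+z. F z \<partial>(scaled_law s m P \<Otimes>\<^sub>M scaled_law s' m' Q)) = (\<integral>\<^sup>+x. \<integral>\<^sup>+y. F (x, y) \<partial>scaled_law s' m' Q \<partial>scaled_law s m P)"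
    by (rule SQ.nn_integral_fst[symmetric]) measurable
  also have "\<dots> = (\<integral>\<^sup>+x. ennreal m' * (\<integral>\<^sup>+v. F (x, s' * exp v) \<partial>Q) \<partial>scaled_law s m P)"
    by (subst nn_integral_scaled_law[OF Q]) auto
  also have "\<dots> = ennreal m * (\<integral>\<^sup>+u. ennreal m' * (\<integral>\<^sup>+v. F (s * exp u, s' * exp v) \<partial>Q) \<partial>P)"
    by (subst nn_integral_scaled_law[OF P]) auto
  also have "\<dots> = ennreal (m * m') * (\<integral>\<^sup>+u. \<integral>\<^sup>+v. F (s * exp u, s' * exp v) \<partial>Q \<partial>P)"
    using m by (subst nn_integral_cmult) (auto simp: ennreal_mult mult.assoc)
  also have "(\<integral>\<^sup>+u. \<integral>\<^sup>+v. F (s * exp u, s' * exp v) \<partial>Q \<partial>P) = (\<integral>\<^sup>+z. F (s * exp (fst z), s' * exp (snd z)) \<partial>(P \<Otimes>\<^sub>M Q))"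
    by (subst Q.nn_integral_fst[symmetric]) auto
  finally show ?thesis .
qed

text \<open>The energies are differences of positive and negative parts in the extended reals; wherever the
kernel is integrable in exponential coordinates they reduce to an ordinary integral.\<close>

lemma ereal_integral_scaled_law_pair:
  assumes P: "real_distribution P" and Q: "real_distribution Q" and m: "0 \<le> m" "0 \<le> m'"
    and F [measurable]: "F \<in> borel_measurable (borel \<Otimes>\<^sub>M borel)"
    and k: "integrable (P \<Otimes>\<^sub>M Q) k"
    and ae: "AE z in P \<Otimes>\<^sub>M Q. F (s * exp (fst z), s' * exp (snd z)) = ereal (k z)"
  shows "ereal_integral (scaled_law s m P \<Otimes>\<^sub>M scaled_law s' m' Q) F = ereal (m * m' * (\<integral>z. k z \<partial>(P \<Otimes>\<^sub>M Q)))"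
proof -
  have pos: "(\<integral>\<^sup>+z. e2ennreal (F (s * exp (fst z), s' * exp (snd z))) \<partial>(P \<Otimes>\<^sub>M Q)) = (\<integral>\<^sup>+z. ennreal (k z) \<partial>(P \<Otimes>\<^sub>M Q))"
    by (rule nn_integral_cong_AE) (use ae in eventually_elim, simp add: e2ennreal_ereal)
  have neg: "(\<integral>\<^sup>+z. e2ennreal (- F (s * exp (fst z), s' * exp (snd z))) \<partial>(P \<Otimes>\<^sub>M Q)) = (\<integral>\<^sup>+z. ennreal (- k z) \<partial>(P \<Otimes>\<^sub>M Q))"
    by (rule nn_integral_cong_AE) (use ae in eventually_elim, simp add: e2ennreal_ereal)
  have "(\<integral>\<^sup>+z. ennreal (k z) \<partial>(P \<Otimes>\<^sub>M Q)) \<noteq> \<infinity>" "(\<integral>\<^sup>+z. ennreal (- k z) \<partial>(P \<Otimes>\<^sub>M Q)) \<noteq> \<infinity>"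
    using k unfolding real_integrable_def by blast+
  then obtain a b where ab: "(\<integral>\<^sup>+z. ennreal (k z) \<partial>(P \<Otimes>\<^sub>M Q)) = ennreal a" "0 \<le> a"
      "(\<integral>\<^sup>+z. ennreal (- k z) \<partial>(P \<Otimes>\<^sub>M Q)) = ennreal b" "0 \<le> b"
    by (cases "\<integral>\<^sup>+z. ennreal (k z) \<partial>(P \<Otimes>\<^sub>M Q)"; cases "\<integral>\<^sup>+z. ennreal (- k z) \<partial>(P \<Otimes>\<^sub>M Q)") auto
  have "(\<integral>z. k z \<partial>(P \<Otimes>\<^sub>M Q)) = a - b"
    using ab by (simp add: real_lebesgue_integral_def[OF k])
  moreover have "ereal_integral (scaled_law s m P \<Otimes>\<^sub>M scaled_law s' m' Q) F = enn2ereal (ennreal (m * m') * ennreal a) - enn2ereal (ennreal (m * m') * ennreal b)"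
    unfolding ereal_integral_def
    by (subst (1 2) nn_integral_scaled_law_pair[OF P Q m]) (auto simp: pos neg ab)
  moreover have "\<dots> = ereal (m * m' * (a - b))"
    using ab m by (simp add: ennreal_mult[symmetric] enn2ereal_ennreal algebra_simps)
  ultimately show ?thesis by simp
qed

lemma brownian_kernel:
  assumes P: "finite_energy_law P" and Q: "finite_energy_law Q"
  defines "k \<equiv> \<lambda>z. brownian (fst z) (snd z) - max (fst z) 0 - max (snd z) 0"
  shows brownian_kernel_integrable: "integrable (P \<Otimes>\<^sub>M Q) k"
    and brownian_kernel_integral: "(\<integral>z. k z \<partial>(P \<Otimes>\<^sub>M Q)) = brown_form P Q - plus_moment P - plus_moment Q"
proof -
  interpret P: real_distribution P using P by (rule finite_energy_law_dist)
  interpret Q: real_distribution Q using Q by (rule finite_energy_law_dist)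
  interpret PQ: pair_prob_space P Q ..
  note b = brown_form_integral(2,3)[OF P Q, unfolded case_prod_beta']
  note p = finite_energy_positive_part[OF P] and q = finite_energy_positive_part[OF Q]
  note i = b(1) PQ.integrable_marginal1[OF p] PQ.integrable_marginal2[OF q]
  show "integrable (P \<Otimes>\<^sub>M Q) k" unfolding k_def using i by simp
  show "(\<integral>z. k z \<partial>(P \<Otimes>\<^sub>M Q)) = brown_form P Q - plus_moment P - plus_moment Q"
    unfolding k_def plus_moment_def b(2) using i PQ.integral_marginal1[OF p] PQ.integral_marginal2[OF q] by simp
qed

lemma finite_energy_AE_distinct:
  assumes P: "finite_energy_law P" and Q: "finite_energy_law Q"
  shows "AE z in P \<Otimes>\<^sub>M Q. fst z \<noteq> snd z"
  using kap_form_fourier(2)[OF P Q zero_less_one] P Q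
  by (intro kap_finite_AE_distinct) (auto intro: finite_energy_law_dist)

lemma log_energy_scaled_law:
  assumes P: "finite_energy_law P" and m: "0 \<le> m" and s: "\<bar>s\<bar> = 1"
  shows "log_energy (scaled_law s m P) = ereal (m\<^sup>2 * root_energy 1 P)"
    and "finite_log_energy (scaled_law s m P)"
proof -
  note D = finite_energy_law_dist[OF P]
  interpret P: real_distribution P by (rule D)
  define k where "k z = brownian (fst z) (snd z) - max (fst z) 0 - max (snd z) 0 + kap_real 1 (fst z - snd z)" for z
  have k: "integrable (P \<Otimes>\<^sub>M P) k" unfolding k_def
    by (intro Bochner_Integration.integrable_add brownian_kernel_integrable kap_form_integral P) simp
  have kI: "(\<integral>z. k z \<partial>(P \<Otimes>\<^sub>M P)) = root_energy 1 P" unfolding k_def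
    by (subst Bochner_Integration.integral_add)
       (auto intro!: brownian_kernel_integrable kap_form_integral P simp: brownian_kernel_integral[OF P P] kap_form_integral(2)[OF P P] root_energy_def)
  have ae: "AE z in P \<Otimes>\<^sub>M P. (case (s * exp (fst z), s * exp (snd z)) of (x, y) \<Rightarrow> log_kernel x y) = ereal (k z)"
    using finite_energy_AE_distinct[OF P P] by eventually_elim (simp add: log_kernel_exp s k_def)
  show "log_energy (scaled_law s m P) = ereal (m\<^sup>2 * root_energy 1 P)"
    unfolding log_energy_def mutual_energy_def
    by (subst ereal_integral_scaled_law_pair[OF D D m m _ k ae]) (auto simp: kI power2_eq_square)
  have "(\<integral>\<^sup>+z. e2ennreal \<bar>case z of (x, y) \<Rightarrow> log_kernel x y\<bar> \<partial>(scaled_law s m P \<Otimes>\<^sub>M scaled_law s m P)) =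
      ennreal (m * m) * (\<integral>\<^sup>+z. e2ennreal \<bar>case (s * exp (fst z), s * exp (snd z)) of (x, y) \<Rightarrow> log_kernel x y\<bar> \<partial>(P \<Otimes>\<^sub>M P))"
    by (rule nn_integral_scaled_law_pair[OF D D m m]) measurable
  also have "(\<integral>\<^sup>+z. e2ennreal \<bar>case (s * exp (fst z), s * exp (snd z)) of (x, y) \<Rightarrow> log_kernel x y\<bar> \<partial>(P \<Otimes>\<^sub>M P)) =
      (\<integral>\<^sup>+z. ennreal (norm (k z)) \<partial>(P \<Otimes>\<^sub>M P))"
    by (rule nn_integral_cong_AE) (use ae in eventually_elim, simp add: e2ennreal_ereal)
  also have "ennreal (m * m) * \<dots> < \<infinity>"
    using k by (simp add: integrable_iff_bounded ennreal_mult_less_top)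
  finally show "finite_log_energy (scaled_law s m P)"
    unfolding finite_log_energy_def by (simp add: case_prod_beta')
qed

lemma mutual_energy_scaled_law:
  assumes P: "finite_energy_law P" and Q: "finite_energy_law Q" and m: "0 \<le> m" "0 \<le> m'" and s: "\<bar>s\<bar> = 1"
  shows "mutual_energy (scaled_law s m P) (scaled_law (- s) m' Q) = ereal (m * m' * cross_energy P Q)"
proof -
  note D = finite_energy_law_dist[OF P] finite_energy_law_dist[OF Q]
  interpret P: real_distribution P by (rule D)
  interpret Q: real_distribution Q by (rule D)
  define k where "k z = brownian (fst z) (snd z) - max (fst z) 0 - max (snd z) 0 + (kap_real (1/2) (fst z - snd z) - kap_real 1 (fst z - snd z))" for z
  note i = brownian_kernel_integrable[OF P Q] kap_form_integral[OF P Q, of "1/2", simplified] kap_form_integral[OF P Q, of 1, simplified]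
  have k: "integrable (P \<Otimes>\<^sub>M Q) k" unfolding k_def
    by (intro Bochner_Integration.integrable_add Bochner_Integration.integrable_diff i)
  have kI: "(\<integral>z. k z \<partial>(P \<Otimes>\<^sub>M Q)) = cross_energy P Q" unfolding k_def
    using i by (subst Bochner_Integration.integral_add) (simp_all add: brownian_kernel_integral[OF P Q] cross_energy_def)
  have ae: "AE z in P \<Otimes>\<^sub>M Q. (case (s * exp (fst z), - s * exp (snd z)) of (x, y) \<Rightarrow> log_kernel x y) = ereal (k z)"
    using finite_energy_AE_distinct[OF P Q]
  proof eventually_elim
    case (elim z)
    from log_kernel_exp_opposite[OF elim s] show ?case by (simp add: k_def)
  qed
  show ?thesis
    unfolding mutual_energy_def
    by (subst ereal_integral_scaled_law_pair[OF D m _ k ae]) (auto simp: kI)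
qed

text \<open>The law of \<open>ln \<bar>x\<bar>\<close> under the normalized measure.\<close>

lemma log_law_exists:
  assumes M: "sets M = sets borel" and mass: "emeasure M UNIV = ennreal m" and m: "m > 0" and s: "\<bar>s\<bar> = 1"
    and side: "AE x in M. s * x > 0"
  shows "\<exists>\<pi>. real_distribution \<pi> \<and> M = scaled_law s m \<pi>"
proof (intro exI conjI)
  note [measurable_cong] = M
  have spM: "space M = UNIV" using sets_eq_imp_space_eq[OF M] by simp
  let ?S = "scale_measure (ennreal (1 / m)) M"
  let ?\<pi> = "distr ?S borel (\<lambda>x. ln (s * x))"
  have meas: "(\<lambda>x. ln (s * x)) \<in> measurable ?S borel" by measurable
  have "emeasure ?S UNIV = 1" using m by (simp add: mass ennreal_mult[symmetric])
  then have "prob_space ?S" by (intro prob_spaceI) (simp add: spM space_scale_measure)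
  then show P: "real_distribution ?\<pi>"
    unfolding real_distribution_def real_distribution_axioms_def by (auto intro!: prob_space.prob_space_distr meas)
  show "M = scaled_law s m ?\<pi>"
  proof (rule measure_eqI)
    fix A assume "A \<in> sets M"
    then have [measurable]: "A \<in> sets borel" using M by simp
    have ss: "s * (s * x) = x" for x using s by (metis abs_mult_self_eq mult.assoc mult_1)
    have "emeasure (scaled_law s m ?\<pi>) A = ennreal m * emeasure ?\<pi> {u. s * exp u \<in> A}"
      by (rule emeasure_scaled_law[OF P]) measurable
    also have "emeasure ?\<pi> {u. s * exp u \<in> A} = ennreal (1 / m) * emeasure M {x. s * exp (ln (s * x)) \<in> A}"
      by (subst emeasure_distr[OF meas]) (auto simp: spM vimage_def space_scale_measure)
    also have "ennreal m * \<dots> = emeasure M {x. s * exp (ln (s * x)) \<in> A}"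
      using m by (simp add: mult.assoc[symmetric] ennreal_mult[symmetric])
    also have "\<dots> = emeasure M A"
    proof (rule emeasure_eq_AE)
      show "AE x in M. x \<in> {x. s * exp (ln (s * x)) \<in> A} \<longleftrightarrow> x \<in> A"
        using side by eventually_elim (simp add: ss)
      show "{x. s * exp (ln (s * x)) \<in> A} \<in> sets M" unfolding M by measurable
    qed (simp add: M)
    finally show "emeasure M A = emeasure (scaled_law s m ?\<pi>) A" ..
  qed (simp add: M)
qed

text \<open>The complement of the support is a union of open null sets, of which countably many suffice by
Lindelof's theorem.\<close>

lemma support_null:
  assumes M: "sets M = sets borel" and S: "closed S" "measure_support M \<subseteq> S"
  shows "emeasure M (- S) = 0"
proof -
  obtain F where F: "F \<subseteq> {U. open U \<and> emeasure M U = 0}" "countable F" "\<Union>F = \<Union>{U. open U \<and> emeasure M U = 0}"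
    using Lindelof[of "{U. open U \<and> emeasure M U = 0}"] by auto
  have "\<Union>F \<in> null_sets M"
    using F(1,2) M by (intro null_sets_UN'[of F "\<lambda>x. x", simplified]) (auto simp: null_sets_def)
  moreover have "- S \<subseteq> \<Union>F"
    using S(2) unfolding F(3) measure_support_def by (auto simp: zero_less_iff_neq_zero)
  ultimately show ?thesis using S(1) M by (metis (no_types, lifting) borel_open emeasure_eq_0 null_setsD1 null_setsD2 open_Compl)
qed

lemma support_subset_closed:
  assumes S: "closed S" "emeasure M (- S) = 0"
  shows "measure_support M \<subseteq> S"
  using S unfolding measure_support_def by (auto simp: open_Compl)

text \<open>An atom at \<open>x\<close> would charge the point \<open>(x, x)\<close> of the product, where the kernel is infinite.\<close>

lemma no_atom_of_finite_pair_integral: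
  fixes M :: "real measure"
  assumes M: "sets M = sets borel" "finite_measure M"
    and F_meas: "F \<in> borel_measurable (borel \<Otimes>\<^sub>M borel)"
    and fin: "(\<integral>\<^sup>+z. F z \<partial>(M \<Otimes>\<^sub>M M)) < \<infinity>" and F: "F (x, x) = (\<infinity>::ennreal)"
  shows "emeasure M {x} = 0"
proof -
  interpret finite_measure M by (rule M)
  have "sets (M \<Otimes>\<^sub>M M) = sets (borel \<Otimes>\<^sub>M borel)" by (intro sets_pair_measure_cong M)
  then have meas: "F \<in> borel_measurable (M \<Otimes>\<^sub>M M)"
    using F_meas measurable_cong_sets by blast
  have "AE z in M \<Otimes>\<^sub>M M. F z \<noteq> \<infinity>"
    using fin by (intro nn_integral_PInf_AE meas) auto
  then have "AE z in M \<Otimes>\<^sub>M M. z \<notin> {x} \<times> {x}"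
    by (rule eventually_mono) (use F in auto)
  moreover have "{x} \<times> {x} \<in> sets (M \<Otimes>\<^sub>M M)" using M(1) by (intro pair_measureI) auto
  ultimately have "emeasure (M \<Otimes>\<^sub>M M) ({x} \<times> {x}) = 0"
    using AE_iff_null_sets null_setsD1 by blast
  moreover have "emeasure (M \<Otimes>\<^sub>M M) ({x} \<times> {x}) = emeasure M {x} * emeasure M {x}"
    using M(1) by (intro emeasure_pair_measure_Times) auto
  ultimately show ?thesis by simp
qed

lemma finite_log_energy_no_atom:
  assumes M: "sets M = sets borel" "finite_measure M" and fin: "finite_log_energy M"
  shows "emeasure M {x} = 0"
  by (rule no_atom_of_finite_pair_integral[OF M _ fin[unfolded finite_log_energy_def]]) (auto simp: log_kernel_def[of x x])

text \<open>Absolute convergence of the double integral controls the two nonnegative parts of the kernel only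
together with the external field. So the positive part is integrated first: for almost every \<open>u0\<close> the kernel is
integrable in \<open>v\<close>, and for \<open>v\<close> beyond \<open>u0 + ln 2\<close> the point \<open>exp v\<close> is so much larger
than \<open>exp u0\<close> that the kernel itself bounds \<open>v\<close>. Adding the external field back then leaves a
sum of nonnegative terms with finite integral.\<close>

lemma finite_energy_law_of_scaled:
  assumes P: "real_distribution P" and m: "m > 0" and s: "\<bar>s\<bar> = 1" and fin: "finite_log_energy (scaled_law s m P)"
  shows "finite_energy_law P"
proof -
  interpret P: real_distribution P by (rule P)
  interpret PP: pair_prob_space P P ..
  define L where "L u v = e2ennreal \<bar>log_kernel (s * exp u) (s * exp v)\<bar>" for u v
  have [measurable]: "case_prod L \<in> borel_measurable (P \<Otimes>\<^sub>M P)" unfolding L_def by measurable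
  have "ennreal (m * m) * (\<integral>\<^sup>+z. L (fst z) (snd z) \<partial>(P \<Otimes>\<^sub>M P)) = 
     (\<integral>\<^sup>+z. e2ennreal \<bar>case z of (x, y) \<Rightarrow> log_kernel x y\<bar> \<partial>(scaled_law s m P \<Otimes>\<^sub>M scaled_law s m P))"
    using m by (subst nn_integral_scaled_law_pair[OF P P]) (auto simp: L_def)
  also have "\<dots> < \<infinity>" using fin unfolding finite_log_energy_def by (simp add: case_prod_beta')
  finally have Lpair: "(\<integral>\<^sup>+z. L (fst z) (snd z) \<partial>(P \<Otimes>\<^sub>M P)) < \<infinity>"
    using m by (auto simp: ennreal_mult_less_top)
  have Ldouble: "(\<integral>\<^sup>+u. \<integral>\<^sup>+v. L u v \<partial>P \<partial>P) < \<infinity>"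
    using Lpair by (subst (asm) P.nn_integral_fst[symmetric]) (auto simp: case_prod_beta')
  have L: "L u v = ennreal \<bar>brownian u v - max u 0 - max v 0 + kap_real 1 (u - v)\<bar>" if "u \<noteq> v" for u v
    unfolding L_def log_kernel_exp[OF that s] by (simp add: e2ennreal_ereal)
  have Ldiag: "L u u = \<infinity>" for u by (simp add: L_def log_kernel_def)
  have "(AE u in P. (\<integral>\<^sup>+v. L u v \<partial>P) \<noteq> \<infinity>)"
    using Ldouble by (intro nn_integral_PInf_AE) auto
  then obtain u0 where u0: "(\<integral>\<^sup>+v. L u0 v \<partial>P) \<noteq> \<infinity>"
    using eventually_happens'[OF P.ae_filter_bot] by blast
  have plus_bound: "ennreal (max v 0) \<le> L u0 v + ennreal (ln 2 + max u0 0)" for v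
  proof (cases "v \<le> u0 + ln 2")
    case True
    then have "max v 0 \<le> ln 2 + max u0 0" by auto
    then show ?thesis by (intro add_increasing[OF _ ennreal_leI]) auto
  next
    case False
    then have vu: "v > u0" "v \<noteq> u0" by (auto intro: less_trans[of _ "u0 + ln 2"])
    have "exp (u0 + ln 2) \<le> exp v" using False by simp
    then have "2 * exp u0 \<le> exp v" by (simp add: exp_add mult.commute)
    \<comment> \<open>The distance of the two points is at least half of the larger one.\<close>
    then have half: "exp v / 2 \<le> exp v - exp u0" by simp
    have "v - ln 2 = ln (exp v / 2)" by (simp add: ln_div)
    also have "\<dots> \<le> ln (exp v - exp u0)" using half vu by (subst ln_le_cancel_iff) auto
    also have "\<dots> = - ln (1 / \<bar>exp u0 - exp v\<bar>)" using vu by (simp add: ln_div)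
    also have "\<dots> \<le> \<bar>brownian u0 v - max u0 0 - max v 0 + kap_real 1 (u0 - v)\<bar>"
      unfolding ln_exp_diff[OF vu(2)[symmetric]] by simp
    finally have "max v 0 \<le> \<bar>brownian u0 v - max u0 0 - max v 0 + kap_real 1 (u0 - v)\<bar> + (ln 2 + max u0 0)"
      by (auto simp: max_def)
    then have "ennreal (max v 0) \<le> ennreal (\<bar>brownian u0 v - max u0 0 - max v 0 + kap_real 1 (u0 - v)\<bar> + (ln 2 + max u0 0))"
      by (rule ennreal_leI)
    also have "\<dots> = L u0 v + ennreal (ln 2 + max u0 0)"
      unfolding L[OF vu(2)[symmetric]] by (rule ennreal_plus) auto
    finally show ?thesis .
  qed
  have "(\<integral>\<^sup>+v. ennreal (max v 0) \<partial>P) \<le> (\<integral>\<^sup>+v. L u0 v + ennreal (ln 2 + max u0 0) \<partial>P)"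
    by (intro nn_integral_mono plus_bound)
  also have "\<dots> = (\<integral>\<^sup>+v. L u0 v \<partial>P) + ennreal (ln 2 + max u0 0)"
    by (subst nn_integral_add) (auto simp: P.emeasure_space_1[simplified])
  also have "\<dots> < \<infinity>" using u0 by (auto simp: less_top)
  finally have 1: "(\<integral>\<^sup>+v. ennreal (max v 0) \<partial>P) < \<infinity>" .
  have pw: "ennreal (brownian u v) + kap 1 (u - v) \<le> L u v + (ennreal (max u 0) + ennreal (max v 0))" for u v
  proof (cases "u = v")
    case True then show ?thesis by (simp add: Ldiag)
  next
    case False
    have k: "kap_real 1 (u - v) \<ge> 0" using False by (intro kap_real_nonneg) auto
    have "brownian u v + kap_real 1 (u - v) \<le> \<bar>brownian u v - max u 0 - max v 0 + kap_real 1 (u - v)\<bar> + (max u 0 + max v 0)" by arith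
    then have "ennreal (brownian u v + kap_real 1 (u - v)) \<le> ennreal (\<bar>brownian u v - max u 0 - max v 0 + kap_real 1 (u - v)\<bar> + (max u 0 + max v 0))"
      by (rule ennreal_leI)
    then show ?thesis using k brownian_nonneg[of u v] False
      unfolding L[OF False] by (subst kap_eq_kap_real) (auto simp: ennreal_plus[symmetric] simp del: ennreal_plus ennreal_max_0')
  qed
  have "(\<integral>\<^sup>+u. \<integral>\<^sup>+v. ennreal (brownian u v) + kap 1 (u - v) \<partial>P \<partial>P) \<le> (\<integral>\<^sup>+u. \<integral>\<^sup>+v. L u v + (ennreal (max u 0) + ennreal (max v 0)) \<partial>P \<partial>P)"
    by (intro nn_integral_mono pw)
  also have "\<dots> = (\<integral>\<^sup>+u. \<integral>\<^sup>+v. L u v \<partial>P \<partial>P) + ((\<integral>\<^sup>+u. ennreal (max u 0) \<partial>P) + (\<integral>\<^sup>+u. ennreal (max u 0) \<partial>P))"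
    by (simp add: nn_integral_add P.emeasure_space_1[simplified])
  also have "\<dots> < \<infinity>" using 1 Ldouble by simp
  finally have s: "(\<integral>\<^sup>+u. \<integral>\<^sup>+v. ennreal (brownian u v) + kap 1 (u - v) \<partial>P \<partial>P) < \<infinity>" .
  have "(\<integral>\<^sup>+u. \<integral>\<^sup>+v. ennreal (brownian u v) + kap 1 (u - v) \<partial>P \<partial>P) = brownian_energy P P + (kap_energy 1 P P)"
    unfolding brownian_energy_def nn_integral_diff_law[OF P P measurable_kap] by (simp add: nn_integral_add)
  with s have "brownian_energy P P < \<infinity>" "kap_energy 1 P P < \<infinity>" by auto
  with 1 P show ?thesis by (simp add: finite_energy_law_def)
qed

section \<open>Semicontinuity and strict positivity\<close>

text \<open>As a map into the extended reals the kernel is continuous also on the diagonal.\<close>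

lemma tendsto_log_kernel:
  assumes f: "(f \<longlongrightarrow> a) F" and g: "(g \<longlongrightarrow> b) F"
  shows "((\<lambda>n. log_kernel (f n) (g n)) \<longlongrightarrow> log_kernel a b) F"
proof (cases "a = b")
  case False
  have d: "((\<lambda>n. f n - g n) \<longlongrightarrow> a - b) F" by (intro tendsto_intros f g)
  have ne: "\<forall>\<^sub>F n in F. f n - g n \<noteq> 0" using False by (intro tendsto_imp_eventually_ne[OF d]) simp
  have "((\<lambda>n. ereal (ln (1 / \<bar>f n - g n\<bar>))) \<longlongrightarrow> ereal (ln (1 / \<bar>a - b\<bar>))) F"
    using False by (intro tendsto_intros d) auto
  moreover have "\<forall>\<^sub>F n in F. ereal (ln (1 / \<bar>f n - g n\<bar>)) = log_kernel (f n) (g n)"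
    using ne by eventually_elim (simp add: log_kernel_def)
  ultimately have "((\<lambda>n. log_kernel (f n) (g n)) \<longlongrightarrow> ereal (ln (1 / \<bar>a - b\<bar>))) F"
    by (rule Lim_transform_eventually)
  then show ?thesis using False by (simp add: log_kernel_def)
next
  case True
  have d: "((\<lambda>n. \<bar>f n - g n\<bar>) \<longlongrightarrow> 0) F" using tendsto_rabs[OF tendsto_diff[OF f g]] True by simp
  show ?thesis unfolding True
  proof (simp add: log_kernel_def[of b b] tendsto_PInfty, intro allI)
    fix r
    have "\<forall>\<^sub>F n in F. \<bar>f n - g n\<bar> < exp (- r)" using d by (rule order_tendstoD) simp
    then show "\<forall>\<^sub>F n in F. ereal r < log_kernel (f n) (g n)"
    proof eventually_elim
      case (elim n)
      show ?case
      proof (cases "f n = g n")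
        case False
        then have "ln \<bar>f n - g n\<bar> < ln (exp (- r))" using elim by (subst ln_less_cancel_iff) auto
        then show ?thesis using False by (simp add: log_kernel_def ln_div)
      qed (simp add: log_kernel_def)
    qed
  qed
qed

text \<open>For \<open>a, b \<ge> 1\<close> the larger of the two is at most the product, so the distance of two points
grows at most like a product of functions of one variable.\<close>

lemma log_kernel_root_bound:
  assumes "n \<ge> (1::nat)" "x \<ge> 0" "y \<ge> 0"
  shows "ereal (- (ln (max x 1) + ln (max y 1)) / real n) \<le> log_kernel (root n x) (root n y)"
proof (cases "x = y")
  case True then show ?thesis by (simp add: log_kernel_def)
next
  case False
  have ne: "root n x \<noteq> root n y" using False assms by simp
  have "\<bar>root n x - root n y\<bar> \<le> max (root n x) (root n y)" using assms by (auto simp: abs_if max_def)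
  also have "\<dots> \<le> root n (max x 1) * root n (max y 1)"
  proof -
    have 1: "1 \<le> root n (max x 1)" "1 \<le> root n (max y 1)" using assms by auto
    have 2: "root n x \<le> root n (max x 1)" "root n y \<le> root n (max y 1)" using assms by auto
    have "root n (max x 1) * 1 \<le> root n (max x 1) * root n (max y 1)" using 1 by (intro mult_left_mono) auto
    moreover have "1 * root n (max y 1) \<le> root n (max x 1) * root n (max y 1)" using 1 by (intro mult_right_mono) auto
    ultimately show ?thesis using 2 by auto
  qed
  finally have "ln \<bar>root n x - root n y\<bar> \<le> ln (root n (max x 1) * root n (max y 1))"
    using ne assms by (subst ln_le_cancel_iff) (auto intro!: mult_pos_pos)
  also have "\<dots> = ln (max x 1) / real n + ln (max y 1) / real n"
  proof -
    have "max x 1 > 0" "max y 1 > 0" by (simp_all add: less_max_iff_disj)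
    moreover from this have "root n (max x 1) > 0" "root n (max y 1) > 0" using assms by simp_all
    ultimately show ?thesis using assms by (simp add: ln_mult_pos ln_root)
  qed
  finally have "- (ln (max x 1) + ln (max y 1)) / real n \<le> ln (1 / \<bar>root n x - root n y\<bar>)"
    using ne by (simp add: ln_div add_divide_distrib diff_divide_distrib)
  then show ?thesis using ne by (simp add: log_kernel_def)
qed

text \<open>A kernel bounded from below is turned into a nonnegative one; for probability measures this changes its
integral by a constant.\<close>

lemma ereal_integral_shift:
  assumes Q: "prob_space Q" and [measurable]: "G \<in> borel_measurable Q" and ae: "AE z in Q. F z = G z"
    and low: "AE z in Q. ereal (- d) \<le> G z" and d: "d \<ge> 0"
  shows "ereal_integral Q F = enn2ereal (\<integral>\<^sup>+z. e2ennreal (G z + ereal d) \<partial>Q) - ereal d"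
proof -
  interpret prob_space Q by (rule Q)
  let ?p = "\<integral>\<^sup>+z. e2ennreal (G z) \<partial>Q" and ?n = "\<integral>\<^sup>+z. e2ennreal (- G z) \<partial>Q" and ?I = "\<integral>\<^sup>+z. e2ennreal (G z + ereal d) \<partial>Q"
  have p: "(\<integral>\<^sup>+z. e2ennreal (F z) \<partial>Q) = ?p" and n: "(\<integral>\<^sup>+z. e2ennreal (- F z) \<partial>Q) = ?n"
    by (rule nn_integral_cong_AE; use ae in eventually_elim; simp)+
  have nd: "?n \<le> ennreal d"
  proof -
    have "?n \<le> (\<integral>\<^sup>+z. ennreal d \<partial>Q)"
    proof (rule nn_integral_mono_AE, use low in eventually_elim)
      fix z assume "ereal (- d) \<le> G z"
      then have "- G z \<le> ereal d" by (cases "G z") auto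
      then show "e2ennreal (- G z) \<le> ennreal d" using e2ennreal_mono[of "- G z" "ereal d"] by (simp add: e2ennreal_ereal)
    qed
    then show ?thesis by (simp add: emeasure_space_1)
  qed
  have "?I + ?n = (\<integral>\<^sup>+z. e2ennreal (G z + ereal d) + e2ennreal (- G z) \<partial>Q)"
    by (rule nn_integral_add[symmetric]) auto
  also have "\<dots> = (\<integral>\<^sup>+z. e2ennreal (G z) + ennreal d \<partial>Q)"
  proof (rule nn_integral_cong_AE, use low in eventually_elim)
    fix z assume l: "ereal (- d) \<le> G z"
    show "e2ennreal (G z + ereal d) + e2ennreal (- G z) = e2ennreal (G z) + ennreal d"
    proof (cases "G z")
      case (real g)
      then have "- d \<le> g" using l by simp
      then show ?thesis using real d by (cases "g \<ge> 0") (auto simp: e2ennreal_ereal ennreal_neg simp flip: ennreal_plus)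
    qed (use l in \<open>auto simp: e2ennreal_infty e2ennreal_neg\<close>)
  qed
  also have "\<dots> = ?p + ennreal d" by (subst nn_integral_add) (auto simp: emeasure_space_1)
  finally have eq: "?I + ?n = ?p + ennreal d" .
  obtain n' where n': "?n = ennreal n'" "n' \<ge> 0" using nd by (cases ?n) (auto simp: top_unique)
  show ?thesis
  proof (cases ?p)
    case (real p')
    then have "?I \<noteq> \<infinity>" using eq real d by (auto simp: ennreal_plus[symmetric] simp del: ennreal_plus)
    then obtain I' where I': "?I = ennreal I'" "I' \<ge> 0" by (cases ?I) auto
    have "I' + n' = p' + d" using eq real I' n' d by (simp flip: ennreal_plus)
    then show ?thesis unfolding ereal_integral_def p n using real I' n' by (simp add: enn2ereal_ennreal)
  next
    case top
    then have "?I = top" using eq n' by (auto simp: ennreal_add_eq_top)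
    then show ?thesis unfolding ereal_integral_def p n using top n' by (simp add: enn2ereal_ennreal)
  qed
qed

text \<open>The Fourier transform of \<open>kap a\<close> is strictly positive, so the form is strictly positive
definite: it vanishes on a difference of laws only if the characteristic functions agree.\<close>

lemma kap_form_parallelogram:
  assumes P: "real_distribution P" and Q: "real_distribution Q" and a: "a > 0"
    and finP: "kap_energy a P P < \<infinity>" and finQ: "kap_energy a Q Q < \<infinity>"
  shows "kap_energy a P Q < \<infinity>"
    and "2 * kap_form a P Q \<le> kap_form a P P + kap_form a Q Q"
    and "2 * kap_form a P Q = kap_form a P P + kap_form a Q Q \<Longrightarrow> P = Q"
proof -
  interpret P: real_distribution P by (rule P)
  interpret Q: real_distribution Q by (rule Q)
  note PQ = kap_energy_mixed[OF P Q a finP finQ] and PP = kap_energy_mixed[OF P P a finP finP] and QQ = kap_energy_mixed[OF Q Q a finQ finQ]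
  show "kap_energy a P Q < \<infinity>" unfolding PQ(2) by simp
  define h where "h \<xi> = kap_hat a \<xi> * (cmod (char Q \<xi> - char P \<xi>))\<^sup>2" for \<xi>
  have h: "h \<xi> = kap_hat a \<xi> * Re (char Q \<xi> * cnj (char Q \<xi>)) - 2 * (kap_hat a \<xi> * Re (char P \<xi> * cnj (char Q \<xi>))) + kap_hat a \<xi> * Re (char P \<xi> * cnj (char P \<xi>))" for \<xi>
    unfolding h_def cmod_diff_squared by (simp only: algebra_simps)
  note i2 = integrable_mult_right[OF PQ(1), of 2]
  have h_int: "integrable lborel h"
    unfolding h[abs_def] by (intro Bochner_Integration.integrable_add Bochner_Integration.integrable_diff i2 PP(1) QQ(1))
  have forms: "kap_form a P Q = (\<integral>\<xi>. kap_hat a \<xi> * Re (char P \<xi> * cnj (char Q \<xi>)) \<partial>lborel)"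
     "kap_form a P P = (\<integral>\<xi>. kap_hat a \<xi> * Re (char P \<xi> * cnj (char P \<xi>)) \<partial>lborel)"
     "kap_form a Q Q = (\<integral>\<xi>. kap_hat a \<xi> * Re (char Q \<xi> * cnj (char Q \<xi>)) \<partial>lborel)"
    unfolding kap_form_def PQ(2) PP(2) QQ(2) using PQ(3) PP(3) QQ(3) by (simp_all only: enn2real_ennreal)
  have I: "(\<integral>\<xi>. h \<xi> \<partial>lborel) = kap_form a Q Q - 2 * kap_form a P Q + kap_form a P P"
    unfolding h[abs_def] forms
    by (subst Bochner_Integration.integral_add[OF Bochner_Integration.integrable_diff[OF QQ(1) i2] PP(1)],
        subst Bochner_Integration.integral_diff[OF QQ(1) i2], subst integral_mult_right_zero, rule refl)
  have pos: "AE \<xi> in lborel. 0 \<le> h \<xi>" by (intro AE_I2) (simp add: h_def kap_hat_nonneg a)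
  show "2 * kap_form a P Q \<le> kap_form a P P + kap_form a Q Q"
    using integral_nonneg_AE[OF pos] I by simp
  assume "2 * kap_form a P Q = kap_form a P P + kap_form a Q Q"
  then have "(\<integral>\<xi>. h \<xi> \<partial>lborel) = 0" using I by simp
  then have "AE \<xi> in lborel. h \<xi> = 0" using integral_nonneg_eq_0_iff_AE[OF h_int pos] by simp
  then have ae: "AE \<xi> in lborel. char Q \<xi> - char P \<xi> = 0"
  proof eventually_elim
    case (elim \<xi>)
    then show ?case using kap_hat_pos[OF a, of \<xi>] by (simp add: h_def)
  qed
  have "continuous_on UNIV (\<lambda>\<xi>. char Q \<xi> - char P \<xi>)"
    using P.isCont_char Q.isCont_char by (intro continuous_intros continuous_at_imp_continuous_on ballI) auto
  from continuous_AE_eq_0[OF this ae] have "char P = char Q" by (auto simp: fun_eq_iff)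
  then show "P = Q" by (intro Levy_uniqueness) unfold_locales
qed

lemma half_log_square: "ln (max x 1) \<le> ln (1 + x\<^sup>2) / 2" if "x \<ge> (0::real)"
proof (cases "x \<ge> 1")
  case True
  have "2 * ln x = ln (x\<^sup>2)" using True by (simp add: ln_realpow)
  also have "\<dots> \<le> ln (1 + x\<^sup>2)" using True by (subst ln_le_cancel_iff) (auto intro: add_pos_nonneg)
  finally show ?thesis using True by simp
next
  case False
  then show ?thesis using that by (simp add: max_def)
qed

lemma prob_on_halflineD:
  assumes "prob_on_halfline M"
  shows "real_distribution M" "AE x in M. 0 \<le> x" "sets M = sets borel" "prob_space M" "space M = UNIV"
proof -
  show s: "sets M = sets borel" "prob_space M" using assms by (auto simp: prob_on_halfline_def)
  show sp: "space M = UNIV" using sets_eq_imp_space_eq[OF s(1)] by simp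
  interpret prob_space M by (rule s)
  show "real_distribution M" using s sp by unfold_locales auto
  have "AE x in M. x \<in> {0..}"
    using assms s by (intro AE_prob_1) (auto simp: prob_on_halfline_def measure_def)
  then show "AE x in M. 0 \<le> x" by simp
qed

lemma prob_on_halflineI:
  assumes "real_distribution M" "AE x in M. 0 \<le> x"
  shows "prob_on_halfline M"
proof -
  interpret real_distribution M by fact
  have "prob {0..} = 1" using assms(2) by (subst prob_eq_1) auto
  then show ?thesis using prob_space_axioms by (auto simp: prob_on_halfline_def emeasure_eq_measure)
qed

lemma AE_pair_halfline:
  assumes M: "prob_on_halfline M"
  shows "AE z in M \<Otimes>\<^sub>M M. 0 \<le> fst z \<and> 0 \<le> snd z"
proof -
  note D = prob_on_halflineD[OF M]
  interpret real_distribution M by (rule D)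
  interpret MM: pair_prob_space M M ..
  have "AE x in M. AE y in M. 0 \<le> x \<and> 0 \<le> y"
    using D(2)
  proof eventually_elim
    case (elim x)
    show ?case using D(2) by eventually_elim (use elim in simp)
  qed
  moreover have "{z \<in> space (M \<Otimes>\<^sub>M M). 0 \<le> fst z \<and> 0 \<le> snd z} \<in> sets (M \<Otimes>\<^sub>M M)" by measurable
  ultimately show ?thesis by (intro MM.AE_pair_measure) auto
qed

lemma prob_on_halfline_scaled_law:
  assumes P: "real_distribution P" shows "prob_on_halfline (scaled_law 1 1 P)"
proof -
  interpret real_distribution P by (rule P)
  have "emeasure (scaled_law 1 1 P) A = 1" if "\<And>u::real. exp u \<in> A" "A \<in> sets borel" for A
    using that emeasure_space_1 by (simp add: emeasure_scaled_law[OF P])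
  from this[of UNIV] this[of "{0..}"] show ?thesis
    by (auto simp: prob_on_halfline_def intro!: prob_spaceI)
qed

section \<open>The scalar problem\<close>

locale external_field =
  fixes q r :: nat and Vh :: "real \<Rightarrow> real"
  assumes q: "q \<ge> 1" and r: "r \<ge> 1"
    and cont: "continuous_on {0..} Vh"
    and growth: "filterlim (\<lambda>x. Vh x - ln (1 + x\<^sup>2)) at_top at_top"
begin

definition \<theta> :: real where "\<theta> = (1 / real q + 1 / real r) / 2"

text \<open>The potential, extended by a constant so that it is continuous on the whole line.\<close>

definition V :: "real \<Rightarrow> real" where "V x = Vh (max x 0)"

text \<open>Half of the potential minus the growth \<open>\<theta> ln x\<close> of the logarithmic kernel in one of its variables;
the kernel of the scalar problem dominates \<open>confine x + confine y\<close>.\<close>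

definition confine :: "real \<Rightarrow> real" where "confine x = V x / 2 - \<theta> * ln (max x 1)"

lemma theta: "0 < \<theta>" "\<theta> \<le> 1"
proof -
  have "1 / real q \<le> 1" "1 / real r \<le> 1" "1 / real q > 0" "1 / real r > 0" using q r by auto
  note bounds = this
  show "0 < \<theta>" unfolding \<theta>_def by (intro half_gt_zero add_pos_pos bounds)
  have "\<theta> \<le> (1 + 1) / 2" unfolding \<theta>_def by (intro divide_right_mono add_mono bounds) simp
  then show "\<theta> \<le> 1" by simp
qed

lemma continuous_V: "continuous_on UNIV V"
  unfolding V_def by (rule continuous_on_compose2[OF cont]) (auto intro!: continuous_intros)

lemma continuous_confine: "continuous_on UNIV confine"
  unfolding confine_def by (intro continuous_intros continuous_V) (auto simp: max_def)

lemma measurable_V [measurable]: "V \<in> borel_measurable borel"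
  using continuous_V by (rule borel_measurable_continuous_onI)

lemma measurable_confine [measurable]: "confine \<in> borel_measurable borel"
  using continuous_confine by (rule borel_measurable_continuous_onI)

text \<open>Since \<open>\<theta> \<le> 1\<close> and \<open>ln x \<le> ln (1 + x\<^sup>2) / 2\<close> for \<open>x \<ge> 1\<close>, the growth assumption on the
potential is what is needed.\<close>

lemma confine_at_top: "filterlim confine at_top at_top"
proof (rule filterlim_at_top_mono)
  show "filterlim (\<lambda>x. (1/2) * (Vh x - ln (1 + x\<^sup>2))) at_top at_top"
    by (rule filterlim_tendsto_pos_mult_at_top[OF tendsto_const _ growth]) simp
  show "\<forall>\<^sub>F x in at_top. (1/2) * (Vh x - ln (1 + x\<^sup>2)) \<le> confine x"
    using eventually_ge_at_top[of 1]
  proof eventually_elim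
    case (elim x)
    have "\<theta> * ln (max x 1) \<le> 1 * ln (max x 1)" using theta elim by (intro mult_right_mono) auto
    also have "\<dots> \<le> ln (1 + x\<^sup>2) / 2" using half_log_square[of x] elim by simp
    finally show ?case using elim by (simp add: confine_def V_def)
  qed
qed

lemma confine_bounded_below: "\<exists>c\<ge>0. \<forall>x. 0 \<le> confine x + c"
proof -
  obtain R where R: "\<And>x. x \<ge> R \<Longrightarrow> confine x \<ge> 0"
    using confine_at_top unfolding filterlim_at_top eventually_at_top_linorder by blast
  have "compact (confine ` {0..max R 0})"
    using continuous_confine by (intro compact_continuous_image) (auto intro: continuous_on_subset)
  then obtain B where B: "\<And>x. 0 \<le> x \<Longrightarrow> x \<le> max R 0 \<Longrightarrow> \<bar>confine x\<bar> \<le> B"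
    using compact_imp_bounded bounded_iff by (metis (no_types, lifting) atLeastAtMost_iff image_eqI real_norm_def)
  have neg: "confine x = confine 0" if "x \<le> 0" for x using that by (simp add: confine_def V_def)
  have "0 \<le> confine x + \<bar>B\<bar>" for x
  proof -
    consider "x \<le> 0" | "0 \<le> x" "x \<le> max R 0" | "x \<ge> R" by linarith
    then show ?thesis
    proof cases
      case 1 then show ?thesis using B[of 0] neg[of x] by simp
    next
      case 2 then show ?thesis using B[of x] by simp
    next
      case 3 then show ?thesis using R[of x] by simp
    qed
  qed
  then show ?thesis by (intro exI[of _ "\<bar>B\<bar>"]) auto
qed

text \<open>Any constant that makes \<open>confine\<close> nonnegative. After raising the kernel by \<open>2 * shift\<close> the energies
take values in the extended nonnegative reals, where sums, limits and Fubini's theorem need no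
integrability conditions.\<close>

definition shift :: real where "shift = (SOME c. c \<ge> 0 \<and> (\<forall>x. 0 \<le> confine x + c))"

lemma shift: "shift \<ge> 0" "0 \<le> confine x + shift"
  using someI_ex[OF confine_bounded_below, folded shift_def] by auto

definition raised :: "real \<Rightarrow> real" where "raised x = confine x + shift"

lemma raised_nonneg: "raised x \<ge> 0" by (simp add: raised_def shift)

lemma measurable_raised [measurable]: "raised \<in> borel_measurable borel"
  unfolding raised_def[abs_def] by measurable

definition field_kernel :: "real \<Rightarrow> real \<Rightarrow> ereal" where
  "field_kernel x y = log_kernel (root q x) (root q y) / 2 + log_kernel (root r x) (root r y) / 2 + ereal (V x / 2) + ereal (V y / 2)"

definition raised_kernel :: "real \<Rightarrow> real \<Rightarrow> ennreal" where
  "raised_kernel x y = e2ennreal (field_kernel x y + ereal (2 * shift))"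

definition raised_energy :: "real measure \<Rightarrow> real measure \<Rightarrow> ennreal" where
  "raised_energy \<mu> \<nu> = (\<integral>\<^sup>+x. \<integral>\<^sup>+y. raised_kernel x y \<partial>\<nu> \<partial>\<mu>)"

lemma measurable_root [measurable]: "root n \<in> borel_measurable borel"
  by (intro borel_measurable_continuous_onI continuous_on_real_root continuous_on_id)

lemma measurable_field_kernel [measurable (raw)]:
  assumes [measurable]: "f \<in> borel_measurable M" "g \<in> borel_measurable M"
  shows "(\<lambda>x. field_kernel (f x) (g x)) \<in> borel_measurable M"
  unfolding field_kernel_def by measurable

lemma measurable_raised_kernel [measurable (raw)]:
  assumes [measurable]: "f \<in> borel_measurable M" "g \<in> borel_measurable M"
  shows "(\<lambda>x. raised_kernel (f x) (g x)) \<in> borel_measurable M"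
  unfolding raised_kernel_def by measurable

lemma field_kernel_sym: "field_kernel x y = field_kernel y x"
proof -
  have "log_kernel a b = log_kernel b a" for a b by (simp add: log_kernel_def abs_minus_commute)
  then show ?thesis unfolding field_kernel_def by (simp add: add.assoc add.commute[of "V x / 2" "V y / 2"])
qed

lemma raised_kernel_diag: "raised_kernel x x = \<infinity>"
proof -
  have "log_kernel a a / 2 = \<infinity>" for a by (simp add: log_kernel_def)
  then show ?thesis by (simp add: raised_kernel_def field_kernel_def e2ennreal_infty)
qed

lemma field_kernel_lower:
  assumes "x \<ge> 0" "y \<ge> 0"
  shows "ereal (confine x + confine y) \<le> field_kernel x y"
proof (cases "x = y")
  case True
  have "log_kernel a a / 2 = \<infinity>" for a by (simp add: log_kernel_def)
  then show ?thesis using True by (simp add: field_kernel_def)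
next
  case False
  then have ne: "root q x \<noteq> root q y" "root r x \<noteq> root r y" using assms q r by auto
  let ?a = "ln (1 / \<bar>root q x - root q y\<bar>)" and ?b = "ln (1 / \<bar>root r x - root r y\<bar>)"
  have "- (ln (max x 1) + ln (max y 1)) / real q \<le> ?a" "- (ln (max x 1) + ln (max y 1)) / real r \<le> ?b"
    using log_kernel_root_bound[OF q assms] log_kernel_root_bound[OF r assms] ne by (auto simp: log_kernel_def)
  then have "- (ln (max x 1) + ln (max y 1)) / real q / 2 + - (ln (max x 1) + ln (max y 1)) / real r / 2 \<le> ?a / 2 + ?b / 2"
    by (intro add_mono divide_right_mono) auto
  moreover have "- (ln (max x 1) + ln (max y 1)) / real q / 2 + - (ln (max x 1) + ln (max y 1)) / real r / 2
     = - \<theta> * (ln (max x 1) + ln (max y 1))"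
  proof -
    have "- X / a / 2 + - X / b / 2 = - ((1 / a + 1 / b) / 2) * X" for X a b :: real
      by (simp add: algebra_simps)
    then show ?thesis unfolding \<theta>_def .
  qed
  ultimately have "confine x + confine y \<le> ?a / 2 + ?b / 2 + V x / 2 + V y / 2"
    unfolding confine_def by (simp add: algebra_simps)
  moreover have "field_kernel x y = ereal (?a / 2 + ?b / 2 + V x / 2 + V y / 2)"
    using ne by (simp add: field_kernel_def log_kernel_def)
  ultimately show ?thesis by simp
qed

lemma raised_kernel_lower:
  assumes "x \<ge> 0" "y \<ge> 0"
  shows "ennreal (raised x) + ennreal (raised y) \<le> raised_kernel x y"
proof -
  have "ereal (confine x + confine y) + ereal (2 * shift) \<le> field_kernel x y + ereal (2 * shift)"
    by (intro add_right_mono field_kernel_lower assms)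
  then have "ereal (raised x + raised y) \<le> field_kernel x y + ereal (2 * shift)" by (simp add: raised_def algebra_simps)
  from e2ennreal_mono[OF this] show ?thesis
    unfolding raised_kernel_def by (simp add: e2ennreal_ereal raised_nonneg)
qed

lemma raised_kernel_tendsto:
  assumes f: "(f \<longlongrightarrow> x) F" and g: "(g \<longlongrightarrow> y) F"
  shows "((\<lambda>n. raised_kernel (f n) (g n)) \<longlongrightarrow> raised_kernel x y) F"
proof -
  have V: "((\<lambda>n. V (h n)) \<longlongrightarrow> V z) F" if "(h \<longlongrightarrow> z) F" for h z
    by (rule continuous_on_tendsto_compose[OF continuous_V that]) auto
  have k: "((\<lambda>n. log_kernel (root m (f n)) (root m (g n)) / 2) \<longlongrightarrow> log_kernel (root m x) (root m y) / 2) F" for m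
  proof -
    have "((\<lambda>n. ereal (1/2) * log_kernel (root m (f n)) (root m (g n))) \<longlongrightarrow> ereal (1/2) * log_kernel (root m x) (root m y)) F"
      by (intro tendsto_cmult_ereal tendsto_log_kernel tendsto_real_root f g) auto
    then show ?thesis by (simp add: divide_ereal_def mult.commute inverse_eq_divide)
  qed
  have nm: "log_kernel a b / 2 \<noteq> - \<infinity>" for a b by (cases "a = b") (auto simp: log_kernel_def)
  have "((\<lambda>n. field_kernel (f n) (g n) + ereal (2 * shift)) \<longlongrightarrow> field_kernel x y + ereal (2 * shift)) F"
    unfolding field_kernel_def using nm
    by (intro tendsto_add_ereal_general k tendsto_ereal tendsto_divide V f g tendsto_const) (auto simp: ereal_plus_eq_MInfty)
  then show ?thesis unfolding raised_kernel_def by (rule tendsto_e2ennrealI)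
qed

text \<open>The scalar functional and the raised energy differ by a constant, so they have the same
minimizers; this includes measures of infinite energy.\<close>

lemma nu_energy_eq:
  assumes M: "prob_on_halfline M"
  shows "nu_energy q r Vh M = enn2ereal (raised_energy M M) - ereal (2 * shift)"
proof -
  note D = prob_on_halflineD[OF M]
  interpret real_distribution M by (rule D)
  interpret MM: pair_prob_space M M ..
  note nonneg = AE_pair_halfline[OF M]
  have "nu_energy q r Vh M = enn2ereal (\<integral>\<^sup>+z. e2ennreal (field_kernel (fst z) (snd z) + ereal (2 * shift)) \<partial>(M \<Otimes>\<^sub>M M)) - ereal (2 * shift)"
    unfolding nu_energy_def
  proof (rule ereal_integral_shift)
    show "AE z in M \<Otimes>\<^sub>M M. (case z of (x, y) \<Rightarrow> log_kernel (root q x) (root q y) / 2 + log_kernel (root r x) (root r y) / 2 + ereal (Vh x / 2) + ereal (Vh y / 2)) = field_kernel (fst z) (snd z)"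
      using nonneg by eventually_elim (auto simp: field_kernel_def V_def split_beta')
    show "AE z in M \<Otimes>\<^sub>M M. ereal (- (2 * shift)) \<le> field_kernel (fst z) (snd z)"
      using nonneg
    proof eventually_elim
      case (elim z)
      have "- (2 * shift) \<le> confine (fst z) + confine (snd z)"
        using shift(2)[of "fst z"] shift(2)[of "snd z"] by simp
      then show ?case using field_kernel_lower[of "fst z" "snd z"] elim by (meson ereal_less_eq(3) order_trans)
    qed
  qed (auto intro: MM.prob_space_axioms shift)
  also have "(\<integral>\<^sup>+z. e2ennreal (field_kernel (fst z) (snd z) + ereal (2 * shift)) \<partial>(M \<Otimes>\<^sub>M M)) = raised_energy M M"
    unfolding raised_energy_def raised_kernel_def by (subst nn_integral_fst[symmetric]) auto
  finally show ?thesis .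
qed

lemma nu_energy_less_iff:
  assumes "prob_on_halfline M" "prob_on_halfline M'"
  shows "nu_energy q r Vh M < nu_energy q r Vh M' \<longleftrightarrow> raised_energy M M < raised_energy M' M'"
proof -
  have "enn2ereal a - ereal d < enn2ereal b - ereal d \<longleftrightarrow> a < b" for a b :: ennreal and d
    by (cases a; cases b) (auto simp: enn2ereal_ennreal ennreal_less_iff)
  then show ?thesis by (simp add: nu_energy_eq assms)
qed

text \<open>The coefficient \<open>\<theta>\<close> is the mean of \<open>1 / q\<close> and \<open>1 / r\<close>. The terms \<open>- \<theta> max u 0\<close> of the two root kernels
are exactly what \<open>confine\<close> subtracts from the potential, and what remains is a sum of nonnegative parts
that can be integrated separately.\<close>

lemma raised_energy_exp:
  assumes P: "real_distribution P" and Q: "real_distribution Q"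
  shows "raised_energy (scaled_law 1 1 P) (scaled_law 1 1 Q) =
     ennreal \<theta> * brownian_energy P Q + ennreal (1/2) * kap_energy (real q) P Q + ennreal (1/2) * (kap_energy (real r) P Q)
     + (\<integral>\<^sup>+u. ennreal (raised (exp u)) \<partial>P) + (\<integral>\<^sup>+v. ennreal (raised (exp v)) \<partial>Q)"
proof -
  interpret P: real_distribution P by (rule P)
  interpret Q: real_distribution Q by (rule Q)
  have pw: "raised_kernel (exp u) (exp v) = ennreal \<theta> * ennreal (brownian u v) + ennreal (1/2) * kap (real q) (u - v) + ennreal (1/2) * kap (real r) (u - v)
     + ennreal (raised (exp u)) + ennreal (raised (exp v))" for u v
  proof (cases "u = v")
    case True
    have "ennreal (1/2) * top = top" by (simp add: ennreal_mult_top)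
    then show ?thesis using True by (simp add: raised_kernel_diag kap_zero)
  next
    case False
    have ln: "ln (max (exp x) 1) = max x 0" for x :: real
      by (cases "x \<ge> 0") (auto simp: max_def)
    have roots: "root q (exp u) \<noteq> root q (exp v)" "root r (exp u) \<noteq> root r (exp v)" using False q r by auto
    have kp: "kap_real (real q) (u - v) \<ge> 0" "kap_real (real r) (u - v) \<ge> 0"
      using False q r by (auto intro!: kap_real_nonneg)
    have b: "brownian u v \<ge> 0" by (rule brownian_nonneg)
    have "field_kernel (exp u) (exp v) + ereal (2 * shift) = ereal (\<theta> * brownian u v + 1/2 * kap_real (real q) (u - v) + 1/2 * kap_real (real r) (u - v) + raised (exp u) + raised (exp v))"
    proof -
      have "((B - a - b) / real q + k) / 2 + ((B - a - b) / real r + l) / 2 + v / 2 + w / 2 + 2 * s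
        = \<theta> * B + 1/2 * k + 1/2 * l + (v / 2 - \<theta> * a + s) + (w / 2 - \<theta> * b + s)" for B a b k l v w s :: real
      proof -
        define x y where "x = 1 / real q" and "y = 1 / real r"
        have "z / real q = x * z" "z / real r = y * z" for z by (simp_all add: x_def y_def)
        then show ?thesis unfolding \<theta>_def x_def[symmetric] y_def[symmetric] by (simp add: algebra_simps add_divide_distrib diff_divide_distrib)
      qed
      note e = this
      have "field_kernel (exp u) (exp v) + ereal (2 * shift) = ereal (((brownian u v - max u 0 - max v 0) / real q + kap_real (real q) (u - v)) / 2
          + ((brownian u v - max u 0 - max v 0) / real r + kap_real (real r) (u - v)) / 2 + V (exp u) / 2 + V (exp v) / 2 + 2 * shift)"
        unfolding field_kernel_def log_kernel_def using roots
        by (simp add: ln_root_exp_diff[OF False q] ln_root_exp_diff[OF False r])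
      then show ?thesis unfolding e raised_def confine_def ln .
    qed
    then have "raised_kernel (exp u) (exp v) = ennreal (\<theta> * brownian u v + 1/2 * kap_real (real q) (u - v) + 1/2 * kap_real (real r) (u - v) + raised (exp u) + raised (exp v))"
      unfolding raised_kernel_def by (simp only: e2ennreal_ereal)
    also have "\<dots> = ennreal (\<theta> * brownian u v) + ennreal (1/2 * kap_real (real q) (u - v)) + ennreal (1/2 * kap_real (real r) (u - v)) + ennreal (raised (exp u)) + ennreal (raised (exp v))"
      using kp b theta raised_nonneg by (simp only: ennreal_plus add_nonneg_nonneg mult_nonneg_nonneg less_imp_le zero_le_divide_1_iff zero_le_numeral)
    also have "\<dots> = ennreal \<theta> * ennreal (brownian u v) + ennreal (1/2) * ennreal (kap_real (real q) (u - v)) + ennreal (1/2) * ennreal (kap_real (real r) (u - v)) + ennreal (raised (exp u)) + ennreal (raised (exp v))"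
      using kp b theta by (simp only: ennreal_mult less_imp_le zero_le_divide_1_iff zero_le_numeral)
    finally show ?thesis using False q r by (simp add: kap_eq_kap_real)
  qed
  have "raised_energy (scaled_law 1 1 P) (scaled_law 1 1 Q) = (\<integral>\<^sup>+u. \<integral>\<^sup>+v. raised_kernel (exp u) (exp v) \<partial>Q \<partial>P)"
    unfolding raised_energy_def by (subst nn_integral_scaled_law[OF Q], measurable, subst nn_integral_scaled_law[OF P]) auto
  also have "\<dots> = (\<integral>\<^sup>+u. ennreal \<theta> * (\<integral>\<^sup>+v. ennreal (brownian u v) \<partial>Q) + ennreal (1/2) * (\<integral>\<^sup>+v. kap (real q) (u - v) \<partial>Q) + ennreal (1/2) * (\<integral>\<^sup>+v. kap (real r) (u - v) \<partial>Q)
     + ennreal (raised (exp u)) + (\<integral>\<^sup>+v. ennreal (raised (exp v)) \<partial>Q) \<partial>P)"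
    unfolding pw by (simp add: nn_integral_add nn_integral_cmult Q.emeasure_space_1[simplified])
  also have "\<dots> = ennreal \<theta> * brownian_energy P Q + ennreal (1/2) * kap_energy (real q) P Q + ennreal (1/2) * (kap_energy (real r) P Q)
     + (\<integral>\<^sup>+u. ennreal (raised (exp u)) \<partial>P) + (\<integral>\<^sup>+v. ennreal (raised (exp v)) \<partial>Q)"
    unfolding brownian_energy_def nn_integral_diff_law[OF P Q measurable_kap]
    by (simp add: nn_integral_add nn_integral_cmult P.emeasure_space_1[simplified])
  finally show ?thesis .
qed

lemma raised_energy_real:
  assumes X: "real_distribution X" and Y: "real_distribution Y" and f: "brownian_energy X Y < \<infinity>"
    "kap_energy (real q) X Y < \<infinity>" "kap_energy (real r) X Y < \<infinity>"
    "(\<integral>\<^sup>+u. ennreal (raised (exp u)) \<partial>X) < \<infinity>" "(\<integral>\<^sup>+u. ennreal (raised (exp u)) \<partial>Y) < \<infinity>"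
  defines "x \<equiv> \<theta> * brown_form X Y + kap_form (real q) X Y / 2 + kap_form (real r) X Y / 2
    + enn2real (\<integral>\<^sup>+u. ennreal (raised (exp u)) \<partial>X) + enn2real (\<integral>\<^sup>+u. ennreal (raised (exp u)) \<partial>Y)"
  shows "raised_energy (scaled_law 1 1 X) (scaled_law 1 1 Y) = ennreal x" and "0 \<le> x"
proof -
  define ra where "ra Z = enn2real (\<integral>\<^sup>+u. ennreal (raised (exp u)) \<partial>Z)" for Z
  have e: "brownian_energy X Y = ennreal (brown_form X Y)" "kap_energy (real q) X Y = ennreal (kap_form (real q) X Y)"
    "kap_energy (real r) X Y = ennreal (kap_form (real r) X Y)"
    "(\<integral>\<^sup>+u. ennreal (raised (exp u)) \<partial>X) = ennreal (ra X)" "(\<integral>\<^sup>+u. ennreal (raised (exp u)) \<partial>Y) = ennreal (ra Y)"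
    using f unfolding brown_form_def kap_form_def ra_def by (simp_all add: ennreal_enn2real less_top)
  have nn: "0 \<le> \<theta>" "0 \<le> brown_form X Y" "0 \<le> kap_form (real q) X Y" "0 \<le> kap_form (real r) X Y" "0 \<le> ra X" "0 \<le> ra Y"
    using theta by (simp_all add: brown_form_def kap_form_def ra_def)
  have x: "x = \<theta> * brown_form X Y + 1/2 * kap_form (real q) X Y + 1/2 * kap_form (real r) X Y + ra X + ra Y"
    by (simp add: x_def ra_def)
  show "raised_energy (scaled_law 1 1 X) (scaled_law 1 1 Y) = ennreal x"
    unfolding raised_energy_exp[OF X Y] e x using nn
    by (simp only: ennreal_plus ennreal_mult add_nonneg_nonneg mult_nonneg_nonneg zero_le_divide_1_iff zero_le_numeral)
  show "0 \<le> x" unfolding x using nn by (intro add_nonneg_nonneg mult_nonneg_nonneg) auto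
qed

lemma finite_raised_energy_log_law:
  assumes M: "prob_on_halfline M" and fin: "raised_energy M M < \<infinity>"
  shows "\<exists>P. real_distribution P \<and> M = scaled_law 1 1 P"
proof -
  note D = prob_on_halflineD[OF M]
  interpret real_distribution M by (rule D)
  have "(\<integral>\<^sup>+z. raised_kernel (fst z) (snd z) \<partial>(M \<Otimes>\<^sub>M M)) = raised_energy M M"
    unfolding raised_energy_def by (subst nn_integral_fst[symmetric]) auto
  then have "emeasure M {0} = 0"
    using fin by (intro no_atom_of_finite_pair_integral[of M "\<lambda>z. raised_kernel (fst z) (snd z)"]) (auto simp: raised_kernel_diag finite_measure_axioms)
  then have "AE x in M. x \<noteq> 0" by (intro AE_I[of _ _ "{0}"]) auto
  then have "AE x in M. 1 * x > 0" using D(2) by eventually_elim auto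
  then show ?thesis using emeasure_space_1 by (intro log_law_exists) auto
qed

lemma raised_energy_sym:
  assumes "real_distribution P" "real_distribution Q"
  shows "raised_energy P Q = raised_energy Q P"
proof -
  interpret P: real_distribution P by fact
  interpret Q: real_distribution Q by fact
  interpret PQ: pair_sigma_finite P Q ..
  have "raised_kernel x y = raised_kernel y x" for x y by (simp add: raised_kernel_def field_kernel_sym[of x y])
  then have "raised_energy P Q = (\<integral>\<^sup>+x. \<integral>\<^sup>+y. raised_kernel y x \<partial>Q \<partial>P)" by (simp add: raised_energy_def)
  also have "\<dots> = raised_energy Q P" unfolding raised_energy_def by (rule PQ.Fubini'[symmetric]) measurable
  finally show ?thesis .
qed

end

text \<open>The terms of the series integrate to \<open>2 a / (m + 1)\<^sup>2\<close>. Hence laws with bounded density have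
finite \<open>kap\<close> energy.\<close>

lemma nn_integral_kap_lborel:
  assumes a: "a > 0"
  shows "(\<integral>\<^sup>+t. kap a t \<partial>lborel) < \<infinity>"
proof -
  have e: "(\<integral>\<^sup>+t. ennreal (exp (- (c * \<bar>t\<bar>))) \<partial>lborel) \<le> ennreal (2 / c)" if c: "c > 0" for c
  proof -
    have "(\<integral>\<^sup>+t. ennreal (exp (- (c * \<bar>t\<bar>))) \<partial>lborel) \<le>
       (\<integral>\<^sup>+t. ennreal (exp (- (c * t))) * indicator {0..} t + ennreal (exp (- (c * (- t)))) * indicator {0..} (- t) \<partial>lborel)"
      by (intro nn_integral_mono) (auto split: split_indicator)
    also have "\<dots> = (\<integral>\<^sup>+t. ennreal (exp (- (c * t))) * indicator {0..} t \<partial>lborel) + (\<integral>\<^sup>+t. ennreal (exp (- (c * (- t)))) * indicator {0..} (- t) \<partial>lborel)"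
      by (intro nn_integral_add) auto
    also have "(\<integral>\<^sup>+t. ennreal (exp (- (c * (- t)))) * indicator {0..} (- t) \<partial>lborel) = (\<integral>\<^sup>+t. ennreal (exp (- (c * t))) * indicator {0..} t \<partial>lborel)"
      using nn_integral_real_affine[of "\<lambda>t. ennreal (exp (- (c * t))) * indicator {0..} t" "-1" 0] by simp
    also have "(\<integral>\<^sup>+t. ennreal (exp (- (c * t))) * indicator {0..} t \<partial>lborel) + \<dots> = ennreal (2 / c)"
      unfolding exp_half_line_rate[OF c] using c by (simp flip: ennreal_plus)
    finally show ?thesis .
  qed
  have "(\<integral>\<^sup>+t. kap a t \<partial>lborel) = (\<Sum>m. \<integral>\<^sup>+t. ennreal (exp (- (real (Suc m) * \<bar>t\<bar> / a)) / real (Suc m)) \<partial>lborel)"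
    unfolding kap_def by (rule nn_integral_suminf) measurable
  also have "\<dots> \<le> (\<Sum>m. ennreal (2 * a * (1 / (real (Suc m))\<^sup>2)))"
  proof (intro suminf_le summableI)
    fix m
    have c: "real (Suc m) / a > 0" using a by simp
    have "(\<integral>\<^sup>+t. ennreal (exp (- (real (Suc m) * \<bar>t\<bar> / a)) / real (Suc m)) \<partial>lborel) =
        (\<integral>\<^sup>+t. ennreal (1 / real (Suc m)) * ennreal (exp (- (real (Suc m) / a * \<bar>t\<bar>))) \<partial>lborel)"
      by (intro nn_integral_cong) (simp add: ennreal_mult[symmetric] del: of_nat_Suc)
    also have "\<dots> \<le> ennreal (1 / real (Suc m)) * ennreal (2 / (real (Suc m) / a))"
      by (subst nn_integral_cmult, measurable, intro mult_left_mono e[OF c], simp)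
    also have "\<dots> = ennreal (2 * a * (1 / (real (Suc m))\<^sup>2))"
      using a by (simp add: ennreal_mult[symmetric] power2_eq_square mult_ac del: of_nat_Suc)
    finally show "(\<integral>\<^sup>+t. ennreal (exp (- (real (Suc m) * \<bar>t\<bar> / a)) / real (Suc m)) \<partial>lborel) \<le> ennreal (2 * a * (1 / (real (Suc m))\<^sup>2))" .
  qed
  also have "\<dots> = ennreal (\<Sum>m. 2 * a * (1 / (real (Suc m))\<^sup>2))"
    using a by (intro suminf_ennreal2 summable_mult summable_inverse_Suc_square) auto
  also have "\<dots> < \<infinity>" by simp
  finally show ?thesis .
qed

context external_field
begin

section \<open>Existence, uniqueness and support of the scalar minimizer\<close>

text \<open>The uniform law on \<open>{0..1}\<close> in exponential coordinates.\<close>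

lemma finite_raised_energy_example: "\<exists>M. prob_on_halfline M \<and> raised_energy M M < \<infinity>"
proof -
  define P :: "real measure" where "P = uniform_measure lborel {0..1}"
  have P: "real_distribution P"
    unfolding P_def real_distribution_def real_distribution_axioms_def
    by (auto intro!: prob_space_uniform_measure)
  interpret P: real_distribution P by (rule P)
  have nn: "(\<integral>\<^sup>+x. f x \<partial>P) = (\<integral>\<^sup>+x. f x * indicator {0..1} x \<partial>lborel)" if [measurable]: "f \<in> borel_measurable borel" for f
    unfolding P_def by (subst nn_integral_uniform_measure) (auto simp: divide_ennreal_def)
  have kapf: "kap_energy a P P < \<infinity>" if a: "a > 0" for a
  proof -
    have "kap_energy a P P = (\<integral>\<^sup>+u. \<integral>\<^sup>+v. kap a (u - v) \<partial>P \<partial>P)"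
      by (rule nn_integral_diff_law[OF P P]) measurable
    also have "\<dots> \<le> (\<integral>\<^sup>+u. (\<integral>\<^sup>+t. kap a t \<partial>lborel) \<partial>P)"
    proof (rule nn_integral_mono)
      fix u
      have "(\<integral>\<^sup>+v. kap a (u - v) \<partial>P) = (\<integral>\<^sup>+v. kap a (u - v) * indicator {0..1} v \<partial>lborel)" by (rule nn) measurable
      also have "\<dots> \<le> (\<integral>\<^sup>+v. kap a (u - v) \<partial>lborel)" by (intro nn_integral_mono) (auto split: split_indicator)
      also have "\<dots> = (\<integral>\<^sup>+t. kap a t \<partial>lborel)"
        using nn_integral_real_affine[of "kap a" "-1" u] by simp
      finally show "(\<integral>\<^sup>+v. kap a (u - v) \<partial>P) \<le> (\<integral>\<^sup>+t. kap a t \<partial>lborel)" .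
    qed
    also have "\<dots> = (\<integral>\<^sup>+t. kap a t \<partial>lborel)" by (simp add: P.emeasure_space_1[simplified])
    also have "\<dots> < \<infinity>" by (rule nn_integral_kap_lborel[OF a])
    finally show ?thesis .
  qed
  have bounded: "(\<integral>\<^sup>+x. f x \<partial>P) \<le> ennreal B" if [measurable]: "f \<in> borel_measurable borel" and "\<And>x. 0 \<le> x \<Longrightarrow> x \<le> 1 \<Longrightarrow> f x \<le> ennreal B" for f B
  proof -
    have "(\<integral>\<^sup>+x. f x \<partial>P) \<le> (\<integral>\<^sup>+x. ennreal B * indicator {0..1::real} x \<partial>lborel)"
    proof (subst nn[OF that(1)], intro nn_integral_mono)
      fix x :: real
      show "f x * indicator {0..1} x \<le> ennreal B * indicator {0..1} x"
        using that(2)[of x] by (auto split: split_indicator)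
    qed
    also have "\<dots> = ennreal B" by (subst nn_integral_cmult_indicator) auto
    finally show ?thesis .
  qed
  have "brownian_energy P P \<le> ennreal 1"
    unfolding brownian_energy_def
    by (intro bounded) (auto simp: brownian_def abs_if intro!: ennreal_leI, measurable)
  then have br: "brownian_energy P P < \<infinity>" by (auto simp: less_top[symmetric] top_unique)
  have "continuous_on {0..1} (\<lambda>u. confine (exp u))"
    by (rule continuous_on_compose2[OF continuous_confine]) (auto intro: continuous_on_exp)
  then have "compact ((\<lambda>u. raised (exp u)) ` {0..1})"
    unfolding raised_def by (intro compact_continuous_image continuous_on_add continuous_on_const) auto
  then obtain B where B: "\<And>u. 0 \<le> u \<Longrightarrow> u \<le> 1 \<Longrightarrow> \<bar>raised (exp u)\<bar> \<le> B"
    using compact_imp_bounded bounded_iff by (metis (no_types, lifting) atLeastAtMost_iff image_eqI real_norm_def)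
  have "(\<integral>\<^sup>+u. ennreal (raised (exp u)) \<partial>P) \<le> ennreal B"
  proof (rule bounded)
    show "ennreal (raised (exp u)) \<le> ennreal B" if "0 \<le> u" "u \<le> 1" for u
      using B[OF that] by (intro ennreal_leI) linarith
  qed measurable
  then have ra: "(\<integral>\<^sup>+u. ennreal (raised (exp u)) \<partial>P) < \<infinity>" by (auto simp: less_top[symmetric] top_unique)
  have "raised_energy (scaled_law 1 1 P) (scaled_law 1 1 P) < \<infinity>"
  proof -
    have fin: "ennreal c * x < \<infinity>" if "x < \<infinity>" for c x using that by (simp add: ennreal_mult_less_top)
    have add: "x + y < \<infinity>" if "x < \<infinity>" "y < \<infinity>" for x y :: ennreal using that by simp
    show ?thesis unfolding raised_energy_exp[OF P P] by (intro add fin br ra kapf) (use q r in auto)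
  qed
  moreover have "prob_on_halfline (scaled_law 1 1 P)" by (rule prob_on_halfline_scaled_law[OF P])
  ultimately show ?thesis by blast
qed

lemma raised_le_raised_energy:
  assumes M: "prob_on_halfline M"
  shows "(\<integral>\<^sup>+x. ennreal (raised x) \<partial>M) \<le> raised_energy M M"
proof -
  note D = prob_on_halflineD[OF M]
  interpret real_distribution M by (rule D)
  have "(\<integral>\<^sup>+x. ennreal (raised x) \<partial>M) = (\<integral>\<^sup>+x. \<integral>\<^sup>+y. ennreal (raised x) \<partial>M \<partial>M)"
    by (simp add: emeasure_space_1[simplified])
  also have "\<dots> \<le> raised_energy M M" unfolding raised_energy_def
  proof (rule nn_integral_mono_AE, use D(2) in eventually_elim, rule nn_integral_mono_AE, use D(2) in eventually_elim)
    fix x y :: real assume xy: "0 \<le> x" "0 \<le> y"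
    have "ennreal (raised x) \<le> ennreal (raised x) + ennreal (raised y)" by simp
    also have "\<dots> \<le> raised_kernel x y" by (rule raised_kernel_lower[OF xy])
    finally show "ennreal (raised x) \<le> raised_kernel x y" .
  qed
  finally show ?thesis .
qed

lemma raised_at_top: "\<exists>R>0. \<forall>x>R. raised x \<ge> E"
proof -
  obtain R where R: "\<And>x. x \<ge> R \<Longrightarrow> confine x \<ge> E"
    using confine_at_top unfolding filterlim_at_top eventually_at_top_linorder by blast
  have "raised x \<ge> E" if "x > max R 1" for x using R[of x] that shift(1) by (simp add: raised_def)
  then show ?thesis by (intro exI[of _ "max R 1"]) auto
qed

text \<open>The energy bounds the integral of \<open>raised\<close>, which tends to infinity; tightness is Markov's inequality.\<close>

lemma tight_of_bounded_raised_energy: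
  assumes M: "\<And>n. prob_on_halfline (M n)" and K: "\<And>n. raised_energy (M n) (M n) \<le> ennreal K" "K \<ge> 0"
  shows "tight M"
  unfolding tight_def
proof (intro conjI allI impI)
  show "real_distribution (M n)" for n by (rule prob_on_halflineD[OF M])
  fix \<epsilon> :: real assume \<epsilon>: "\<epsilon> > 0"
  \<comment> \<open>Markov's bound \<open>K / E\<close> lies below \<open>\<epsilon>\<close>.\<close>
  define E where "E = K / \<epsilon> + 1"
  have E: "E > 0" using divide_nonneg_pos[OF K(2) \<epsilon>] unfolding E_def by linarith
  obtain R where R: "R > 0" "\<And>x. x > R \<Longrightarrow> raised x \<ge> E" using raised_at_top by blast
  show "\<exists>x y. x < y \<and> (\<forall>n. 1 - \<epsilon> < measure (M n) {x<..y})"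
  proof (rule exI[of _ "- 1"], rule exI[of _ R], intro conjI allI)
    show "- 1 < R" using R by simp
    fix n
    note D = prob_on_halflineD[OF M[of n]]
    interpret real_distribution "M n" by (rule D)
    have "ennreal E * emeasure (M n) {R<..} = (\<integral>\<^sup>+x. ennreal E * indicator {R<..} x \<partial>M n)"
      by (subst nn_integral_cmult_indicator) auto
    also have "\<dots> \<le> (\<integral>\<^sup>+x. ennreal (raised x) \<partial>M n)"
      using R by (intro nn_integral_mono) (auto split: split_indicator intro: ennreal_leI)
    also have "\<dots> \<le> ennreal K" using raised_le_raised_energy[OF M[of n]] K(1)[of n] by (rule order_trans)
    finally have "E * prob {R<..} \<le> K" using E K(2) by (simp add: emeasure_eq_measure ennreal_mult[symmetric])
    then have "prob {R<..} \<le> K / E" using E by (simp add: field_simps)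
    also have "K / E < \<epsilon>" using K(2) \<epsilon> E by (simp add: E_def field_simps)
    finally have small: "prob {R<..} < \<epsilon>" .
    have "prob (- {- 1<..R}) = prob {R<..}"
    proof (rule measure_eq_AE)
      show "AE x in M n. x \<in> - {- 1<..R} \<longleftrightarrow> x \<in> {R<..}" using D(2) by eventually_elim auto
    qed auto
    then show "1 - \<epsilon> < prob {- 1<..R}"
      using small prob_compl[of "{- 1<..R}"] by (simp add: Compl_eq_Diff_UNIV)
  qed
qed

text \<open>The direct method. A minimizing sequence is tight, and along an almost surely convergent
representation of a weak limit the continuous kernel and Fatou's lemma give lower semicontinuity.\<close>

theorem raised_energy_minimizer_exists:
  "\<exists>M. prob_on_halfline M \<and> raised_energy M M < \<infinity> \<and> (\<forall>M'. prob_on_halfline M' \<longrightarrow> raised_energy M M \<le> raised_energy M' M')"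
proof -
  define I where "I = (INF M\<in>{M. prob_on_halfline M}. raised_energy M M)"
  have I_le: "I \<le> raised_energy M M" if "prob_on_halfline M" for M unfolding I_def using that by (intro INF_lower) auto
  have I_fin: "I < \<infinity>" using finite_raised_energy_example I_le by (auto intro: le_less_trans)
  have "\<exists>M. prob_on_halfline M \<and> raised_energy M M < I + ennreal (1 / real (Suc n))" for n
  proof -
    have "I < I + ennreal (1 / real (Suc n))"
      using I_fin by (cases I) (auto simp: ennreal_less_iff simp del: of_nat_Suc simp flip: ennreal_plus)
    then show ?thesis unfolding I_def by (auto simp: INF_less_iff)
  qed
  then obtain M where M: "\<And>n. prob_on_halfline (M n)" "\<And>n. raised_energy (M n) (M n) < I + ennreal (1 / real (Suc n))" by metis
  obtain I' where I': "I = ennreal I'" "I' \<ge> 0" using I_fin by (cases I) auto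
  have bound: "raised_energy (M n) (M n) \<le> ennreal (I' + 1)" for n
  proof -
    have "raised_energy (M n) (M n) \<le> ennreal (I' + 1 / real (Suc n))" using M(2)[of n] I' by (simp add: ennreal_plus less_imp_le)
    also have "\<dots> \<le> ennreal (I' + 1)" by (intro ennreal_leI) auto
    finally show ?thesis .
  qed
  have "tight M" by (rule tight_of_bounded_raised_energy[OF M(1) bound]) (use I' in simp)
  then obtain s T where s: "strict_mono (s :: nat \<Rightarrow> nat)" and T: "real_distribution T" and conv: "weak_conv_m (M \<circ> id \<circ> s) T"
    using tight_imp_convergent_subsubsequence[OF _ strict_mono_id] by blast
  have conv': "weak_conv_m (\<lambda>n. M (s n)) T" using conv by (simp add: comp_def)
  have D: "real_distribution (M (s n))" for n by (rule prob_on_halflineD[OF M(1)])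
  obtain \<Omega> :: "real measure" and Y_seq Y where Y: "prob_space \<Omega>" "\<And>n. Y_seq n \<in> measurable \<Omega> borel"
     "\<And>n. distr \<Omega> borel (Y_seq n) = M (s n)" "Y \<in> measurable \<Omega> lborel" "distr \<Omega> borel Y = T"
     "\<And>x. x \<in> space \<Omega> \<Longrightarrow> (\<lambda>n. Y_seq n x) \<longlonglongrightarrow> Y x"
    using Skorohod[OF D T conv'] by blast
  interpret \<Omega>: prob_space \<Omega> by (rule Y)
  note [measurable] = Y(2)
  have [measurable]: "Y \<in> borel_measurable \<Omega>" using Y(4) by simp
  have "AE \<omega> in \<Omega>. 0 \<le> Y_seq n \<omega>" for n
    using prob_on_halflineD(2)[OF M(1)[of "s n"]] unfolding Y(3)[symmetric] by (subst (asm) AE_distr_iff) auto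
  then have "AE \<omega> in \<Omega>. \<forall>n. 0 \<le> Y_seq n \<omega>" by (simp add: AE_all_countable)
  then have "AE \<omega> in \<Omega>. 0 \<le> Y \<omega>"
    using AE_space
  proof eventually_elim
    case (elim \<omega>)
    then show ?case using LIMSEQ_le_const[OF Y(6)[of \<omega>], of 0] by auto
  qed
  then have "AE x in T. 0 \<le> x" unfolding Y(5)[symmetric] by (subst AE_distr_iff) auto
  then have T_half: "prob_on_halfline T" using T by (intro prob_on_halflineI)
  have pull: "raised_energy (distr \<Omega> borel Z) (distr \<Omega> borel Z) = (\<integral>\<^sup>+\<omega>. \<integral>\<^sup>+\<omega>'. raised_kernel (Z \<omega>) (Z \<omega>') \<partial>\<Omega> \<partial>\<Omega>)"
    if [measurable]: "Z \<in> borel_measurable \<Omega>" for Z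
    unfolding raised_energy_def by (simp add: nn_integral_distr)
  have "raised_energy T T = (\<integral>\<^sup>+\<omega>. \<integral>\<^sup>+\<omega>'. liminf (\<lambda>n. raised_kernel (Y_seq n \<omega>) (Y_seq n \<omega>')) \<partial>\<Omega> \<partial>\<Omega>)"
    unfolding Y(5)[symmetric] pull[OF \<open>Y \<in> borel_measurable \<Omega>\<close>]
    by (intro nn_integral_cong lim_imp_Liminf[symmetric] raised_kernel_tendsto Y(6)) auto
  also have "\<dots> \<le> (\<integral>\<^sup>+\<omega>. liminf (\<lambda>n. \<integral>\<^sup>+\<omega>'. raised_kernel (Y_seq n \<omega>) (Y_seq n \<omega>') \<partial>\<Omega>) \<partial>\<Omega>)"
    by (intro nn_integral_mono nn_integral_liminf) measurable
  also have "\<dots> \<le> liminf (\<lambda>n. \<integral>\<^sup>+\<omega>. \<integral>\<^sup>+\<omega>'. raised_kernel (Y_seq n \<omega>) (Y_seq n \<omega>') \<partial>\<Omega> \<partial>\<Omega>)"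
    by (intro nn_integral_liminf) measurable
  also have "\<dots> = liminf (\<lambda>n. raised_energy (M (s n)) (M (s n)))"
    unfolding Y(3)[symmetric] pull[OF Y(2)] ..
  also have "\<dots> \<le> liminf (\<lambda>n. I + ennreal (1 / real (Suc (s n))))"
    by (intro Liminf_mono always_eventually allI less_imp_le M(2))
  also have "\<dots> = I"
  proof -
    have "(\<lambda>n. I + ennreal (1 / real (Suc n))) \<longlonglongrightarrow> I + ennreal 0"
      by (intro tendsto_add tendsto_const tendsto_ennrealI LIMSEQ_Suc[OF lim_1_over_n])
    from LIMSEQ_subseq_LIMSEQ[OF this s] show ?thesis
      by (intro lim_imp_Liminf) (auto simp: comp_def)
  qed
  finally have "raised_energy T T \<le> I" .
  then show ?thesis using T_half I_le I_fin by (intro exI[of _ T]) (auto intro: order_trans le_less_trans)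
qed

lemma prob_on_halfline_mix:
  assumes A: "prob_on_halfline A" and B: "prob_on_halfline B"
  shows "prob_on_halfline (mix_law (1/2) A B)"
proof -
  note DA = prob_on_halflineD[OF A] and DB = prob_on_halflineD[OF B]
  have R: "real_distribution (mix_law (1/2) A B)" by (rule real_distribution_mix_law[OF DA(1) DB(1)]) auto
  interpret real_distribution "mix_law (1/2) A B" by (rule R)
  have "emeasure (mix_law (1/2) A B) {0..} = ennreal (1/2) * emeasure A {0..} + ennreal (1 - 1/2) * emeasure B {0..}"
    using nn_integral_mix_law[OF DA(1) DB(1), of "1/2" "indicator {0..}"] DA(3) DB(3) by simp
  also have "\<dots> = ennreal (1/2) + ennreal (1 - 1/2)" using A B by (simp only: prob_on_halfline_def mult_1_right)
  also have "\<dots> = ennreal (1/2 + (1 - 1/2))" by (rule ennreal_plus[symmetric]) auto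
  also have "\<dots> = 1" by simp
  finally show ?thesis using prob_space_axioms by (simp add: prob_on_halfline_def)
qed

text \<open>Two minimizers are compared with their midpoint. Each of the three forms satisfies the parallelogram
inequality, and minimality forces equality in their sum, hence in each of them; equality for
\<open>kap q\<close> identifies the laws.\<close>

theorem raised_energy_minimizer_unique:
  assumes A: "prob_on_halfline A" "raised_energy A A < \<infinity>" "\<And>M. prob_on_halfline M \<Longrightarrow> raised_energy A A \<le> raised_energy M M"
    and B: "prob_on_halfline B" "\<And>M. prob_on_halfline M \<Longrightarrow> raised_energy B B \<le> raised_energy M M"
  shows "A = B"
proof -
  have eq: "raised_energy B B = raised_energy A A" using A B by (intro antisym) auto
  note DA = prob_on_halflineD(1)[OF A(1)] and DB = prob_on_halflineD(1)[OF B(1)]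
  interpret A: real_distribution A by (rule DA)
  interpret B: real_distribution B by (rule DB)
  have mix: "raised_energy (mix_law (1/2) A B) (mix_law (1/2) A B) = ennreal (1/4) * (raised_energy A A + raised_energy A B + (raised_energy B A + raised_energy B B))"
  proof -
    have m: "(\<integral>\<^sup>+t. f t \<partial>mix_law (1/2) A B) = ennreal (1/2) * ((\<integral>\<^sup>+x. f x \<partial>A) + (\<integral>\<^sup>+x. f x \<partial>B))" if "f \<in> borel_measurable borel" for f
      using nn_integral_mix_law[OF DA DB _ _ that, of "1/2"] by (simp add: distrib_left)
    have "raised_energy (mix_law (1/2) A B) (mix_law (1/2) A B) = (\<integral>\<^sup>+x. ennreal (1/2) * ((\<integral>\<^sup>+y. raised_kernel x y \<partial>A) + (\<integral>\<^sup>+y. raised_kernel x y \<partial>B)) \<partial>mix_law (1/2) A B)"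
      unfolding raised_energy_def by (intro nn_integral_cong m) measurable
    also have "\<dots> = ennreal (1/2) * ((\<integral>\<^sup>+x. ennreal (1/2) * ((\<integral>\<^sup>+y. raised_kernel x y \<partial>A) + (\<integral>\<^sup>+y. raised_kernel x y \<partial>B)) \<partial>A) + (\<integral>\<^sup>+x. ennreal (1/2) * ((\<integral>\<^sup>+y. raised_kernel x y \<partial>A) + (\<integral>\<^sup>+y. raised_kernel x y \<partial>B)) \<partial>B))"
      by (rule m) measurable
    also have "\<dots> = ennreal (1/2) * (ennreal (1/2) * (raised_energy A A + raised_energy A B) + ennreal (1/2) * (raised_energy B A + raised_energy B B))"
      unfolding raised_energy_def by (simp add: nn_integral_cmult nn_integral_add)
    also have "\<dots> = (ennreal (1/2) * ennreal (1/2)) * (raised_energy A A + raised_energy A B + (raised_energy B A + raised_energy B B))"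
      by (simp only: distrib_left mult.assoc)
    also have "ennreal (1/2) * ennreal (1/2) = ennreal (1/4)" by (subst ennreal_mult[symmetric]) auto
    finally show ?thesis .
  qed
  obtain P where P: "real_distribution P" "A = scaled_law 1 1 P" using finite_raised_energy_log_law[OF A(1,2)] by blast
  obtain Q where Q: "real_distribution Q" "B = scaled_law 1 1 Q" using finite_raised_energy_log_law[OF B(1)] A(2) eq by auto
  define ra where "ra X = enn2real (\<integral>\<^sup>+u. ennreal (raised (exp u)) \<partial>X)" for X
  have fin: "brownian_energy X X < \<infinity> \<and> kap_energy (real q) X X < \<infinity> \<and> kap_energy (real r) X X < \<infinity>
     \<and> (\<integral>\<^sup>+u. ennreal (raised (exp u)) \<partial>X) < \<infinity>" if X: "real_distribution X" "raised_energy (scaled_law 1 1 X) (scaled_law 1 1 X) < \<infinity>" for X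
    using X(2) theta unfolding raised_energy_exp[OF X(1) X(1)] by (auto simp: ennreal_mult_less_top)
  have finP: "raised_energy (scaled_law 1 1 P) (scaled_law 1 1 P) < \<infinity>" and finQ: "raised_energy (scaled_law 1 1 Q) (scaled_law 1 1 Q) < \<infinity>"
    using A(2) eq P(2) Q(2) by auto
  note fP = fin[OF P(1) finP] and fQ = fin[OF Q(1) finQ]
  have q0: "real q > 0" "real r > 0" using q r by auto
  note kq = kap_form_parallelogram[OF P(1) Q(1) q0(1)] and kr = kap_form_parallelogram[OF P(1) Q(1) q0(2)]
  have kqf: "kap_energy (real q) P Q < \<infinity>" and krf: "kap_energy (real r) P Q < \<infinity>"
    using kq(1) kr(1) fP fQ by auto
  have brle: "2 * brownian_energy P Q \<le> brownian_energy P P + brownian_energy Q Q" by (rule brownian_energy_mixed_le[OF P(1) Q(1)])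
  then have "2 * brownian_energy P Q < \<infinity>" using fP fQ by (auto intro: le_less_trans)
  then have brf: "brownian_energy P Q < \<infinity>" by (auto simp: ennreal_mult_less_top)
  have br2: "2 * brown_form P Q \<le> brown_form P P + brown_form Q Q"
  proof -
    obtain x y z where "brownian_energy P Q = ennreal x" "0 \<le> x" "brownian_energy P P = ennreal y" "0 \<le> y" "brownian_energy Q Q = ennreal z" "0 \<le> z"
      using brf fP fQ by (cases "brownian_energy P Q"; cases "brownian_energy P P"; cases "brownian_energy Q Q") auto
    note xyz = this
    from brle have "ennreal (2 * x) \<le> ennreal (y + z)" using xyz by (simp add: ennreal_mult ennreal_plus)
    then have "2 * x \<le> y + z" using xyz by (subst (asm) ennreal_le_iff) auto
    then show ?thesis using xyz by (simp add: brown_form_def)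
  qed
  define a where "a = \<theta> * brown_form P P + kap_form (real q) P P / 2 + kap_form (real r) P P / 2 + ra P + ra P"
  define b where "b = \<theta> * brown_form Q Q + kap_form (real q) Q Q / 2 + kap_form (real r) Q Q / 2 + ra Q + ra Q"
  define x where "x = \<theta> * brown_form P Q + kap_form (real q) P Q / 2 + kap_form (real r) P Q / 2 + ra P + ra Q"
  have NA: "raised_energy A A = ennreal a" "0 \<le> a"
    unfolding P(2) a_def ra_def by (rule raised_energy_real[OF P(1) P(1)]; use fP in simp)+
  have NB: "raised_energy B B = ennreal b" "0 \<le> b"
    unfolding Q(2) b_def ra_def by (rule raised_energy_real[OF Q(1) Q(1)]; use fQ in simp)+
  have NX: "raised_energy A B = ennreal x" "0 \<le> x"
    unfolding P(2) Q(2) x_def ra_def by (rule raised_energy_real[OF P(1) Q(1)]; use fP fQ kqf krf brf in simp)+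
  note NAA = NA(1) and NBB = NB(1) and NAB = NX(1) and nn = NA(2) NB(2) NX(2)
  have ab: "a = b" using eq NAA NBB nn by simp
  have "raised_energy A A \<le> ennreal (1/4) * (raised_energy A A + raised_energy A B + (raised_energy B A + raised_energy B B))"
    unfolding mix[symmetric] by (intro A(3) prob_on_halfline_mix A(1) B(1))
  then have "ennreal a \<le> ennreal (1/4 * (a + x + (x + b)))"
    unfolding raised_energy_sym[OF DB DA] NAA NBB NAB using nn by (simp only: ennreal_plus[symmetric] ennreal_mult[symmetric] add_nonneg_nonneg zero_le_divide_1_iff zero_le_numeral)
  then have "a \<le> 1/4 * (a + x + (x + b))" using nn by (subst (asm) ennreal_le_iff) auto
  \<comment> \<open>The reverse of the parallelogram inequality, forced by the minimality of \<open>A\<close> against the midpoint.\<close>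
  then have xge: "a + b \<le> 2 * x" using ab by simp
  have t: "\<theta> * (2 * brown_form P Q) \<le> \<theta> * (brown_form P P + brown_form Q Q)" using theta br2 by (intro mult_left_mono) auto
  have kq2: "2 * kap_form (real q) P Q \<le> kap_form (real q) P P + kap_form (real q) Q Q"
    and kr2: "2 * kap_form (real r) P Q \<le> kap_form (real r) P P + kap_form (real r) Q Q"
    using kq(2) kr(2) fP fQ by auto
  have "kap_form (real q) P P + kap_form (real q) Q Q \<le> 2 * kap_form (real q) P Q"
    using xge t kr2 unfolding a_def b_def x_def by (simp add: algebra_simps)
  then have "2 * kap_form (real q) P Q = kap_form (real q) P P + kap_form (real q) Q Q" using kq2 by simp
  then have "P = Q" using kq(3) fP fQ by auto
  then show ?thesis using P(2) Q(2) by simp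
qed

text \<open>Let \<open>m\<close> be the minimal energy and let \<open>K = {0..R}\<close> be such that the kernel is at least
\<open>m + 1\<close> outside \<open>K \<times> K\<close>. If \<open>K\<close> has mass \<open>s\<close>, conditioning on \<open>K\<close> gives a competitor, so the part
of the energy in \<open>K \<times> K\<close> is at least \<open>m s\<^sup>2\<close>. Then \<open>m s\<^sup>2 + (m + 1) (1 - s\<^sup>2) \<le> m\<close>, so \<open>s = 1\<close>.\<close>

theorem raised_energy_minimizer_bounded:
  assumes A: "prob_on_halfline A" "raised_energy A A < \<infinity>" "\<And>M. prob_on_halfline M \<Longrightarrow> raised_energy A A \<le> raised_energy M M"
  shows "\<exists>R>0. emeasure A (- {0..R}) = 0"
proof -
  note D = prob_on_halflineD[OF A(1)]
  interpret A: real_distribution A by (rule D)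
  obtain m where m: "raised_energy A A = ennreal m" "m \<ge> 0" using A(2) by (cases "raised_energy A A") auto
  obtain R where R: "R > 0" "\<And>x. x > R \<Longrightarrow> raised x \<ge> m + 1" using raised_at_top by blast
  define K where "K = {0..R}"
  have [measurable]: "K \<in> sets borel" by (simp add: K_def)
  define s where "s = A.prob K"
  have s01: "0 \<le> s" "s \<le> 1" by (simp_all add: s_def)
  have compl: "emeasure A (- K) = ennreal (1 - s)"
    using A.prob_compl[of K] by (simp add: A.emeasure_eq_measure Compl_eq_Diff_UNIV s_def)
  define J where "J = (\<integral>\<^sup>+x. \<integral>\<^sup>+y. raised_kernel x y * indicator K y * indicator K x \<partial>A \<partial>A)"
  have low: "ennreal (m * s\<^sup>2) \<le> J"
  proof (cases "s = 0")
    case False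
    then have s: "s > 0" using s01 by simp
    define U where "U = uniform_measure A K"
    have eK: "emeasure A K = ennreal s" by (simp add: A.emeasure_eq_measure s_def)
    have nnU: "(\<integral>\<^sup>+x. f x \<partial>U) = (\<integral>\<^sup>+x. f x * indicator K x \<partial>A) / ennreal s" if "f \<in> borel_measurable borel" for f
      unfolding U_def using that by (subst nn_integral_uniform_measure) (auto simp: eK)
    have "prob_space U" unfolding U_def using s by (intro prob_space_uniform_measure) (auto simp: eK)
    moreover have "emeasure U {0..} = 1"
    proof -
      have "emeasure U {0..} = emeasure A (K \<inter> {0..}) / emeasure A K" unfolding U_def by (subst emeasure_uniform_measure) auto
      also have "K \<inter> {0..} = K" by (auto simp: K_def)
      also have "emeasure A K / emeasure A K = 1" unfolding eK using s by (simp add: divide_ennreal)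
      finally show ?thesis .
    qed
    ultimately have "prob_on_halfline U" by (simp add: prob_on_halfline_def U_def)
    then have "ennreal m \<le> raised_energy U U" using A(3) m by simp
    also have "raised_energy U U = (\<integral>\<^sup>+x. ((\<integral>\<^sup>+y. raised_kernel x y * indicator K y \<partial>A) / ennreal s) * indicator K x \<partial>A) / ennreal s"
      unfolding raised_energy_def by (subst nnU, measurable)+
    also have "(\<integral>\<^sup>+x. ((\<integral>\<^sup>+y. raised_kernel x y * indicator K y \<partial>A) / ennreal s) * indicator K x \<partial>A) = J / ennreal s"
    proof -
      have "((\<integral>\<^sup>+y. raised_kernel x y * indicator K y \<partial>A) / ennreal s) * indicator K x = (\<integral>\<^sup>+y. raised_kernel x y * indicator K y * indicator K x \<partial>A) / ennreal s" for x
        by (auto split: split_indicator)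
      then show ?thesis unfolding J_def by (simp add: nn_integral_divide)
    qed
    finally have "ennreal m \<le> J / ennreal s / ennreal s" .
    then have "ennreal m * (ennreal s * ennreal s) \<le> J / ennreal s / ennreal s * (ennreal s * ennreal s)" by (rule mult_right_mono) simp
    also have "\<dots> = J"
    proof (cases J)
      case (real j) then show ?thesis using s by (simp add: divide_ennreal ennreal_mult[symmetric])
    next
      case top then show ?thesis using s by (simp add: ennreal_top_divide ennreal_top_mult)
    qed
    finally show ?thesis using m s by (simp add: ennreal_mult power2_eq_square)
  qed simp
  have "J + ennreal ((m + 1) * (1 - s\<^sup>2)) \<le> raised_energy A A"
  proof -
    have outer: "(\<integral>\<^sup>+x. \<integral>\<^sup>+y. ennreal (m + 1) * (1 - indicator K y * indicator K x) \<partial>A \<partial>A) = ennreal ((m + 1) * (1 - s\<^sup>2))"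
    proof -
      have split: "1 - indicator K y * indicator K x = (indicator (- K) x + indicator (- K) y * indicator K x :: ennreal)" for x y
        by (auto split: split_indicator)
      have "(\<integral>\<^sup>+x. \<integral>\<^sup>+y. ennreal (m + 1) * (1 - indicator K y * indicator K x) \<partial>A \<partial>A) = ennreal (m + 1) * (ennreal (1 - s) + ennreal (1 - s) * ennreal s)"
        unfolding split by (simp add: nn_integral_cmult nn_integral_add nn_integral_multc A.emeasure_space_1[simplified] compl)
          (simp add: A.emeasure_eq_measure s_def)
      also have "\<dots> = ennreal ((m + 1) * ((1 - s) + (1 - s) * s))"
        using s01 m by (simp add: ennreal_mult ennreal_plus)
      also have "(1 - s) + (1 - s) * s = 1 - s\<^sup>2" by (simp add: power2_eq_square algebra_simps)
      finally show ?thesis .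
    qed
    have "J + ennreal ((m + 1) * (1 - s\<^sup>2)) = (\<integral>\<^sup>+x. \<integral>\<^sup>+y. raised_kernel x y * indicator K y * indicator K x + ennreal (m + 1) * (1 - indicator K y * indicator K x) \<partial>A \<partial>A)"
      unfolding J_def outer[symmetric] by (simp add: nn_integral_add)
    also have "\<dots> \<le> raised_energy A A" unfolding raised_energy_def
    proof (rule nn_integral_mono_AE, use D(2) in eventually_elim, rule nn_integral_mono_AE, use D(2) in eventually_elim)
      fix x y :: real assume xy: "0 \<le> x" "0 \<le> y"
      show "raised_kernel x y * indicator K y * indicator K x + ennreal (m + 1) * (1 - indicator K y * indicator K x) \<le> raised_kernel x y"
      proof (cases "x \<in> K \<and> y \<in> K")
        case False
        then have "x > R \<or> y > R" using xy by (auto simp: K_def)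
        then have "m + 1 \<le> raised x + raised y" using R(2)[of x] R(2)[of y] raised_nonneg[of x] raised_nonneg[of y] by auto
        then have "ennreal (m + 1) \<le> ennreal (raised x + raised y)" by (rule ennreal_leI)
        also have "\<dots> = ennreal (raised x) + ennreal (raised y)" by (rule ennreal_plus) (rule raised_nonneg)+
        also have "\<dots> \<le> raised_kernel x y" by (rule raised_kernel_lower[OF xy])
        finally show ?thesis using False by (auto split: split_indicator)
      qed auto
    qed
    finally show ?thesis .
  qed
  then have "ennreal (m * s\<^sup>2) + ennreal ((m + 1) * (1 - s\<^sup>2)) \<le> ennreal m"
    unfolding m(1)[symmetric] using low by (meson add_right_mono order_trans)
  moreover have s2: "s\<^sup>2 \<le> 1" using s01 by (simp add: power_le_one)
  ultimately have "ennreal (m * s\<^sup>2 + (m + 1) * (1 - s\<^sup>2)) \<le> ennreal m"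
    using m by (subst ennreal_plus) auto
  then have "m * s\<^sup>2 + (m + 1) * (1 - s\<^sup>2) \<le> m"
    using m(2) by (simp only: ennreal_le_iff)
  then have "1 - s\<^sup>2 \<le> 0" by (simp add: algebra_simps)
  then have "s = 1" using s01 s2 by (simp add: power2_eq_1_iff)
  then show ?thesis using R(1) compl by (auto simp: K_def)
qed

text \<open>Compact support bounds the positive part, and the energy for \<open>kap q\<close> controls that
for \<open>kap 1\<close>.\<close>

theorem minimizer_log_law:
  assumes A: "prob_on_halfline A" "raised_energy A A < \<infinity>" "R > 0" "emeasure A (- {0..R}) = 0"
  shows "\<exists>P. finite_energy_law P \<and> A = scaled_law 1 1 P"
proof -
  obtain P where P: "real_distribution P" "A = scaled_law 1 1 P" using finite_raised_energy_log_law[OF A(1,2)] by blast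
  interpret P: real_distribution P by (rule P)
  have fin: "brownian_energy P P < \<infinity>" "kap_energy (real q) P P < \<infinity>"
    using A(2) theta unfolding P(2) raised_energy_exp[OF P(1) P(1)] by (auto simp: ennreal_mult_less_top)
  have "kap_energy 1 P P \<le> (kap_energy (real q) P P)"
    using q by (intro nn_integral_mono kap_mono) auto
  then have 1: "kap_energy 1 P P < \<infinity>" using fin(2) by (rule le_less_trans)
  have "emeasure P {u. exp u \<notin> {0..R}} = 0"
    using A(4) unfolding P(2) by (subst (asm) emeasure_scaled_law[OF P(1)]) (auto simp: Compl_eq)
  then have "AE u in P. exp u \<in> {0..R}" by (intro AE_I[of _ _ "{u. exp u \<notin> {0..R}}"]) auto
  then have ae: "AE u in P. max u 0 \<le> max (ln R) 0"
  proof eventually_elim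
    case (elim u)
    then have "u \<le> ln R" using A(3) by (subst ln_ge_iff) auto
    then show ?case by auto
  qed
  have "(\<integral>\<^sup>+u. ennreal (max u 0) \<partial>P) \<le> (\<integral>\<^sup>+u. ennreal (max (ln R) 0) \<partial>P)"
    by (rule nn_integral_mono_AE) (use ae in eventually_elim, rule ennreal_leI)
  also have "\<dots> < \<infinity>" by (simp add: P.emeasure_space_1[simplified])
  finally show ?thesis using 1 fin(1) P by (auto simp: finite_energy_law_def)
qed

section \<open>Substitution of the q-th root\<close>

lemma prob_on_halfline_root: "prob_on_halfline M \<Longrightarrow> prob_on_halfline (distr M borel (root q))"
proof -
  assume M: "prob_on_halfline M"
  note D = prob_on_halflineD[OF M]
  interpret real_distribution M by (rule D)
  have [measurable]: "root q \<in> measurable M borel" by (simp add: measurable_root)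
  have "AE x in distr M borel (root q). 0 \<le> x"
    using D(2) by (subst AE_distr_iff) (auto elim!: eventually_mono simp: real_root_ge_zero)
  moreover have "real_distribution (distr M borel (root q))"
    unfolding real_distribution_def real_distribution_axioms_def by (auto intro!: prob_space_distr)
  ultimately show ?thesis by (intro prob_on_halflineI)
qed

text \<open>Substituting \<open>x \<mapsto> x\<^bsup>1/q\<^esup>\<close> turns the kernels \<open>ln \<bar>x - y\<bar>\<close> and \<open>ln \<bar>x\<^bsup>q/r\<^esup> - y\<^bsup>q/r\<^esup>\<bar>\<close> into those of the
\<open>q\<close>-th and the \<open>r\<close>-th root.\<close>

lemma mu_energy_root:
  assumes M: "prob_on_halfline M"
  shows "mu_energy (real q / real r) (\<lambda>x. Vh (x ^ q)) (distr M borel (root q)) = nu_energy q r Vh M"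
proof -
  note D = prob_on_halflineD[OF M]
  interpret real_distribution M by (rule D)
  let ?M' = "distr M borel (root q)"
  have [measurable]: "root q \<in> measurable M borel" by (simp add: measurable_root)
  interpret M': prob_space ?M' by (rule prob_space_distr) measurable
  have pull: "(\<integral>\<^sup>+z. F z \<partial>(?M' \<Otimes>\<^sub>M ?M')) = (\<integral>\<^sup>+z. F (root q (fst z), root q (snd z)) \<partial>(M \<Otimes>\<^sub>M M))"
    if [measurable]: "F \<in> borel_measurable (borel \<Otimes>\<^sub>M borel)" for F
    by (subst M'.nn_integral_fst[symmetric], simp, subst nn_integral_fst[symmetric], measurable)
       (simp add: nn_integral_distr)
  note half = AE_pair_halfline[OF M] and half' = AE_pair_halfline[OF prob_on_halfline_root[OF M]]
  define F where "F z = log_kernel (fst z) (snd z) / 2 + log_kernel (fst z powr (real q / real r)) (snd z powr (real q / real r)) / 2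
     + ereal (V (fst z ^ q) / 2) + ereal (V (snd z ^ q) / 2)" for z
  have [measurable]: "F \<in> borel_measurable (borel \<Otimes>\<^sub>M borel)" unfolding F_def by measurable
  have F_eq: "F (root q x, root q y) = field_kernel x y" if "0 \<le> x" "0 \<le> y" for x y
  proof -
    have p: "root q z powr (real q / real r) = root r z" if "0 \<le> z" for z
    proof (cases "z = 0")
      case False
      then have "z > 0" using that by simp
      then show ?thesis using q r by (simp add: root_powr_inverse powr_powr)
    qed simp
    show ?thesis using that q by (simp add: F_def field_kernel_def p)
  qed
  have c1: "AE z in ?M' \<Otimes>\<^sub>M ?M'. (case z of (x, y) \<Rightarrow> log_kernel x y / 2 + log_kernel (x powr (real q / real r)) (y powr (real q / real r)) / 2
     + ereal (Vh (x ^ q) / 2) + ereal (Vh (y ^ q) / 2)) = F z"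
    using half' by eventually_elim (auto simp: F_def V_def split_beta')
  have c2: "AE z in M \<Otimes>\<^sub>M M. F (root q (fst z), root q (snd z)) = (case z of (x, y) \<Rightarrow> log_kernel (root q x) (root q y) / 2 + log_kernel (root r x) (root r y) / 2 + ereal (Vh x / 2) + ereal (Vh y / 2))"
    using half by eventually_elim (auto simp: F_eq field_kernel_def V_def split_beta')
  have "ereal_integral (?M' \<Otimes>\<^sub>M ?M') F = ereal_integral (M \<Otimes>\<^sub>M M) (\<lambda>z. F (root q (fst z), root q (snd z)))"
    unfolding ereal_integral_def by (subst (1 2) pull) auto
  moreover have "ereal_integral Q f = ereal_integral Q g" if "AE z in Q. f z = g z" for Q :: "(real \<times> real) measure" and f g
  proof -
    have "(\<integral>\<^sup>+z. e2ennreal (f z) \<partial>Q) = (\<integral>\<^sup>+z. e2ennreal (g z) \<partial>Q)" "(\<integral>\<^sup>+z. e2ennreal (- f z) \<partial>Q) = (\<integral>\<^sup>+z. e2ennreal (- g z) \<partial>Q)"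
      by (rule nn_integral_cong_AE; use that in eventually_elim; simp)+
    then show ?thesis by (simp add: ereal_integral_def)
  qed
  note cong = this
  ultimately show ?thesis unfolding mu_energy_def nu_energy_def using cong[OF c1] cong[OF c2] by simp
qed

lemma root_pushforward_surj:
  assumes M: "prob_on_halfline M"
  shows "prob_on_halfline (distr M borel (\<lambda>x. x ^ q))" "distr (distr M borel (\<lambda>x. x ^ q)) borel (root q) = M"
proof -
  note D = prob_on_halflineD[OF M]
  interpret real_distribution M by (rule D)
  have "AE x in distr M borel (\<lambda>x. x ^ q). 0 \<le> x"
    using D(2) by (subst AE_distr_iff) (auto elim!: eventually_mono)
  moreover have "real_distribution (distr M borel (\<lambda>x. x ^ q))"
    unfolding real_distribution_def real_distribution_axioms_def by (auto intro!: prob_space_distr)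
  ultimately show "prob_on_halfline (distr M borel (\<lambda>x. x ^ q))" by (intro prob_on_halflineI)
  have "distr (distr M borel (\<lambda>x. x ^ q)) borel (root q) = distr M borel (\<lambda>x. root q (x ^ q))"
    by (subst distr_distr) (auto simp: measurable_root comp_def)
  also have "\<dots> = M"
  proof (rule measure_eqI)
    fix B assume "B \<in> sets (distr M borel (\<lambda>x. root q (x ^ q)))"
    then have B [measurable]: "B \<in> sets borel" by simp
    have [measurable]: "(\<lambda>x. root q (x ^ q)) \<in> borel_measurable borel" by measurable
    have "emeasure (distr M borel (\<lambda>x. root q (x ^ q))) B = emeasure M {x. root q (x ^ q) \<in> B}"
      by (subst emeasure_distr) (auto simp: vimage_def)
    also have "\<dots> = emeasure M B"
    proof (rule emeasure_eq_AE)
      show "AE x in M. x \<in> {x. root q (x ^ q) \<in> B} \<longleftrightarrow> x \<in> B"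
        using D(2) by eventually_elim (use q in \<open>simp add: real_root_power_cancel\<close>)
      have "{x \<in> space borel. root q (x ^ q) \<in> B} \<in> sets borel" by measurable
      then show "{x. root q (x ^ q) \<in> B} \<in> sets M" by simp
    qed (use B in simp)
    finally show "emeasure (distr M borel (\<lambda>x. root q (x ^ q))) B = emeasure M B" .
  qed simp
  finally show "distr (distr M borel (\<lambda>x. x ^ q)) borel (root q) = M" .
qed

theorem nu_and_mu_minimizer:
  "\<exists>A P R. prob_on_halfline A \<and> finite_energy_law P \<and> A = scaled_law 1 1 P \<and> 0 < R \<and> emeasure A (- {0..R}) = 0 \<and>
     is_unique_minimizer (nu_energy q r Vh) prob_on_halfline A \<and>
     is_unique_minimizer (mu_energy (real q / real r) (\<lambda>x. Vh (x ^ q))) prob_on_halfline (distr A borel (root q))"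
proof -
  obtain A where A: "prob_on_halfline A" "raised_energy A A < \<infinity>" "\<And>M. prob_on_halfline M \<Longrightarrow> raised_energy A A \<le> raised_energy M M"
    using raised_energy_minimizer_exists by blast
  obtain R where R: "R > 0" "emeasure A (- {0..R}) = 0" using raised_energy_minimizer_bounded[OF A] by blast
  obtain P where P: "finite_energy_law P" "A = scaled_law 1 1 P" using minimizer_log_law[OF A(1,2) R] by blast
  have iff: "is_arg_min (nu_energy q r Vh) prob_on_halfline B \<longleftrightarrow> prob_on_halfline B \<and> (\<forall>M. prob_on_halfline M \<longrightarrow> raised_energy B B \<le> raised_energy M M)" for B
    unfolding is_arg_min_def using nu_energy_less_iff by (auto simp: not_less[symmetric])
  have nu: "is_unique_minimizer (nu_energy q r Vh) prob_on_halfline A"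
    unfolding is_unique_minimizer_def iff using A raised_energy_minimizer_unique[OF A] by metis
  have transfer: "is_arg_min (nu_energy q r Vh) prob_on_halfline (distr B borel (\<lambda>x. x ^ q))"
    if B: "is_arg_min (mu_energy (real q / real r) (\<lambda>x. Vh (x ^ q))) prob_on_halfline B" for B
  proof -
    have B0: "prob_on_halfline B" using B by (simp add: is_arg_min_def)
    note pB = root_pushforward_surj[OF B0]
    have "\<not> nu_energy q r Vh M < nu_energy q r Vh (distr B borel (\<lambda>x. x ^ q))" if M: "prob_on_halfline M" for M
      using B prob_on_halfline_root[OF M] mu_energy_root[OF M] mu_energy_root[OF pB(1)] pB(2) by (auto simp: is_arg_min_def)
    then show ?thesis using pB(1) by (auto simp: is_arg_min_def)
  qed
  have "is_unique_minimizer (mu_energy (real q / real r) (\<lambda>x. Vh (x ^ q))) prob_on_halfline (distr A borel (root q))"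
    unfolding is_unique_minimizer_def
  proof (intro conjI allI impI)
    show "is_arg_min (mu_energy (real q / real r) (\<lambda>x. Vh (x ^ q))) prob_on_halfline (distr A borel (root q))"
      unfolding is_arg_min_def
    proof (intro conjI notI prob_on_halfline_root A(1))
      assume "\<exists>y. prob_on_halfline y \<and> mu_energy (real q / real r) (\<lambda>x. Vh (x ^ q)) y < mu_energy (real q / real r) (\<lambda>x. Vh (x ^ q)) (distr A borel (root q))"
      then obtain B where B: "prob_on_halfline B" "mu_energy (real q / real r) (\<lambda>x. Vh (x ^ q)) B < nu_energy q r Vh A"
        using mu_energy_root[OF A(1)] by auto
      have "nu_energy q r Vh (distr B borel (\<lambda>x. x ^ q)) < nu_energy q r Vh A"
        using B(2) mu_energy_root[OF root_pushforward_surj(1)[OF B(1)]] root_pushforward_surj(2)[OF B(1)] by simp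
      then show False using nu root_pushforward_surj(1)[OF B(1)] by (auto simp: is_unique_minimizer_def is_arg_min_def)
    qed
    fix B assume B: "is_arg_min (mu_energy (real q / real r) (\<lambda>x. Vh (x ^ q))) prob_on_halfline B"
    then have "distr B borel (\<lambda>x. x ^ q) = A" using transfer[OF B] nu by (auto simp: is_unique_minimizer_def)
    then show "B = distr A borel (root q)"
      using root_pushforward_surj(2)[of B] B by (simp add: is_arg_min_def)
  qed
  then show ?thesis using A(1) P R nu by blast
qed

end

section \<open>The vector problem\<close>

definition side :: "int \<Rightarrow> real" where "side j = (if even j then 1 else - 1)"

lemma abs_side [simp]: "\<bar>side j\<bar> = 1" by (simp add: side_def)

lemma side_Suc: "side (j + 1) = - side j" by (simp add: side_def)

lemma side_exp_in_Delta: "side j * exp u \<in> Delta j" by (simp add: side_def Delta_def)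

lemma closed_Delta: "closed (Delta j)" by (simp add: Delta_def)

lemma index_set_cases:
  assumes "j \<in> index_set q r"
  obtains i where "j = int i" "i < r" | i where "j = - int i" "1 \<le> i" "i < q"
proof (cases "j \<ge> 0")
  case True
  with assms show ?thesis by (intro that(1)[of "nat j"]) (auto simp: index_set_def)
next
  case False
  with assms show ?thesis by (intro that(2)[of "nat (- j)"]) (auto simp: index_set_def)
qed

lemma index_set_int: "int i \<in> index_set q r \<longleftrightarrow> i < r" if "q \<ge> 1"
  using that by (auto simp: index_set_def)

lemma index_set_minus_int: "- int i \<in> index_set q r \<longleftrightarrow> i < q" if "r \<ge> 1"
  using that by (auto simp: index_set_def)

lemma mass_int: "mass q r (int i) = 1 - real i / real r" by (simp add: mass_def)

lemma mass_minus_int: "mass q r (- int i) = 1 - real i / real q" by (simp add: mass_def)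

lemma mass_pos: "j \<in> index_set q r \<Longrightarrow> mass q r j > 0"
  by (erule index_set_cases) (auto simp: mass_int mass_minus_int)

definition law_vector :: "nat \<Rightarrow> nat \<Rightarrow> (int \<Rightarrow> real measure) \<Rightarrow> int \<Rightarrow> real measure" where
  "law_vector q r \<pi> = restrict (\<lambda>j. scaled_law (side j) (mass q r j) (\<pi> j)) (index_set q r)"

lemma law_vector_admissible:
  assumes "\<And>j. j \<in> index_set q r \<Longrightarrow> finite_energy_law (\<pi> j)"
  shows "admissible q r (law_vector q r \<pi>)"
  unfolding admissible_def
proof (intro conjI ballI)
  show "law_vector q r \<pi> \<in> extensional (index_set q r)" by (simp add: law_vector_def)
  fix j assume j: "j \<in> index_set q r"
  let ?M = "scaled_law (side j) (mass q r j) (\<pi> j)"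
  have M: "law_vector q r \<pi> j = ?M" using j by (simp add: law_vector_def)
  note fe = assms[OF j] and D = finite_energy_law_dist[OF assms[OF j]]
  interpret real_distribution "\<pi> j" by (rule D)
  have [measurable]: "Delta j \<in> sets borel" using closed_Delta by (rule borel_closed)
  show "sets (law_vector q r \<pi> j) = sets borel" by (simp add: M)
  have "emeasure ?M (- Delta j) = 0"
    by (subst emeasure_scaled_law[OF D]) (auto simp: side_exp_in_Delta)
  then show "measure_support (law_vector q r \<pi> j) \<subseteq> Delta j"
    unfolding M by (intro support_subset_closed closed_Delta)
  show "emeasure (law_vector q r \<pi> j) (Delta j) = ennreal (mass q r j)"
    unfolding M using emeasure_space_1 by (subst emeasure_scaled_law[OF D]) (auto simp: side_exp_in_Delta)
  show "finite_log_energy (law_vector q r \<pi> j)"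
    unfolding M using mass_pos[OF j] by (intro log_energy_scaled_law(2) fe) auto
qed

text \<open>Finite energy excludes an atom at the origin, so that the logarithm is defined almost everywhere.\<close>

lemma admissible_law_vector:
  assumes adm: "admissible q r \<nu>"
  shows "\<exists>\<pi>. (\<forall>j\<in>index_set q r. finite_energy_law (\<pi> j)) \<and> \<nu> = law_vector q r \<pi>"
proof -
  have "\<exists>P. finite_energy_law P \<and> \<nu> j = scaled_law (side j) (mass q r j) P" if j: "j \<in> index_set q r" for j
  proof -
    have s: "sets (\<nu> j) = sets borel" and supp: "measure_support (\<nu> j) \<subseteq> Delta j"
      and mj: "emeasure (\<nu> j) (Delta j) = ennreal (mass q r j)" and fin: "finite_log_energy (\<nu> j)"
      using adm j unfolding admissible_def by auto
    have sp: "space (\<nu> j) = UNIV" using sets_eq_imp_space_eq[OF s] by simp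
    have D: "Delta j \<in> sets (\<nu> j)" "- Delta j \<in> sets (\<nu> j)" using closed_Delta[of j] unfolding s by auto
    have null: "emeasure (\<nu> j) (- Delta j) = 0" by (rule support_null[OF s closed_Delta supp])
    have total: "emeasure (\<nu> j) UNIV = ennreal (mass q r j)"
      using plus_emeasure[OF D] null mj by (simp add: Compl_partition)
    have fm: "finite_measure (\<nu> j)" by (intro finite_measureI) (simp add: sp total)
    have "AE x in \<nu> j. x \<in> Delta j" using null D by (intro AE_I[of _ _ "- Delta j"]) auto
    moreover have "AE x in \<nu> j. x \<noteq> 0"
      using finite_log_energy_no_atom[OF s fm fin, of 0] s by (intro AE_I[of _ _ "{0}"]) auto
    ultimately have "AE x in \<nu> j. side j * x > 0"
      by eventually_elim (auto simp: side_def Delta_def split: if_splits)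
    then obtain P where P: "real_distribution P" "\<nu> j = scaled_law (side j) (mass q r j) P"
      using log_law_exists[OF s total mass_pos[OF j] abs_side] by blast
    have "finite_energy_law P"
      using fin unfolding P(2) by (rule finite_energy_law_of_scaled[OF P(1) mass_pos[OF j] abs_side])
    then show ?thesis using P(2) by blast
  qed
  then obtain \<pi> where \<pi>: "\<And>j. j \<in> index_set q r \<Longrightarrow> finite_energy_law (\<pi> j)"
      "\<And>j. j \<in> index_set q r \<Longrightarrow> \<nu> j = scaled_law (side j) (mass q r j) (\<pi> j)"
    by metis
  have "\<nu> = law_vector q r \<pi>"
    using adm \<pi>(2) by (intro extensionalityI[of _ "index_set q r"]) (auto simp: law_vector_def admissible_def)
  then show ?thesis using \<pi>(1) by blast
qed

definition defect_sum :: "nat \<Rightarrow> (nat \<Rightarrow> real measure) \<Rightarrow> real" where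
  "defect_sum r \<pi> = (\<Sum>j<r-1. (1 - real j / real r)\<^sup>2 * chain_defect (real (r - j)) (\<pi> j) (\<pi> (Suc j)))"

lemma defect_sum_nonneg:
  assumes "\<And>j. j < r \<Longrightarrow> finite_energy_law (\<pi> j)"
  shows "defect_sum r \<pi> \<ge> 0"
  unfolding defect_sum_def
  by (intro sum_nonneg mult_nonneg_nonneg chain_defect_nonneg assms) auto

lemma defect_sum_zeroD:
  assumes fe: "\<And>j. j < r \<Longrightarrow> finite_energy_law (\<pi> j)" and z: "defect_sum r \<pi> = 0" and j: "Suc j < r"
  shows "chain_defect (real (r - j)) (\<pi> j) (\<pi> (Suc j)) = 0"
proof -
  have "\<forall>j\<in>{..<r-1}. (1 - real j / real r)\<^sup>2 * chain_defect (real (r - j)) (\<pi> j) (\<pi> (Suc j)) = 0"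
    using z unfolding defect_sum_def
    by (subst (asm) sum_nonneg_eq_0_iff) (auto intro!: mult_nonneg_nonneg chain_defect_nonneg fe)
  moreover have "j \<in> {..<r-1}" using j by simp
  ultimately have "(1 - real j / real r)\<^sup>2 * chain_defect (real (r - j)) (\<pi> j) (\<pi> (Suc j)) = 0" by (rule bspec)
  then show ?thesis using j by auto
qed

lemma index_sum_split:
  fixes f :: "int \<Rightarrow> real"
  assumes "q \<ge> 1" "r \<ge> 1"
  shows "(\<Sum>j\<in>index_set q r. f j) = f 0 + (\<Sum>i=1..<r. f (int i)) + (\<Sum>i=1..<q. f (- int i))"
proof -
  have eq: "index_set q r = insert 0 (int ` {1..<r} \<union> (\<lambda>i. - int i) ` {1..<q})"
  proof (intro set_eqI iffI)
    fix j assume "j \<in> index_set q r"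
    then show "j \<in> insert 0 (int ` {1..<r} \<union> (\<lambda>i. - int i) ` {1..<q})"
      by (rule index_set_cases) (force simp: image_iff)+
  qed (use assms in \<open>auto simp: index_set_def\<close>)
  have "(\<Sum>j\<in>index_set q r. f j) = f 0 + ((\<Sum>j\<in>int ` {1..<r}. f j) + (\<Sum>j\<in>(\<lambda>i. - int i) ` {1..<q}. f j))"
    unfolding eq by (subst sum.insert, force, force, subst sum.union_disjoint) auto
  then show ?thesis by (simp add: sum.reindex inj_on_def)
qed

text \<open>On the negative side the edge that joins \<open>- (i + 1)\<close> and \<open>- i\<close> is the \<open>i\<close>-th edge of the chain of
length \<open>q\<close> counted from the centre.\<close>

lemma edge_sum_split:
  fixes f :: "int \<Rightarrow> real"
  assumes "q \<ge> 1" "r \<ge> 1"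
  shows "(\<Sum>j = - int q + 1 .. int r - 2. f j) = (\<Sum>i<r-1. f (int i)) + (\<Sum>i<q-1. f (- int (Suc i)))"
proof -
  have eq: "{- int q + 1 .. int r - 2} = int ` {..<r-1} \<union> (\<lambda>i. - int (Suc i)) ` {..<q-1}"
  proof (intro set_eqI iffI)
    fix j assume j: "j \<in> {- int q + 1 .. int r - 2}"
    show "j \<in> int ` {..<r-1} \<union> (\<lambda>i. - int (Suc i)) ` {..<q-1}"
    proof (cases "j \<ge> 0")
      case True
      then have "j = int (nat j)" "nat j \<in> {..<r-1}" using j by auto
      then show ?thesis by blast
    next
      case False
      then have "j = - int (Suc (nat (- j - 1)))" "nat (- j - 1) \<in> {..<q-1}" using j by auto
      then show ?thesis by blast
    qed
  qed (use assms in auto)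
  show ?thesis unfolding eq
    by (subst sum.union_disjoint) (auto simp: sum.reindex inj_on_def)
qed

lemma cross_energy_sym:
  assumes "finite_energy_law P" "finite_energy_law Q"
  shows "cross_energy P Q = cross_energy Q P"
  unfolding cross_energy_def using assms by (simp add: brown_form_sym[of P Q] kap_form_sym[of P Q])

text \<open>The energy of the central measure is divided evenly between the two chains, and each half is
decomposed by \<open>chain_energy_decomposition\<close>.\<close>

lemma vector_energy_law_vector:
  assumes q: "q \<ge> 1" and r: "r \<ge> 1" and fe: "\<And>j. j \<in> index_set q r \<Longrightarrow> finite_energy_law (\<pi> j)"
  shows "vector_energy q r Vh (law_vector q r \<pi>) =
    ereal (root_energy (real q) (\<pi> 0) / 2 + root_energy (real r) (\<pi> 0) / 2
       + (defect_sum r (\<lambda>i. \<pi> (int i)) + defect_sum q (\<lambda>i. \<pi> (- int i))) / 2)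
     + ereal_integral (scaled_law 1 1 (\<pi> 0)) (\<lambda>x. ereal (Vh x))"
proof -
  define m where "m = mass q r"
  define S X where "S j = (m j)\<^sup>2 * root_energy 1 (\<pi> j)" and "X j = m j * m (j + 1) * cross_energy (\<pi> j) (\<pi> (j + 1))" for j
  have "(\<Sum>j\<in>index_set q r. log_energy (law_vector q r \<pi> j)) = (\<Sum>j\<in>index_set q r. ereal (S j))"
  proof (rule sum.cong[OF refl])
    fix j assume j: "j \<in> index_set q r"
    show "log_energy (law_vector q r \<pi> j) = ereal (S j)"
      using j mass_pos[OF j] log_energy_scaled_law(1)[OF fe[OF j], of "mass q r j" "side j"] by (simp add: law_vector_def S_def m_def)
  qed
  then have self: "(\<Sum>j\<in>index_set q r. log_energy (law_vector q r \<pi> j)) = ereal (\<Sum>j\<in>index_set q r. S j)" by simp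
  have "(\<Sum>j = - int q + 1 .. int r - 2. mutual_energy (law_vector q r \<pi> j) (law_vector q r \<pi> (j + 1))) = (\<Sum>j = - int q + 1 .. int r - 2. ereal (X j))"
  proof (rule sum.cong[OF refl])
    fix j assume "j \<in> {- int q + 1 .. int r - 2}"
    then have j: "j \<in> index_set q r" "j + 1 \<in> index_set q r" by (auto simp: index_set_def)
    show "mutual_energy (law_vector q r \<pi> j) (law_vector q r \<pi> (j + 1)) = ereal (X j)"
      using j mass_pos[OF j(1)] mass_pos[OF j(2)]
        mutual_energy_scaled_law[OF fe[OF j(1)] fe[OF j(2)], of "mass q r j" "mass q r (j + 1)" "side j"]
      by (simp add: law_vector_def X_def m_def side_Suc)
  qed
  then have cross: "(\<Sum>j = - int q + 1 .. int r - 2. mutual_energy (law_vector q r \<pi> j) (law_vector q r \<pi> (j + 1))) = ereal (\<Sum>j = - int q + 1 .. int r - 2. X j)" by simp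
  have zero: "law_vector q r \<pi> 0 = scaled_law 1 1 (\<pi> 0)"
    using q r by (simp add: law_vector_def index_set_def side_def mass_def)
  have R: "root_energy 1 (\<pi> 0) / 2 + (\<Sum>i=1..<r. S (int i)) - (\<Sum>i<r-1. X (int i)) = root_energy (real r) (\<pi> 0) / 2 + defect_sum r (\<lambda>i. \<pi> (int i)) / 2"
  proof -
    have "(\<Sum>i<r-1. X (int i)) = (\<Sum>i<r-1. (1 - real i / real r) * (1 - real (Suc i) / real r) * cross_energy (\<pi> (int i)) (\<pi> (int (Suc i))))"
    proof (rule sum.cong[OF refl])
      fix i
      have "int i + 1 = int (Suc i)" by simp
      then show "X (int i) = (1 - real i / real r) * (1 - real (Suc i) / real r) * cross_energy (\<pi> (int i)) (\<pi> (int (Suc i)))"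
        unfolding X_def m_def by (simp only: mass_int)
    qed
    then show ?thesis
      using chain_energy_decomposition[OF r, of "\<lambda>i. \<pi> (int i)"] by (simp add: defect_sum_def S_def m_def mass_int del: of_nat_Suc)
  qed
  have L: "root_energy 1 (\<pi> 0) / 2 + (\<Sum>i=1..<q. S (- int i)) - (\<Sum>i<q-1. X (- int (Suc i))) = root_energy (real q) (\<pi> 0) / 2 + defect_sum q (\<lambda>i. \<pi> (- int i)) / 2"
  proof -
    have "(\<Sum>i<q-1. X (- int (Suc i))) = (\<Sum>i<q-1. (1 - real i / real q) * (1 - real (Suc i) / real q) * cross_energy (\<pi> (- int i)) (\<pi> (- int (Suc i))))"
    proof (rule sum.cong[OF refl])
      fix i assume i: "i \<in> {..<q-1}"
      have e: "- int (Suc i) + 1 = - int i" by simp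
      have mem: "- int i \<in> index_set q r" "- int (Suc i) \<in> index_set q r" using i q r by (auto simp: index_set_def)
      have c: "cross_energy (\<pi> (- int (Suc i))) (\<pi> (- int i)) = cross_energy (\<pi> (- int i)) (\<pi> (- int (Suc i)))"
        by (intro cross_energy_sym fe mem)
      show "X (- int (Suc i)) = (1 - real i / real q) * (1 - real (Suc i) / real q) * cross_energy (\<pi> (- int i)) (\<pi> (- int (Suc i)))"
        unfolding X_def m_def e c by (simp only: mass_minus_int mult.commute)
    qed
    then show ?thesis
      using chain_energy_decomposition[OF q, of "\<lambda>i. \<pi> (- int i)"] by (simp add: defect_sum_def S_def m_def mass_minus_int del: of_nat_Suc)
  qed
  have S0: "S 0 = root_energy 1 (\<pi> 0)" by (simp add: S_def m_def mass_def)
  have "(\<Sum>j\<in>index_set q r. S j) - (\<Sum>j = - int q + 1 .. int r - 2. X j) = root_energy (real q) (\<pi> 0) / 2 + root_energy (real r) (\<pi> 0) / 2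
       + (defect_sum r (\<lambda>i. \<pi> (int i)) + defect_sum q (\<lambda>i. \<pi> (- int i))) / 2"
    unfolding index_sum_split[OF q r] edge_sum_split[OF q r] S0 add_divide_distrib using R L by simp
  then show ?thesis unfolding vector_energy_def self cross zero by simp
qed

context external_field
begin

lemma V_exp: "V (exp u) = 2 * raised (exp u) - 2 * shift + 2 * \<theta> * max u 0"
proof -
  have "ln (max (exp u) 1) = max u 0" by (cases "u \<ge> 0") (auto simp: max_def)
  then show ?thesis by (simp add: raised_def confine_def)
qed

lemma potential_integral_exp:
  assumes P: "real_distribution P"
  shows "ereal_integral (scaled_law 1 1 P) (\<lambda>x. ereal (Vh x)) = enn2ereal (\<integral>\<^sup>+u. ennreal (V (exp u)) \<partial>P) - enn2ereal (\<integral>\<^sup>+u. ennreal (- V (exp u)) \<partial>P)"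
proof -
  interpret real_distribution P by (rule P)
  have ae: "AE x in scaled_law 1 1 P. 0 \<le> x" by (rule prob_on_halflineD(2)[OF prob_on_halfline_scaled_law[OF P]])
  have "(\<integral>\<^sup>+x. e2ennreal (ereal (Vh x)) \<partial>scaled_law 1 1 P) = (\<integral>\<^sup>+x. ennreal (V x) \<partial>scaled_law 1 1 P)"
    "(\<integral>\<^sup>+x. e2ennreal (- ereal (Vh x)) \<partial>scaled_law 1 1 P) = (\<integral>\<^sup>+x. ennreal (- V x) \<partial>scaled_law 1 1 P)"
    by (rule nn_integral_cong_AE; use ae in eventually_elim; simp add: V_def e2ennreal_ereal)+
  then show ?thesis unfolding ereal_integral_def by (simp add: nn_integral_scaled_law[OF P])
qed

text \<open>Only the positive part of the potential can diverge, so the vector functional is infinite together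
with the scalar one.\<close>

lemma potential_integral_infinite:
  assumes P: "real_distribution P" and inf: "(\<integral>\<^sup>+u. ennreal (raised (exp u)) \<partial>P) = \<infinity>"
  shows "ereal_integral (scaled_law 1 1 P) (\<lambda>x. ereal (Vh x)) = \<infinity>"
proof -
  interpret real_distribution P by (rule P)
  have nonneg: "0 \<le> 2 * \<theta> * max u 0" for u using theta by simp
  have "(\<integral>\<^sup>+u. ennreal (raised (exp u)) \<partial>P) \<le> (\<integral>\<^sup>+u. ennreal (V (exp u)) + ennreal (2 * shift) \<partial>P)"
  proof (rule nn_integral_mono)
    fix u
    have "raised (exp u) \<le> max (V (exp u)) 0 + 2 * shift"
      using V_exp[of u] nonneg[of u] raised_nonneg[of "exp u"] shift(1) by linarith
    then have "ennreal (raised (exp u)) \<le> ennreal (max (V (exp u)) 0 + 2 * shift)" by (rule ennreal_leI)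
    also have "\<dots> = ennreal (max (V (exp u)) 0) + ennreal (2 * shift)" using shift(1) by (intro ennreal_plus) auto
    finally show "ennreal (raised (exp u)) \<le> ennreal (V (exp u)) + ennreal (2 * shift)" by simp
  qed
  also have "\<dots> = (\<integral>\<^sup>+u. ennreal (V (exp u)) \<partial>P) + ennreal (2 * shift)"
    by (subst nn_integral_add) (auto simp: emeasure_space_1[simplified])
  finally have pos: "(\<integral>\<^sup>+u. ennreal (V (exp u)) \<partial>P) = \<infinity>" using inf by (simp add: top_unique ennreal_add_eq_top)
  have "(\<integral>\<^sup>+u. ennreal (- V (exp u)) \<partial>P) \<le> (\<integral>\<^sup>+u. ennreal (2 * shift) \<partial>P)"
  proof (intro nn_integral_mono ennreal_leI)
    fix u show "- V (exp u) \<le> 2 * shift"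
      using V_exp[of u] nonneg[of u] raised_nonneg[of "exp u"] by linarith
  qed
  also have "\<dots> = ennreal (2 * shift)" by (simp add: emeasure_space_1[simplified])
  finally obtain n where "(\<integral>\<^sup>+u. ennreal (- V (exp u)) \<partial>P) = ennreal n" "n \<ge> 0"
    by (cases "\<integral>\<^sup>+u. ennreal (- V (exp u)) \<partial>P") (auto simp: top_unique)
  then show ?thesis unfolding potential_integral_exp[OF P] pos by (simp add: enn2ereal_ennreal)
qed

text \<open>If in addition the potential is integrable, the combined kernel of the scalar functional may be
integrated term by term.\<close>

lemma nu_energy_log_law:
  assumes fe: "finite_energy_law P" and fin: "(\<integral>\<^sup>+u. ennreal (raised (exp u)) \<partial>P) < \<infinity>"
  shows "\<exists>v. ereal_integral (scaled_law 1 1 P) (\<lambda>x. ereal (Vh x)) = ereal v \<and>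
     nu_energy q r Vh (scaled_law 1 1 P) = ereal (root_energy (real q) P / 2 + root_energy (real r) P / 2 + v)"
proof -
  note P = finite_energy_law_dist[OF fe]
  interpret real_distribution P by (rule P)
  define v where "v = (\<integral>u. V (exp u) \<partial>P)"
  have ri: "integrable P (\<lambda>u. raised (exp u))" using fin raised_nonneg by (intro integrableI_nonneg) auto
  note pi = finite_energy_positive_part[OF fe]
  have Vi: "integrable P (\<lambda>u. V (exp u))" unfolding V_exp using ri pi by simp
  have vI: "v = 2 * (\<integral>u. raised (exp u) \<partial>P) - 2 * shift + 2 * \<theta> * plus_moment P"
    unfolding v_def V_exp plus_moment_def using ri pi prob_space by simp
  have "ereal_integral (scaled_law 1 1 P) (\<lambda>x. ereal (Vh x)) = ereal v"
  proof -
    have "(\<integral>\<^sup>+u. ennreal (V (exp u)) \<partial>P) \<noteq> \<infinity>" "(\<integral>\<^sup>+u. ennreal (- V (exp u)) \<partial>P) \<noteq> \<infinity>"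
      using Vi unfolding real_integrable_def by blast+
    then obtain a b where ab: "(\<integral>\<^sup>+u. ennreal (V (exp u)) \<partial>P) = ennreal a" "0 \<le> a" "(\<integral>\<^sup>+u. ennreal (- V (exp u)) \<partial>P) = ennreal b" "0 \<le> b"
      by (cases "\<integral>\<^sup>+u. ennreal (V (exp u)) \<partial>P"; cases "\<integral>\<^sup>+u. ennreal (- V (exp u)) \<partial>P") auto
    then have "v = a - b" unfolding v_def by (simp add: real_lebesgue_integral_def[OF Vi])
    then show ?thesis unfolding potential_integral_exp[OF P] using ab by (simp add: enn2ereal_ennreal)
  qed
  moreover have "nu_energy q r Vh (scaled_law 1 1 P) = ereal (root_energy (real q) P / 2 + root_energy (real r) P / 2 + v)"
  proof -
    have q0: "real q > 0" "real r > 0" using q r by auto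
    have ra: "enn2real (\<integral>\<^sup>+u. ennreal (raised (exp u)) \<partial>P) = (\<integral>u. raised (exp u) \<partial>P)"
      using raised_nonneg by (subst nn_integral_eq_integral[OF ri]) auto
    define x where "x = \<theta> * brown_form P P + kap_form (real q) P P / 2 + kap_form (real r) P P / 2 + 2 * (\<integral>u. raised (exp u) \<partial>P)"
    have x_eq: "x = \<theta> * brown_form P P + kap_form (real q) P P / 2 + kap_form (real r) P P / 2
       + enn2real (\<integral>\<^sup>+u. ennreal (raised (exp u)) \<partial>P) + enn2real (\<integral>\<^sup>+u. ennreal (raised (exp u)) \<partial>P)"
      unfolding x_def ra by simp
    note pieces = brown_form_integral(1)[OF fe fe] kap_form_fourier(2)[OF fe fe q0(1)] kap_form_fourier(2)[OF fe fe q0(2)] fin fin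
    have raised_energy: "raised_energy (scaled_law 1 1 P) (scaled_law 1 1 P) = ennreal x" and "0 \<le> x"
      unfolding x_eq by (rule raised_energy_real[OF P P pieces])+
    then have "nu_energy q r Vh (scaled_law 1 1 P) = ereal (x - 2 * shift)"
      unfolding nu_energy_eq[OF prob_on_halfline_scaled_law[OF P]] raised_energy by (simp add: enn2ereal_ennreal)
    also have "x - 2 * shift = root_energy (real q) P / 2 + root_energy (real r) P / 2 + v"
    proof -
      have "t * B + k / 2 + l / 2 + 2 * d - 2 * s = ((B - 2 * p) * x + k) / 2 + ((B - 2 * p) * y + l) / 2 + (2 * d - 2 * s + 2 * t * p)"
        if "t = (x + y) / 2" for t B k l d s p x y :: real
        unfolding that by (simp add: algebra_simps add_divide_distrib diff_divide_distrib)
      from this[OF \<theta>_def] show ?thesis unfolding vI root_energy_def x_def by simp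
    qed
    finally show ?thesis .
  qed
  ultimately show ?thesis by blast
qed

text \<open>The reduction of the vector problem to the scalar one: the two functionals differ by half of the
nonnegative sum of the defects of both chains.\<close>

theorem vector_energy_ge_nu_energy:
  assumes fe: "\<And>j. j \<in> index_set q r \<Longrightarrow> finite_energy_law (\<pi> j)"
  defines "d \<equiv> defect_sum r (\<lambda>i. \<pi> (int i)) + defect_sum q (\<lambda>i. \<pi> (- int i))"
  shows "nu_energy q r Vh (scaled_law 1 1 (\<pi> 0)) \<le> vector_energy q r Vh (law_vector q r \<pi>)"
    and "nu_energy q r Vh (scaled_law 1 1 (\<pi> 0)) \<noteq> \<infinity> \<Longrightarrow>
       vector_energy q r Vh (law_vector q r \<pi>) = nu_energy q r Vh (scaled_law 1 1 (\<pi> 0)) + ereal (d / 2)"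
    and "d \<ge> 0"
proof -
  have 0: "0 \<in> index_set q r" using q r by (simp add: index_set_def)
  note P = finite_energy_law_dist[OF fe[OF 0]]
  show d: "d \<ge> 0" unfolding d_def using q r
    by (intro add_nonneg_nonneg defect_sum_nonneg fe) (auto simp: index_set_int index_set_minus_int)
  have v: "vector_energy q r Vh (law_vector q r \<pi>) = ereal (root_energy (real q) (\<pi> 0) / 2 + root_energy (real r) (\<pi> 0) / 2 + d / 2)
     + ereal_integral (scaled_law 1 1 (\<pi> 0)) (\<lambda>x. ereal (Vh x))"
    unfolding d_def by (rule vector_energy_law_vector[OF q r fe])
  have fin: "vector_energy q r Vh (law_vector q r \<pi>) = nu_energy q r Vh (scaled_law 1 1 (\<pi> 0)) + ereal (d / 2)"
    if raised_fin: "(\<integral>\<^sup>+u. ennreal (raised (exp u)) \<partial>\<pi> 0) < \<infinity>"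
  proof -
    obtain w where w: "ereal_integral (scaled_law 1 1 (\<pi> 0)) (\<lambda>x. ereal (Vh x)) = ereal w"
        "nu_energy q r Vh (scaled_law 1 1 (\<pi> 0)) = ereal (root_energy (real q) (\<pi> 0) / 2 + root_energy (real r) (\<pi> 0) / 2 + w)"
      using nu_energy_log_law[OF fe[OF 0] raised_fin] by blast
    show ?thesis unfolding v w by simp
  qed
  have inf: "vector_energy q r Vh (law_vector q r \<pi>) = \<infinity>" "nu_energy q r Vh (scaled_law 1 1 (\<pi> 0)) = \<infinity>"
    if "\<not> (\<integral>\<^sup>+u. ennreal (raised (exp u)) \<partial>\<pi> 0) < \<infinity>"
  proof -
    have i: "(\<integral>\<^sup>+u. ennreal (raised (exp u)) \<partial>\<pi> 0) = \<infinity>" using that by (simp add: less_top[symmetric])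
    show "vector_energy q r Vh (law_vector q r \<pi>) = \<infinity>" unfolding v potential_integral_infinite[OF P i] by simp
    show "nu_energy q r Vh (scaled_law 1 1 (\<pi> 0)) = \<infinity>"
      unfolding nu_energy_eq[OF prob_on_halfline_scaled_law[OF P]] raised_energy_exp[OF P P] i by simp
  qed
  show "nu_energy q r Vh (scaled_law 1 1 (\<pi> 0)) \<le> vector_energy q r Vh (law_vector q r \<pi>)"
  proof (cases "(\<integral>\<^sup>+u. ennreal (raised (exp u)) \<partial>\<pi> 0) < \<infinity>")
    case True
    have "nu_energy q r Vh (scaled_law 1 1 (\<pi> 0)) + 0 \<le> nu_energy q r Vh (scaled_law 1 1 (\<pi> 0)) + ereal (d / 2)"
      using d by (intro add_left_mono) simp
    then show ?thesis using fin[OF True] by simp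
  qed (simp add: inf)
  show "vector_energy q r Vh (law_vector q r \<pi>) = nu_energy q r Vh (scaled_law 1 1 (\<pi> 0)) + ereal (d / 2)"
    if "nu_energy q r Vh (scaled_law 1 1 (\<pi> 0)) \<noteq> \<infinity>"
    using that fin inf by blast
qed

end

lemma scaled_law_inject:
  assumes P: "real_distribution P" and Q: "real_distribution Q" and eq: "scaled_law 1 1 P = scaled_law 1 1 Q"
  shows "P = Q"
proof -
  have recover: "distr (scaled_law 1 1 X) borel ln = X" if X: "real_distribution X" for X
  proof -
    interpret real_distribution X by (rule X)
    show ?thesis
    proof (rule measure_eqI)
      fix A assume "A \<in> sets (distr (scaled_law 1 1 X) borel ln)"
      then have A [measurable]: "A \<in> sets borel" by simp
      have "emeasure (distr (scaled_law 1 1 X) borel ln) A = emeasure (scaled_law 1 1 X) (ln -` A)"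
        by (subst emeasure_distr) auto
      also have "\<dots> = emeasure X A"
      proof -
        have "(ln :: real \<Rightarrow> real) -` A \<in> sets borel" using measurable_sets[of "ln :: real \<Rightarrow> real" borel borel A] A by simp
        then show ?thesis by (subst emeasure_scaled_law[OF X]) auto
      qed
      finally show "emeasure (distr (scaled_law 1 1 X) borel ln) A = emeasure X A" .
    qed simp
  qed
  show ?thesis using recover[OF P] recover[OF Q] unfolding eq by (rule trans[OF sym])
qed

text \<open>The scalar minimizer is continued along both chains without defect. Every admissible vector has at
least the scalar energy of its central measure, so this vector is minimal; a second minimizer has
the same central measure by uniqueness in the scalar problem, no defects, and therefore the same
continuation.\<close>

theorem theorem1p2:
  fixes q r :: nat and Vh :: "real \<Rightarrow> real"
  assumes "q \<ge> 1" and "r \<ge> 1"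
    and "continuous_on {0..} Vh"
    and "filterlim (\<lambda>x. Vh x - ln (1 + x\<^sup>2)) at_top at_top"
  shows "\<exists>\<nu> :: int \<Rightarrow> real measure.
      is_unique_minimizer (vector_energy q r Vh) (admissible q r) \<nu> \<and>
      compact (measure_support (\<nu> 0)) \<and>
      is_unique_minimizer (nu_energy q r Vh) prob_on_halfline (\<nu> 0) \<and>
      is_unique_minimizer (mu_energy (real q / real r) (\<lambda>x. Vh (x ^ q))) prob_on_halfline
        (distr (\<nu> 0) borel (root q))"
proof -
  interpret external_field q r Vh by unfold_locales (fact assms)+
  obtain A P R where A: "prob_on_halfline A" and P: "finite_energy_law P" "A = scaled_law 1 1 P"
    and R: "0 < R" "emeasure A (- {0..R}) = 0"
    and nu: "is_unique_minimizer (nu_energy q r Vh) prob_on_halfline A"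
    and mu: "is_unique_minimizer (mu_energy (real q / real r) (\<lambda>x. Vh (x ^ q))) prob_on_halfline (distr A borel (root q))"
    using nu_and_mu_minimizer by blast
  obtain \<alpha> where \<alpha>: "\<alpha> 0 = P" "\<forall>j<r. finite_energy_law (\<alpha> j)"
      "\<forall>j. Suc j < r \<longrightarrow> chain_defect (real (r - j)) (\<alpha> j) (\<alpha> (Suc j)) = 0"
    using chain_extension_exists[OF P(1) assms(2)] by blast
  obtain \<beta> where \<beta>: "\<beta> 0 = P" "\<forall>j<q. finite_energy_law (\<beta> j)"
      "\<forall>j. Suc j < q \<longrightarrow> chain_defect (real (q - j)) (\<beta> j) (\<beta> (Suc j)) = 0"
    using chain_extension_exists[OF P(1) assms(1)] by blast
  have nuA: "nu_energy q r Vh A \<le> nu_energy q r Vh M" if "prob_on_halfline M" for M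
    using nu that by (simp add: is_unique_minimizer_def is_arg_min_linorder)
  define \<pi> where "\<pi> j = (if j \<ge> 0 then \<alpha> (nat j) else \<beta> (nat (- j)))" for j :: int
  have \<pi>R: "\<pi> (int i) = \<alpha> i" for i by (simp add: \<pi>_def)
  have \<pi>L: "\<pi> (- int i) = \<beta> i" for i using \<alpha>(1) \<beta>(1) by (cases "i = 0") (auto simp: \<pi>_def)
  have \<pi>0: "\<pi> 0 = P" using \<pi>R[of 0] \<alpha>(1) by simp
  have fe: "finite_energy_law (\<pi> j)" if "j \<in> index_set q r" for j
    using that by (rule index_set_cases) (auto simp: \<pi>R \<pi>L \<alpha>(2) \<beta>(2))
  define \<nu> where "\<nu> = law_vector q r \<pi>"
  have adm: "admissible q r \<nu>" unfolding \<nu>_def by (rule law_vector_admissible[OF fe])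
  have idx0: "0 \<in> index_set q r" using assms by (simp add: index_set_def)
  have \<nu>0: "law_vector q r \<pi>' 0 = scaled_law 1 1 (\<pi>' 0)" for \<pi>'
    using idx0 by (simp add: law_vector_def side_def mass_def)
  have \<nu>0A: "\<nu> 0 = A" unfolding \<nu>_def \<nu>0 \<pi>0 P(2) ..
  have nuA_fin: "nu_energy q r Vh A \<noteq> \<infinity>" "nu_energy q r Vh A \<noteq> - \<infinity>"
  proof -
    obtain B where B: "prob_on_halfline B" "raised_energy B B < \<infinity>" using finite_raised_energy_example by blast
    have "raised_energy A A \<le> raised_energy B B" using nuA[OF B(1)] nu_energy_less_iff[OF B(1) A] by (simp flip: not_less)
    then have "raised_energy A A < \<infinity>" using B(2) by (rule le_less_trans)
    then show "nu_energy q r Vh A \<noteq> \<infinity>" "nu_energy q r Vh A \<noteq> - \<infinity>"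
      unfolding nu_energy_eq[OF A] by (cases "raised_energy A A"; simp add: enn2ereal_ennreal)+
  qed
  have d0: "defect_sum r (\<lambda>i. \<pi> (int i)) + defect_sum q (\<lambda>i. \<pi> (- int i)) = 0"
    unfolding \<pi>R \<pi>L defect_sum_def using \<alpha>(3) \<beta>(3) by (simp add: less_diff_conv)
  have val: "vector_energy q r Vh \<nu> = nu_energy q r Vh A"
    using vector_energy_ge_nu_energy(2)[of \<pi>, OF fe] nuA_fin(1) unfolding d0 \<pi>0 P(2)[symmetric] \<nu>_def by simp
  have lower: "nu_energy q r Vh A \<le> vector_energy q r Vh \<nu>'" if a: "admissible q r \<nu>'" for \<nu>'
  proof -
    obtain \<pi>' where \<pi>': "\<forall>j\<in>index_set q r. finite_energy_law (\<pi>' j)" "\<nu>' = law_vector q r \<pi>'"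
      using admissible_law_vector[OF a] by blast
    have "prob_on_halfline (scaled_law 1 1 (\<pi>' 0))"
      using \<pi>'(1) idx0 by (intro prob_on_halfline_scaled_law finite_energy_law_dist) auto
    then have "nu_energy q r Vh A \<le> nu_energy q r Vh (scaled_law 1 1 (\<pi>' 0))"
      by (rule nuA)
    also have "\<dots> \<le> vector_energy q r Vh \<nu>'" unfolding \<pi>'(2) using \<pi>'(1) by (intro vector_energy_ge_nu_energy(1)) auto
    finally show ?thesis .
  qed
  have vec: "is_unique_minimizer (vector_energy q r Vh) (admissible q r) \<nu>"
    unfolding is_unique_minimizer_def
  proof (intro conjI allI impI)
    show "is_arg_min (vector_energy q r Vh) (admissible q r) \<nu>"
      unfolding is_arg_min_linorder val using adm lower by blast
    fix \<nu>' assume min': "is_arg_min (vector_energy q r Vh) (admissible q r) \<nu>'"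
    then have a: "admissible q r \<nu>'" by (simp add: is_arg_min_def)
    have le: "vector_energy q r Vh \<nu>' \<le> nu_energy q r Vh A"
      using min' adm unfolding is_arg_min_linorder val[symmetric] by blast
    obtain \<pi>' where \<pi>': "\<And>j. j \<in> index_set q r \<Longrightarrow> finite_energy_law (\<pi>' j)" "\<nu>' = law_vector q r \<pi>'"
      using admissible_law_vector[OF a] by blast
    note D0 = finite_energy_law_dist[OF \<pi>'(1)[OF idx0]]
    have half: "prob_on_halfline (scaled_law 1 1 (\<pi>' 0))" by (rule prob_on_halfline_scaled_law[OF D0])
    have "nu_energy q r Vh (scaled_law 1 1 (\<pi>' 0)) \<le> nu_energy q r Vh A"
      using vector_energy_ge_nu_energy(1)[of \<pi>', OF \<pi>'(1)] le unfolding \<pi>'(2) by (rule order_trans)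
    then have "is_arg_min (nu_energy q r Vh) prob_on_halfline (scaled_law 1 1 (\<pi>' 0))"
      using half nuA order_trans unfolding is_arg_min_linorder by blast
    then have A': "scaled_law 1 1 (\<pi>' 0) = A" using nu by (auto simp: is_unique_minimizer_def)
    then have P': "\<pi>' 0 = P" using scaled_law_inject[OF D0 finite_energy_law_dist[OF P(1)]] P(2) by simp
    have "defect_sum r (\<lambda>i. \<pi>' (int i)) + defect_sum q (\<lambda>i. \<pi>' (- int i)) \<le> 0"
    proof -
      have "nu_energy q r Vh A + ereal ((defect_sum r (\<lambda>i. \<pi>' (int i)) + defect_sum q (\<lambda>i. \<pi>' (- int i))) / 2) \<le> nu_energy q r Vh A"
        using vector_energy_ge_nu_energy(2)[of \<pi>', OF \<pi>'(1)] nuA_fin(1) le unfolding A' \<pi>'(2) by simp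
      then show ?thesis using nuA_fin by (cases "nu_energy q r Vh A") auto
    qed
    moreover have feR: "\<And>i. i < r \<Longrightarrow> finite_energy_law (\<pi>' (int i))" and feL: "\<And>i. i < q \<Longrightarrow> finite_energy_law (\<pi>' (- int i))"
      using \<pi>'(1) assms by (auto simp: index_set_int index_set_minus_int)
    ultimately have z: "defect_sum r (\<lambda>i. \<pi>' (int i)) = 0" "defect_sum q (\<lambda>i. \<pi>' (- int i)) = 0"
      using defect_sum_nonneg[of r "\<lambda>i. \<pi>' (int i)", OF feR] defect_sum_nonneg[of q "\<lambda>i. \<pi>' (- int i)", OF feL] by linarith+
    have eqR: "\<pi>' (int i) = \<alpha> i" if "i < r" for i
      by (rule chain_extension_unique[of r "\<lambda>i. \<pi>' (int i)" \<alpha>])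
         (use feR \<alpha> P' that defect_sum_zeroD[of r "\<lambda>i. \<pi>' (int i)", OF feR z(1)] in auto)
    have eqL: "\<pi>' (- int i) = \<beta> i" if "i < q" for i
      by (rule chain_extension_unique[of q "\<lambda>i. \<pi>' (- int i)" \<beta>])
         (use feL \<beta> P' that defect_sum_zeroD[of q "\<lambda>i. \<pi>' (- int i)", OF feL z(2)] in auto)
    have "\<pi>' j = \<pi> j" if "j \<in> index_set q r" for j
      using that by (rule index_set_cases) (auto simp: \<pi>R \<pi>L eqR eqL)
    then show "\<nu>' = \<nu>" unfolding \<pi>'(2) \<nu>_def law_vector_def by (intro restrict_ext) simp
  qed
  have "compact (measure_support A)"
  proof -
    have sub: "measure_support A \<subseteq> {0..R}" using R(2) by (intro support_subset_closed) auto
    have "- measure_support A = \<Union>{U. open U \<and> emeasure A U = 0}"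
      unfolding measure_support_def by (auto simp: zero_less_iff_neq_zero)
    then have "open (- measure_support A)" by (auto intro: open_Union)
    then have "closed (measure_support A)" by (simp add: closed_def)
    then show ?thesis using sub compact_Icc by (metis compact_Int_closed inf.absorb_iff2)
  qed
  then show ?thesis using vec nu mu \<nu>0A by (intro exI[of _ \<nu>]) simp
qed

end
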